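(* Let $w(x)=\dfrac1{1+\sinh^2(x)}$, $x\in\mathbb{R}$, and let $\mathcal{D}_S=\{f\in\mathcal{V}_{w,0}:-f''\in L^2_w(\mathbb{R}),\ x^2\sinh x\,f\in L^2_w(\mathbb{R})\}$ be equipped with the Hilbert space norm $$\|f\|_S^2=\|f''\|_w^2+\|x^2\sinh x\,f\|_w^2+\|f\|_w^2.$$ Let $\mathcal{A}$ be the operator in $L^2(\mathbb{R})\oplus L^2(\mathbb{R})$ acting as $$\mathcal{A}=\begin{pmatrix} -\partial_x^2 & \mathrm{i}\sinh x \\ {x^2} & 0 \end{pmatrix}$$ with domain $$\operatorname{Dom}(\mathcal{A})=\{(f,g)\in\mathcal{D}_S\oplus L^2(\mathbb{R}):-f''+\mathrm{i}\sinh x\,g\in L^2(\mathbb{R})\}.$$ Then $\mathcal{A}$ is closed, has non-empty resolvent set, and its domain is dense in both $\mathcal{D}_S\oplus L^2(\mathbb{R})$ and $L^2(\mathbb{R})\oplus L^2(\mathbb{R})$.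
   Context: $L^2_w(\mathbb{R})$ is the Hilbert space of measurable $f$ with $\|f\|_w^2=\int_{\mathbb{R}}|f|^2w\,dx<\infty$. $\mathcal{V}_{w,0}$ is the closure of $C_0^\infty(\mathbb{R})$ in the Hilbert space $\mathcal{V}_w=\{f\in L^2_w(\mathbb{R}):f'\in L^1_{\mathrm{loc}}(\mathbb{R}),\ |V|^{1/2}|f|+|f'|\in L^2_w(\mathbb{R})\}$ with norm $\|f\|_{\mathcal{V}_w}^2=\|f'\|_w^2+\||V|^{1/2}f\|_w^2+\|f\|_w^2$, where $V(x)=-\lambda+\frac{\mathrm{i}}{\lambda}x^2\sinh x$ for some fixed $\lambda<-1$ (the space $\mathcal{V}_{w,0}$ does not depend on $\lambda$, up to equivalent norms). Derivatives are distributional. *)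

theory Defs
  imports "HOL-Analysis.Analysis" "HOL-Library.Function_Algebras"
begin

text \<open>
  Elements of the spaces below are represented by Borel measurable functions
  \<^typ>\<open>real \<Rightarrow> complex\<close>; the Hilbert space proper is the quotient by equality
  almost everywhere, that is, by the null space of the (semi)norm.  Every Lebesgue class has
  a Borel representative.  Sums and differences of functions and of pairs are pointwise.
\<close>

section \<open>Unbounded operators in a seminormed space\<close>

text \<open>
  A carrier \<open>H\<close> with scalar multiplication \<open>sc\<close> and seminorm \<open>N\<close>
  stands for the normed space \<open>H / {x. N x = 0}\<close>, so equality of vectors \<open>x\<close>,
  \<open>y\<close> reads \<open>N (x - y) = 0\<close>.  An operator is given by its domain \<open>D\<close>
  and its action \<open>T\<close>.
\<close>

definition linear_operator ::
  "(complex \<Rightarrow> 'v \<Rightarrow> 'v) \<Rightarrow> 'v set \<Rightarrow> ('v \<Rightarrow> real) \<Rightarrow> 'v set \<Rightarrow> ('v \<Rightarrow> 'v::ab_group_add) \<Rightarrow> bool" where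
  "linear_operator sc H N D T \<longleftrightarrow>
     D \<subseteq> H \<and> T ` D \<subseteq> H \<and> 0 \<in> D \<and>
     (\<forall>p\<in>D. \<forall>q\<in>D. p + q \<in> D \<and> N (T (p + q) - (T p + T q)) = 0) \<and>
     (\<forall>c. \<forall>p\<in>D. sc c p \<in> D \<and> N (T (sc c p) - sc c (T p)) = 0)"

text \<open>
  Taking constant sequences in the last clause shows that \<open>D\<close> and \<open>T\<close> are compatible
  with equality modulo the null space of \<open>N\<close>.
\<close>

definition closed_operator ::
  "(complex \<Rightarrow> 'v \<Rightarrow> 'v) \<Rightarrow> 'v set \<Rightarrow> ('v \<Rightarrow> real) \<Rightarrow> 'v set \<Rightarrow> ('v \<Rightarrow> 'v::ab_group_add) \<Rightarrow> bool" where
  "closed_operator sc H N D T \<longleftrightarrow>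
     linear_operator sc H N D T \<and>
     (\<forall>p u v. (\<forall>n::nat. p n \<in> D) \<longrightarrow> u \<in> H \<longrightarrow> v \<in> H \<longrightarrow>
        (\<lambda>n. N (p n - u)) \<longlonglongrightarrow> 0 \<longrightarrow> (\<lambda>n. N (T (p n) - v)) \<longlonglongrightarrow> 0 \<longrightarrow>
        u \<in> D \<and> N (T u - v) = 0)"

text \<open>
  \<open>z\<close> is in the resolvent set if \<open>T - z : D \<rightarrow> H\<close> has a two-sided inverse
  \<open>R : H \<rightarrow> D\<close> which is bounded on \<open>H\<close>.
\<close>

definition resolvent_set ::
  "(complex \<Rightarrow> 'v \<Rightarrow> 'v) \<Rightarrow> 'v set \<Rightarrow> ('v \<Rightarrow> real) \<Rightarrow> 'v set \<Rightarrow> ('v \<Rightarrow> 'v::ab_group_add) \<Rightarrow> complex set" where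
  "resolvent_set sc H N D T =
     {z. \<exists>R. (\<forall>q\<in>H. R q \<in> D \<and> N (T (R q) - sc z (R q) - q) = 0) \<and>
             (\<forall>p\<in>D. N (R (T p - sc z p) - p) = 0) \<and>
             (\<exists>C. \<forall>q\<in>H. N (R q) \<le> C * N q)}"

definition dense_in :: "('v \<Rightarrow> real) \<Rightarrow> 'v set \<Rightarrow> 'v::ab_group_add set \<Rightarrow> bool" where
  "dense_in N D H \<longleftrightarrow> D \<subseteq> H \<and> (\<forall>x\<in>H. \<forall>e>0. \<exists>y\<in>D. N (x - y) < e)"

definition dsum_norm :: "('a \<Rightarrow> real) \<Rightarrow> ('b \<Rightarrow> real) \<Rightarrow> 'a \<times> 'b \<Rightarrow> real" where
  "dsum_norm N M p = sqrt ((N (fst p))\<^sup>2 + (M (snd p))\<^sup>2)"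


section \<open>Weighted square integrable functions and distributional derivatives\<close>

type_synonym cfun = "real \<Rightarrow> complex"

definition L2 :: "(real \<Rightarrow> real) \<Rightarrow> cfun set" where
  "L2 \<rho> = {f \<in> borel_measurable lborel. integrable lborel (\<lambda>x. (cmod (f x))\<^sup>2 * \<rho> x)}"

definition L2_norm :: "(real \<Rightarrow> real) \<Rightarrow> cfun \<Rightarrow> real" where
  "L2_norm \<rho> f = sqrt (\<integral>x. (cmod (f x))\<^sup>2 * \<rho> x \<partial>lborel)"

definition loc_integrable :: "cfun \<Rightarrow> bool" where
  "loc_integrable f \<longleftrightarrow> (\<forall>a b. set_integrable lborel {a..b} f)"

definition vderiv :: "cfun \<Rightarrow> cfun" where
  "vderiv \<phi> = (\<lambda>x. vector_derivative \<phi> (at x))"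

definition test_funs :: "cfun set" where
  "test_funs = {\<phi>. (\<forall>n. (vderiv ^^ n) \<phi> differentiable_on UNIV) \<and> compact (closure {x. \<phi> x \<noteq> 0})}"

definition has_weak_deriv :: "cfun \<Rightarrow> cfun \<Rightarrow> bool" where
  "has_weak_deriv f g \<longleftrightarrow> loc_integrable f \<and> loc_integrable g \<and>
     (\<forall>\<phi>\<in>test_funs. (\<integral>x. f x * vderiv \<phi> x \<partial>lborel) = - (\<integral>x. g x * \<phi> x \<partial>lborel))"

text \<open>The distributional derivative of \<open>f\<close> is a locally integrable function:\<close>

definition weakly_diff :: "cfun \<Rightarrow> bool" where
  "weakly_diff f \<longleftrightarrow> (\<exists>g. has_weak_deriv f g)"

text \<open>Determined almost everywhere, and meaningful only if \<^term>\<open>weakly_diff f\<close>:\<close>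

definition weak_deriv :: "cfun \<Rightarrow> cfun" where
  "weak_deriv f = (SOME g. has_weak_deriv f g)"


section \<open>The form domain and the operator matrix\<close>

definition w :: "real \<Rightarrow> real" where
  "w x = 1 / (1 + (sinh x)\<^sup>2)"

definition V :: "real \<Rightarrow> real \<Rightarrow> complex" where
  "V lam x = - complex_of_real lam + \<i> / complex_of_real lam * complex_of_real (x\<^sup>2 * sinh x)"

definition Vw :: "real \<Rightarrow> cfun set" where
  "Vw lam = {f \<in> L2 w. weakly_diff f \<and>
     (\<lambda>x. complex_of_real (sqrt (cmod (V lam x)) * cmod (f x) + cmod (weak_deriv f x))) \<in> L2 w}"

definition Vw_norm :: "real \<Rightarrow> cfun \<Rightarrow> real" where
  "Vw_norm lam f = sqrt ((L2_norm w (weak_deriv f))\<^sup>2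
     + (L2_norm w (\<lambda>x. complex_of_real (sqrt (cmod (V lam x))) * f x))\<^sup>2 + (L2_norm w f)\<^sup>2)"

definition Vw0 :: "real \<Rightarrow> cfun set" where
  "Vw0 lam = {f \<in> Vw lam. \<forall>e>0. \<exists>\<phi>\<in>test_funs. Vw_norm lam (f - \<phi>) < e}"

definition DS :: "real \<Rightarrow> cfun set" where
  "DS lam = {f \<in> Vw0 lam. weakly_diff (weak_deriv f) \<and>
     (\<lambda>x. - weak_deriv (weak_deriv f) x) \<in> L2 w \<and>
     (\<lambda>x. complex_of_real (x\<^sup>2 * sinh x) * f x) \<in> L2 w}"

definition DS_norm :: "cfun \<Rightarrow> real" where
  "DS_norm f = sqrt ((L2_norm w (weak_deriv (weak_deriv f)))\<^sup>2
     + (L2_norm w (\<lambda>x. complex_of_real (x\<^sup>2 * sinh x) * f x))\<^sup>2 + (L2_norm w f)\<^sup>2)"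

abbreviation L2R :: "cfun set" where
  "L2R \<equiv> L2 (\<lambda>_. 1)"

abbreviation L2R_norm :: "cfun \<Rightarrow> real" where
  "L2R_norm \<equiv> L2_norm (\<lambda>_. 1)"

definition pair_scale :: "complex \<Rightarrow> cfun \<times> cfun \<Rightarrow> cfun \<times> cfun" where
  "pair_scale c p = (\<lambda>x. c * fst p x, \<lambda>x. c * snd p x)"

definition A :: "cfun \<times> cfun \<Rightarrow> cfun \<times> cfun" where
  "A = (\<lambda>(f, g).
     (\<lambda>x. - weak_deriv (weak_deriv f) x + \<i> * complex_of_real (sinh x) * g x,
      \<lambda>x. complex_of_real (x\<^sup>2) * f x))"

definition DomA :: "real \<Rightarrow> (cfun \<times> cfun) set" where
  "DomA lam = {(f, g). f \<in> DS lam \<and> g \<in> L2R \<and>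
     (\<lambda>x. - weak_deriv (weak_deriv f) x + \<i> * complex_of_real (sinh x) * g x) \<in> L2R}"

end

theory Submission
  imports Defs
begin

text \<open>
  Eliminating the second component from \<open>(A - z) (f, g) = (h\<^sub>1, h\<^sub>2)\<close> leaves the Schur
  complement equation \<open>- f'' - z f + (\<i> / z) x\<^sup>2 sinh x f = h\<^sub>1 + (\<i> / z) sinh x h\<^sub>2\<close>, whose
  right-hand side lies in the weighted space.  For \<open>z = -3\<close> it reads \<open>f'' = Q f - h\<close> with
  \<open>Q = 3 - \<i> q / 3\<close>, \<open>q = x\<^sup>2 sinh x\<close>.  Multiplying by \<open>cnj f w\<close> and taking real parts controls
  \<open>f\<close> and \<open>f'\<close>, because \<open>\<bar>w'\<bar> \<le> 2 w\<close>; multiplying by \<open>q cnj f w\<close> and taking imaginary parts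
  controls \<open>q f\<close>, because \<open>\<bar>q'\<bar> \<le> 5 \<bar>q\<bar> + 5\<close>.  These bounds do not depend on \<open>R\<close> for the Dirichlet problem
  on \<open>[-R, R]\<close>, which is solved by shooting.  The Cauchy data at \<open>0\<close> of these solutions stay
  bounded, so that a subsequence converges to a solution on the whole line.  As
  \<open>1 + x\<^sup>4 \<le> 8 (1 + q\<^sup>2) w\<close>, the resulting inverse is bounded in the unweighted norm.
  Closedness follows from the bounded inverse, and the two density statements from
  cutting off.
\<close>

section \<open>Weighted square integrable functions\<close>

text \<open>The weight makes room for the Schur complement because \<open>sinh x\<close> squared
  times \<open>w x\<close> is at most 1, while sinh x h2 itself need not be square integrable. The
  potential (i / z) q is imaginary for real z and q changes sign, so the real part of the energy
  identity does not see q at all; this is why q f needs a second identity with its own multiplier.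
  The point z = -3 is dictated by the real part: the drift term w' f' cnj f costs 2 |f|^2 w once
  half of |f'|^2 w is given up, the source costs another half, and 3 still leaves a positive
  remainder.

  In one dimension ordinary differential equations can take the place of a variational existence
  theory. The truncated problem becomes a 2 by 2 linear system for the Cauchy data at 0, its
  solvability follows from uniqueness, which is the energy estimate with zero source, and
  compactness is needed only for two complex numbers. Solutions depend affinely on these, so they
  converge pointwise.

  Since \<open>weak_deriv\<close> is a choice among almost everywhere equal functions, computations
  are carried out on continuous representatives linked by \<open>prim\<close>.\<close>

lemma square_add_le: "(a + b)\<^sup>2 \<le> 2 * a\<^sup>2 + 2 * b\<^sup>2" for a b :: real
  using zero_le_power2[of "a - b"] by (simp add: power2_eq_square algebra_simps)

lemma cmod_add_square_le: "(cmod (a + b))\<^sup>2 \<le> 2 * (cmod a)\<^sup>2 + 2 * (cmod b)\<^sup>2"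
  by (rule order_trans[OF power_mono[OF norm_triangle_ineq] square_add_le]) simp

lemma two_mult_le_squares: "2 * a * b \<le> a\<^sup>2 + b\<^sup>2" for a b :: real
  using zero_le_power2[of "a - b"] by (simp add: power2_eq_square algebra_simps)

definition weight :: "(real \<Rightarrow> real) \<Rightarrow> bool" where
  "weight \<rho> \<longleftrightarrow> \<rho> \<in> borel_measurable borel \<and> (\<forall>x. 0 < \<rho> x)"

lemma weight_measurable: "weight \<rho> \<Longrightarrow> \<rho> \<in> borel_measurable borel"
  by (simp add: weight_def)

lemma weight_pos: "weight \<rho> \<Longrightarrow> 0 < \<rho> x"
  by (simp add: weight_def)

lemma weight_one: "weight (\<lambda>_. 1)"
  by (simp add: weight_def)

lemma cosh_square_real: "(cosh x)\<^sup>2 = 1 + (sinh x)\<^sup>2" for x :: real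
  using hyperbolic_pythagoras[of x] by simp

lemma w_eq: "w x = 1 / (cosh x)\<^sup>2"
  by (simp add: w_def cosh_square_real)

lemma continuous_w: "continuous_on S w"
proof -
  have "1 + (sinh x)\<^sup>2 \<noteq> 0" for x :: real
    by (smt (verit) zero_le_power2)
  then show ?thesis
    unfolding w_def by (intro continuous_intros) auto
qed

lemma weight_w: "weight w"
  unfolding weight_def using borel_measurable_continuous_onI[OF continuous_w]
  by (auto simp: w_def intro!: add_pos_nonneg)

lemma L2_measurable: "f \<in> L2 \<rho> \<Longrightarrow> f \<in> borel_measurable borel"
  by (simp add: L2_def)

lemma L2_integrable: "f \<in> L2 \<rho> \<Longrightarrow> integrable lborel (\<lambda>x. (cmod (f x))\<^sup>2 * \<rho> x)"
  by (simp add: L2_def)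

lemma L2_dominated:
  assumes "weight \<rho>" "f \<in> borel_measurable borel" "integrable lborel k"
    and "AE x in lborel. (cmod (f x))\<^sup>2 * \<rho> x \<le> k x"
  shows "f \<in> L2 \<rho>"
proof -
  note [measurable] = assms(2) weight_measurable[OF assms(1)]
  have "integrable lborel (\<lambda>x. (cmod (f x))\<^sup>2 * \<rho> x)"
  proof (rule Bochner_Integration.integrable_bound[OF assms(3)])
    show "AE x in lborel. norm ((cmod (f x))\<^sup>2 * \<rho> x) \<le> norm (k x)"
      using assms(4)
    proof eventually_elim
      case (elim x)
      moreover have "0 \<le> (cmod (f x))\<^sup>2 * \<rho> x"
        using weight_pos[OF assms(1), of x] by simp
      ultimately show ?case by simp
    qed
  qed measurable
  then show ?thesis
    using assms(2) by (simp add: L2_def)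
qed

lemma L2_bound:
  assumes "weight \<rho>" "f \<in> borel_measurable borel" "h \<in> L2 \<rho>"
    and "AE x in lborel. cmod (f x) \<le> c * cmod (h x)"
  shows "f \<in> L2 \<rho>"
proof (rule L2_dominated[OF assms(1,2)])
  show "integrable lborel (\<lambda>x. c\<^sup>2 * ((cmod (h x))\<^sup>2 * \<rho> x))"
    using L2_integrable[OF assms(3)] by simp
  show "AE x in lborel. (cmod (f x))\<^sup>2 * \<rho> x \<le> c\<^sup>2 * ((cmod (h x))\<^sup>2 * \<rho> x)"
    using assms(4)
  proof eventually_elim
    case (elim x)
    have "(cmod (f x))\<^sup>2 \<le> (c * cmod (h x))\<^sup>2"
      using elim by (intro power_mono) auto
    from mult_right_mono[OF this less_imp_le[OF weight_pos[OF assms(1), of x]]]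
    show ?case by (simp add: power_mult_distrib mult.assoc)
  qed
qed

lemma L2_AE_cong:
  assumes "weight \<rho>" "f \<in> borel_measurable borel" "h \<in> L2 \<rho>" "AE x in lborel. f x = h x"
  shows "f \<in> L2 \<rho>"
  by (rule L2_bound[OF assms(1-3), of 1]) (use assms(4) in auto)

lemma L2_add:
  assumes "weight \<rho>" "f \<in> L2 \<rho>" "g \<in> L2 \<rho>"
  shows "(\<lambda>x. f x + g x) \<in> L2 \<rho>"
proof (rule L2_dominated[OF assms(1)])
  show "(\<lambda>x. f x + g x) \<in> borel_measurable borel"
    using assms(2,3)[THEN L2_measurable] by measurable
  show "integrable lborel (\<lambda>x. 2 * ((cmod (f x))\<^sup>2 * \<rho> x) + 2 * ((cmod (g x))\<^sup>2 * \<rho> x))"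
    using assms(2,3)[THEN L2_integrable] by simp
  show "AE x in lborel. (cmod (f x + g x))\<^sup>2 * \<rho> x
      \<le> 2 * ((cmod (f x))\<^sup>2 * \<rho> x) + 2 * ((cmod (g x))\<^sup>2 * \<rho> x)"
  proof (rule AE_I2)
    fix x
    show "(cmod (f x + g x))\<^sup>2 * \<rho> x
      \<le> 2 * ((cmod (f x))\<^sup>2 * \<rho> x) + 2 * ((cmod (g x))\<^sup>2 * \<rho> x)"
      using mult_right_mono[OF cmod_add_square_le less_imp_le[OF weight_pos[OF assms(1), of x]]]
      by (simp add: algebra_simps)
  qed
qed

lemma L2_cmult: "f \<in> L2 \<rho> \<Longrightarrow> (\<lambda>x. c * f x) \<in> L2 \<rho>"
  by (auto simp: L2_def norm_mult power_mult_distrib mult.assoc)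

lemma L2_minus: "f \<in> L2 \<rho> \<Longrightarrow> (\<lambda>x. - f x) \<in> L2 \<rho>"
  by (auto simp: L2_def)

lemma L2_diff:
  assumes "weight \<rho>" "f \<in> L2 \<rho>" "g \<in> L2 \<rho>"
  shows "(\<lambda>x. f x - g x) \<in> L2 \<rho>"
  using L2_add[OF assms(1,2) L2_minus[OF assms(3)]] by simp

lemma L2_zero: "(\<lambda>_. 0) \<in> L2 \<rho>"
  by (simp add: L2_def)

lemma L2_norm_nonneg: "0 \<le> L2_norm \<rho> f" if "weight \<rho>"
  unfolding L2_norm_def using weight_pos[OF that] by (simp add: less_imp_le[OF weight_pos[OF that]])

lemma L2_norm_square: "(L2_norm \<rho> f)\<^sup>2 = (\<integral>x. (cmod (f x))\<^sup>2 * \<rho> x \<partial>lborel)" if "weight \<rho>"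
  unfolding L2_norm_def using less_imp_le[OF weight_pos[OF that]]
  by (intro real_sqrt_pow2 integral_nonneg) simp

lemma L2_norm_AE_cong:
  assumes "weight \<rho>" "f \<in> borel_measurable borel" "h \<in> borel_measurable borel"
    "AE x in lborel. f x = h x"
  shows "L2_norm \<rho> f = L2_norm \<rho> h"
proof -
  note [measurable] = assms(2,3) weight_measurable[OF assms(1)]
  have "(\<integral>x. (cmod (f x))\<^sup>2 * \<rho> x \<partial>lborel) = (\<integral>x. (cmod (h x))\<^sup>2 * \<rho> x \<partial>lborel)"
    by (rule integral_cong_AE) (use assms(4) in auto)
  then show ?thesis by (simp add: L2_norm_def)
qed

lemma L2_norm_add_square:
  assumes "weight \<rho>" "f \<in> L2 \<rho>" "g \<in> L2 \<rho>"
  shows "(L2_norm \<rho> (\<lambda>x. f x + g x))\<^sup>2 \<le> 2 * (L2_norm \<rho> f)\<^sup>2 + 2 * (L2_norm \<rho> g)\<^sup>2"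
proof -
  note i = assms(2,3)[THEN L2_integrable]
  have "(\<integral>x. (cmod (f x + g x))\<^sup>2 * \<rho> x \<partial>lborel)
      \<le> (\<integral>x. 2 * ((cmod (f x))\<^sup>2 * \<rho> x) + 2 * ((cmod (g x))\<^sup>2 * \<rho> x) \<partial>lborel)"
  proof (rule integral_mono)
    show "(cmod (f x + g x))\<^sup>2 * \<rho> x
      \<le> 2 * ((cmod (f x))\<^sup>2 * \<rho> x) + 2 * ((cmod (g x))\<^sup>2 * \<rho> x)" for x
      using mult_right_mono[OF cmod_add_square_le less_imp_le[OF weight_pos[OF assms(1), of x]]]
      by (simp add: algebra_simps)
  qed (use i L2_integrable[OF L2_add[OF assms]] in auto)
  also have "\<dots> = 2 * (\<integral>x. (cmod (f x))\<^sup>2 * \<rho> x \<partial>lborel) + 2 * (\<integral>x. (cmod (g x))\<^sup>2 * \<rho> x \<partial>lborel)"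
    using i by simp
  finally show ?thesis
    by (simp add: L2_norm_square[OF assms(1)])
qed

lemma L2_norm_diff_square:
  assumes "weight \<rho>" "f \<in> L2 \<rho>" "g \<in> L2 \<rho>"
  shows "(L2_norm \<rho> (\<lambda>x. f x - g x))\<^sup>2 \<le> 2 * (L2_norm \<rho> f)\<^sup>2 + 2 * (L2_norm \<rho> g)\<^sup>2"
  using L2_norm_add_square[OF assms(1,2) L2_minus[OF assms(3)]] by (simp add: L2_norm_def)

lemma L2_norm_cmult: "L2_norm \<rho> (\<lambda>x. c * f x) = cmod c * L2_norm \<rho> f"
  by (simp add: L2_norm_def norm_mult power_mult_distrib mult.assoc real_sqrt_mult)

lemma L2_norm_zero: "L2_norm \<rho> (\<lambda>_. 0) = 0"
  by (simp add: L2_norm_def)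

lemma L2_norm_eq_0_iff:
  assumes "weight \<rho>" "f \<in> L2 \<rho>"
  shows "L2_norm \<rho> f = 0 \<longleftrightarrow> (AE x in lborel. f x = 0)"
proof -
  have "L2_norm \<rho> f = 0 \<longleftrightarrow> (\<integral>x. (cmod (f x))\<^sup>2 * \<rho> x \<partial>lborel) = 0"
    by (simp add: L2_norm_def)
  also have "\<dots> \<longleftrightarrow> (AE x in lborel. (cmod (f x))\<^sup>2 * \<rho> x = 0)"
    by (rule integral_nonneg_eq_0_iff_AE[OF L2_integrable[OF assms(2)]])
      (auto simp: less_imp_le[OF weight_pos[OF assms(1)]])
  also have "\<dots> \<longleftrightarrow> (AE x in lborel. f x = 0)"
    using weight_pos[OF assms(1)] by (simp add: less_imp_neq[symmetric])
  finally show ?thesis .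
qed

text \<open>Cut-offs, truncations and smooth approximations all obtain their norm convergence from
  this form, with one square integrable majorant \<open>k\<close> and a constant
  \<open>c\<close>.\<close>

lemma L2_norm_dominated_convergence:
  assumes "weight \<rho>" and "\<And>n. f n \<in> borel_measurable borel" and "k \<in> L2 \<rho>"
    and "AE x in lborel. (\<lambda>n. f n x) \<longlonglongrightarrow> 0" and "\<And>n. AE x in lborel. cmod (f n x) \<le> c * cmod (k x)"
  shows "(\<lambda>n. L2_norm \<rho> (f n)) \<longlonglongrightarrow> 0"
proof -
  note [measurable] = assms(2) weight_measurable[OF assms(1)]
  have "(\<lambda>n. \<integral>x. (cmod (f n x))\<^sup>2 * \<rho> x \<partial>lborel) \<longlonglongrightarrow> (\<integral>x. 0 \<partial>(lborel :: real measure))"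
  proof (rule integral_dominated_convergence)
    show "integrable lborel (\<lambda>x. c\<^sup>2 * ((cmod (k x))\<^sup>2 * \<rho> x))"
      using L2_integrable[OF assms(3)] by simp
    show "AE x in lborel. (\<lambda>n. (cmod (f n x))\<^sup>2 * \<rho> x) \<longlonglongrightarrow> 0"
      using assms(4)
    proof eventually_elim
      case (elim x)
      have "(\<lambda>n. (cmod (f n x))\<^sup>2 * \<rho> x) \<longlonglongrightarrow> (cmod 0)\<^sup>2 * \<rho> x"
        by (intro tendsto_intros elim)
      then show ?case by simp
    qed
    show "AE x in lborel. norm ((cmod (f n x))\<^sup>2 * \<rho> x) \<le> c\<^sup>2 * ((cmod (k x))\<^sup>2 * \<rho> x)" for n
      using assms(5)[of n]
    proof eventually_elim
      case (elim x)
      have "(cmod (f n x))\<^sup>2 \<le> (c * cmod (k x))\<^sup>2"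
        using elim by (intro power_mono) auto
      from mult_right_mono[OF this less_imp_le[OF weight_pos[OF assms(1), of x]]]
      show ?case
        by (simp add: power_mult_distrib mult.assoc abs_mult less_imp_le[OF weight_pos[OF assms(1)]])
    qed
  qed measurable
  then have "(\<lambda>n. sqrt (\<integral>x. (cmod (f n x))\<^sup>2 * \<rho> x \<partial>lborel)) \<longlonglongrightarrow> sqrt 0"
    by (intro tendsto_real_sqrt) simp
  then show ?thesis by (simp add: L2_norm_def)
qed

lemma L2_mult_integrable:
  assumes "weight \<rho>" "f \<in> L2 \<rho>" "g \<in> L2 \<rho>"
  shows "integrable lborel (\<lambda>x. f x * g x * complex_of_real (\<rho> x))"
proof (rule Bochner_Integration.integrable_bound)
  note [measurable] = assms(2,3)[THEN L2_measurable] weight_measurable[OF assms(1)]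
  show "integrable lborel (\<lambda>x. (cmod (f x))\<^sup>2 * \<rho> x + (cmod (g x))\<^sup>2 * \<rho> x)"
    using assms(2,3)[THEN L2_integrable] by simp
  show "(\<lambda>x. f x * g x * complex_of_real (\<rho> x)) \<in> borel_measurable lborel"
    by measurable
  show "AE x in lborel. norm (f x * g x * complex_of_real (\<rho> x))
      \<le> norm ((cmod (f x))\<^sup>2 * \<rho> x + (cmod (g x))\<^sup>2 * \<rho> x)"
  proof (rule AE_I2)
    fix x
    have "0 < \<rho> x" by (rule weight_pos[OF assms(1)])
    have "cmod (f x) * cmod (g x) \<le> (cmod (f x))\<^sup>2 + (cmod (g x))\<^sup>2"
      using two_mult_le_squares[of "cmod (f x)" "cmod (g x)"]
        mult_nonneg_nonneg[OF norm_ge_zero[of "f x"] norm_ge_zero[of "g x"]] by linarith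
    from mult_right_mono[OF this less_imp_le[OF \<open>0 < \<rho> x\<close>]] \<open>0 < \<rho> x\<close>
    show "norm (f x * g x * complex_of_real (\<rho> x))
      \<le> norm ((cmod (f x))\<^sup>2 * \<rho> x + (cmod (g x))\<^sup>2 * \<rho> x)"
      by (simp add: norm_mult algebra_simps)
  qed
qed

section \<open>Locally absolutely continuous functions\<close>

text \<open>Local integrability speaks only about truncations of \<open>f\<close>, so measurability
  on the line is recovered as a pointwise limit of truncations.\<close>

lemma loc_integrable_measurable:
  assumes "loc_integrable f"
  shows "f \<in> borel_measurable borel"
proof (rule borel_measurable_LIMSEQ_metric[where f = "\<lambda>n x. indicator {- real n .. real n} x *\<^sub>R f x"])
  show "(\<lambda>x. indicator {- real n..real n} x *\<^sub>R f x) \<in> borel_measurable borel" for n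
  proof -
    have "integrable lborel (\<lambda>x. indicator {- real n..real n} x *\<^sub>R f x)"
      using assms by (simp add: loc_integrable_def set_integrable_def)
    then show ?thesis
      using borel_measurable_integrable by simp
  qed
next
  fix x :: real
  obtain N :: nat where N: "\<bar>x\<bar> \<le> real N" using real_arch_simple by blast
  show "(\<lambda>n. indicator {- real n..real n} x *\<^sub>R f x) \<longlonglongrightarrow> f x"
    by (rule tendsto_eventually, rule eventually_sequentiallyI[of N]) (use N in \<open>auto simp: indicator_def\<close>)
qed

lemma loc_integrable_set_integrable: "loc_integrable f \<Longrightarrow> set_integrable lborel {a..b} f"
  by (simp add: loc_integrable_def)

lemma loc_integrable_mult_bounded:
  assumes "loc_integrable g" "h \<in> borel_measurable borel"
    and "\<And>a b. \<exists>B. \<forall>x\<in>{a..b}. cmod (h x) \<le> B"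
  shows "loc_integrable (\<lambda>x. g x * h x)"
  unfolding loc_integrable_def
proof (intro allI)
  fix a b :: real
  obtain B where B: "\<forall>x\<in>{a..b}. cmod (h x) \<le> B"
    using assms(3) by blast
  note [measurable] = assms(2) loc_integrable_measurable[OF assms(1)]
  show "set_integrable lborel {a..b} (\<lambda>x. g x * h x)"
    unfolding set_integrable_def
  proof (rule Bochner_Integration.integrable_bound)
    show "integrable lborel (\<lambda>x. B * cmod (indicator {a..b} x *\<^sub>R g x))"
      using loc_integrable_set_integrable[OF assms(1)] unfolding set_integrable_def
      by (intro integrable_mult_right integrable_norm)
    show "(\<lambda>x. indicator {a..b} x *\<^sub>R (g x * h x)) \<in> borel_measurable lborel"
      by measurable
    show "AE x in lborel. norm (indicator {a..b} x *\<^sub>R (g x * h x)) \<le> norm (B * cmod (indicator {a..b} x *\<^sub>R g x))"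
    proof (rule AE_I2)
      fix x
      show "norm (indicator {a..b} x *\<^sub>R (g x * h x)) \<le> norm (B * cmod (indicator {a..b} x *\<^sub>R g x))"
      proof (cases "x \<in> {a..b}")
        case True
        then have "cmod (h x) \<le> \<bar>B\<bar>" using B by force
        from mult_right_mono[OF this norm_ge_zero[of "g x"]] show ?thesis
            using True by (simp add: norm_mult abs_mult mult.commute)
      qed auto
    qed
  qed
qed

lemma continuous_locally_bounded:
  fixes h :: cfun
  assumes "continuous_on UNIV h"
  shows "\<exists>B. \<forall>x\<in>{a..b}. cmod (h x) \<le> B"
proof -
  have "compact (h ` {a..b})"
    by (rule compact_continuous_image[OF continuous_on_subset[OF assms]]) auto
  then show ?thesis
    by (auto dest!: compact_imp_bounded simp: bounded_iff)
qed

lemma loc_integrable_mult_continuous: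
  assumes "loc_integrable g" "continuous_on UNIV h"
  shows "loc_integrable (\<lambda>x. g x * h x)"
  by (intro loc_integrable_mult_bounded assms borel_measurable_continuous_onI
      continuous_locally_bounded)

lemma loc_integrable_continuous: "continuous_on UNIV g \<Longrightarrow> loc_integrable g"
  unfolding loc_integrable_def by (intro allI borel_integrable_atLeastAtMost') (auto intro: continuous_on_subset)

lemma loc_integrable_add: "loc_integrable f \<Longrightarrow> loc_integrable g \<Longrightarrow> loc_integrable (\<lambda>x. f x + g x)"
  unfolding loc_integrable_def by auto

lemma loc_integrable_cmult: "loc_integrable f \<Longrightarrow> loc_integrable (\<lambda>x. c * f x)"
  unfolding loc_integrable_def by auto

lemma loc_integrable_diff: "loc_integrable f \<Longrightarrow> loc_integrable g \<Longrightarrow> loc_integrable (\<lambda>x. f x - g x)"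
  unfolding loc_integrable_def by auto

lemma loc_integrable_AE_cong:
  assumes "loc_integrable f" "g \<in> borel_measurable borel" "AE x in lborel. f x = g x"
  shows "loc_integrable g"
  unfolding loc_integrable_def set_integrable_def
proof (intro allI)
  fix a b :: real
  note [measurable] = assms(2) loc_integrable_measurable[OF assms(1)]
  have "integrable lborel (\<lambda>x. indicator {a..b} x *\<^sub>R g x) \<longleftrightarrow> integrable lborel (\<lambda>x. indicator {a..b} x *\<^sub>R f x)"
    by (rule integrable_cong_AE) (use assms(3) in auto)
  then show "integrable lborel (\<lambda>x. indicator {a..b} x *\<^sub>R g x)"
    using loc_integrable_set_integrable[OF assms(1), of a b] by (simp add: set_integrable_def)
qed

lemma loc_integrable_cnj: "loc_integrable f \<Longrightarrow> loc_integrable (\<lambda>x. cnj (f x))"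
  unfolding loc_integrable_def set_integrable_def
proof (intro allI)
  fix a b :: real
  assume "\<forall>a b. integrable lborel (\<lambda>x. indicator {a..b} x *\<^sub>R f x)"
  then have "integrable lborel (\<lambda>x. cnj (indicator {a..b} x *\<^sub>R f x))"
    by (intro integrable_cnj) blast
  then show "integrable lborel (\<lambda>x. indicator {a..b} x *\<^sub>R cnj (f x))"
    by simp
qed

lemma set_integral_split:
  assumes "loc_integrable g" "a \<le> c" "c \<le> b"
  shows "(LINT x:{a..b}|lborel. g x) = (LINT x:{a..c}|lborel. g x) + (LINT x:{c..b}|lborel. g x)"
proof -
  note s = loc_integrable_set_integrable[OF assms(1)]
  show ?thesis
    unfolding set_borel_integral_eq_integral(2)[OF s]
    using set_borel_integral_eq_integral(1)[OF s]
    by (intro Henstock_Kurzweil_Integration.integral_combine[symmetric] assms) auto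
qed

text \<open>\<open>F\<close> is locally absolutely continuous with a.e. derivative \<open>g\<close>:\<close>

definition prim :: "cfun \<Rightarrow> cfun \<Rightarrow> bool" where
  "prim g F \<longleftrightarrow> loc_integrable g \<and> (\<forall>a b. a \<le> b \<longrightarrow> F b - F a = (LINT x:{a..b}|lborel. g x))"

lemma prim_loc_integrable: "prim g F \<Longrightarrow> loc_integrable g"
  by (simp add: prim_def)

lemma prim_integral: "prim g F \<Longrightarrow> a \<le> b \<Longrightarrow> (LINT x:{a..b}|lborel. g x) = F b - F a"
  by (simp add: prim_def)

lemma prim_set_integrable: "prim g F \<Longrightarrow> set_integrable lborel {a..b} g"
  by (simp add: prim_def loc_integrable_def)

lemma prim_HK:
  assumes "prim g F" "a \<le> b"
  shows "g integrable_on {a..b}" "integral {a..b} g = F b - F a"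
  using set_borel_integral_eq_integral[OF prim_set_integrable[OF assms(1)]]
    prim_integral[OF assms] by auto

lemma prim_continuous:
  assumes "prim g F"
  shows "continuous_on UNIV F"
proof -
  have "isCont F x" for x
  proof -
    have "continuous_on {x-1..x+1} (\<lambda>t. F (x-1) + integral {x-1..t} g)"
      by (intro continuous_intros indefinite_integral_continuous_1 prim_HK[OF assms]) auto
    moreover have "F (x-1) + integral {x-1..t} g = F t" if "t \<in> {x-1..x+1}" for t
      using prim_HK(2)[OF assms, of "x-1" t] that by simp
    ultimately have "continuous_on {x-1..x+1} F"
      by (rule continuous_on_eq)
    then show ?thesis
      by (rule continuous_on_interior) simp
  qed
  then show ?thesis
    by (simp add: continuous_at_imp_continuous_on)
qed

lemma prim_measurable: "prim g F \<Longrightarrow> F \<in> borel_measurable borel"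
  by (intro borel_measurable_continuous_onI prim_continuous)

lemma prim_deriv:
  assumes "prim g F" "continuous_on UNIV g"
  shows "(F has_vector_derivative g x) (at x)"
proof -
  have "((\<lambda>t. integral {x-1..t} g) has_vector_derivative g x) (at x within {x-1..x+1})"
    by (rule integral_has_vector_derivative) (auto intro: continuous_on_subset[OF assms(2)])
  then have "((\<lambda>t. F (x-1) + integral {x-1..t} g) has_vector_derivative g x) (at x within {x-1..x+1})"
    by (auto intro!: derivative_eq_intros)
  then have "(F has_vector_derivative g x) (at x within {x-1..x+1})"
    by (rule has_vector_derivative_transform[rotated 2]) (use prim_HK(2)[OF assms(1)] in auto)
  moreover have "at x within {x-1..x+1} = at x"
    by (rule at_within_interior) simp
  ultimately show ?thesis by simp
qed

lemma prim_C1: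
  assumes "\<And>x. (F has_vector_derivative g x) (at x)" "continuous_on UNIV g"
  shows "prim g F"
  unfolding prim_def
proof (intro conjI allI impI)
  show "loc_integrable g" by (rule loc_integrable_continuous[OF assms(2)])
  show "F b - F a = (LINT x:{a..b}|lborel. g x)" if "a \<le> b" for a b
    unfolding set_lebesgue_integral_def
    by (rule integral_FTC_atLeastAtMost[symmetric, OF that])
      (auto intro: has_vector_derivative_at_within[OF assms(1)] continuous_on_subset[OF assms(2)])
qed

lemma prim_const: "prim (\<lambda>_. 0) (\<lambda>_. c)"
  by (rule prim_C1) auto

lemma prim_add: "prim f F \<Longrightarrow> prim g G \<Longrightarrow> prim (\<lambda>x. f x + g x) (\<lambda>x. F x + G x)"
  unfolding prim_def
  by (auto simp: loc_integrable_add loc_integrable_set_integrable add_diff_add)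

lemma prim_cmult: "prim f F \<Longrightarrow> prim (\<lambda>x. c * f x) (\<lambda>x. c * F x)"
  unfolding prim_def by (auto intro: loc_integrable_cmult simp: right_diff_distrib[symmetric])

lemma prim_diff: "prim f F \<Longrightarrow> prim g G \<Longrightarrow> prim (\<lambda>x. f x - g x) (\<lambda>x. F x - G x)"
  using prim_add[OF _ prim_cmult[of g G "-1"], of f F] by simp

lemma prim_cnj: "prim f F \<Longrightarrow> prim (\<lambda>x. cnj (f x)) (\<lambda>x. cnj (F x))"
  unfolding prim_def
proof (intro conjI allI impI; (elim conjE)?)
  assume *: "loc_integrable f" "\<forall>a b. a \<le> b \<longrightarrow> F b - F a = (LINT x:{a..b}|lborel. f x)"
  show "loc_integrable (\<lambda>x. cnj (f x))"
    using * by (intro loc_integrable_cnj)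
  fix a b :: real assume "a \<le> b"
  have "(LINT x:{a..b}|lborel. cnj (f x)) = cnj (LINT x:{a..b}|lborel. f x)"
  proof -
    have "(\<lambda>x. indicat_real {a..b} x *\<^sub>R cnj (f x)) = (\<lambda>x. cnj (indicat_real {a..b} x *\<^sub>R f x))"
      by simp
    then show ?thesis
      unfolding set_lebesgue_integral_def by (simp only: Bochner_Integration.integral_cnj)
  qed
  then show "cnj (F b) - cnj (F a) = (LINT x:{a..b}|lborel. cnj (f x))"
    using * \<open>a \<le> b\<close> by (metis complex_cnj_diff)
qed

lemma prim_AE_cong:
  assumes "prim f F" "g \<in> borel_measurable borel" "AE x in lborel. f x = g x"
  shows "prim g F"
  unfolding prim_def
proof (intro conjI allI impI)
  show l: "loc_integrable g"
    by (rule loc_integrable_AE_cong[OF prim_loc_integrable[OF assms(1)] assms(2,3)])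
  fix a b :: real assume "a \<le> b"
  note [measurable] = assms(2) loc_integrable_measurable[OF prim_loc_integrable[OF assms(1)]]
  have "(LINT x:{a..b}|lborel. g x) = (LINT x:{a..b}|lborel. f x)"
    unfolding set_lebesgue_integral_def by (rule integral_cong_AE) (use assms(3) in auto)
  then show "F b - F a = (LINT x:{a..b}|lborel. g x)"
    using prim_integral[OF assms(1) \<open>a \<le> b\<close>] by simp
qed

lemma prim_exists:
  assumes "loc_integrable g"
  obtains F where "prim g F" "F 0 = c"
proof
  \<comment> \<open>The case split produces the signed integral from 0: a set integral over a
    reversed interval is 0 and not the negative of the integral.\<close>
  define F where "F x = c + (if 0 \<le> x then (LINT t:{0..x}|lborel. g t) else - (LINT t:{x..0}|lborel. g t))" for x
  have at0: "(LINT t:{0..0::real}|lborel. g t) = 0"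
    using set_borel_integral_eq_integral(2)[OF loc_integrable_set_integrable[OF assms], of 0 0]
    by (simp del: atLeastAtMost_singleton) simp
  show "prim g F"
    unfolding prim_def
  proof (intro conjI allI impI assms)
    fix a b :: real assume "a \<le> b"
    consider "0 \<le> a" | "a < 0" "0 \<le> b" | "b < 0" by linarith
    then show "F b - F a = (LINT x:{a..b}|lborel. g x)"
    proof cases
      case 1
      then show ?thesis using set_integral_split[OF assms 1 \<open>a \<le> b\<close>] \<open>a \<le> b\<close> by (simp add: F_def)
    next
      case 2
      then show ?thesis using set_integral_split[OF assms _ 2(2), of a] by (simp add: F_def)
    next
      case 3
      then show ?thesis using set_integral_split[OF assms \<open>a \<le> b\<close>, of 0] \<open>a \<le> b\<close> by (simp add: F_def)
    qed
  qed
  show "F 0 = c" using at0 by (simp add: F_def)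
qed

section \<open>Integration by parts and boundary terms at infinity\<close>

lemma fubini_triangle:
  fixes u v :: cfun
  assumes u: "integrable lborel u" and v: "integrable lborel v"
  shows "(\<integral>t. u t * (\<integral>s. indicator {..t} s *\<^sub>R v s \<partial>lborel) \<partial>lborel)
    + (\<integral>s. v s * (\<integral>t. indicator {..s} t *\<^sub>R u t \<partial>lborel) \<partial>lborel)
    = (\<integral>t. u t \<partial>lborel) * (\<integral>s. v s \<partial>lborel)"
proof -
  note [measurable] = borel_measurable_integrable[OF u] borel_measurable_integrable[OF v]
  \<comment> \<open>The square is cut into the triangles s \<le> t and t < s. The second is strict
    so that the two indicators add up to 1 everywhere; the diagonal is a single point in each inner
    integral.\<close>
  define h1 where "h1 t s = u t * (indicator {..t} s *\<^sub>R v s)" for t s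
  define h2 where "h2 t s = v s * (indicator {..<s} t *\<^sub>R u t)" for t s
  have m1: "(\<lambda>(t,s). h1 t s) \<in> borel_measurable (lborel \<Otimes>\<^sub>M lborel)"
    and m2: "(\<lambda>(t,s). h2 t s) \<in> borel_measurable (lborel \<Otimes>\<^sub>M lborel)"
    unfolding h1_def h2_def indicator_def atMost_iff lessThan_iff by measurable
  have uv: "integrable (lborel \<Otimes>\<^sub>M lborel) (\<lambda>(t,s). u t * v s)"
  proof (rule lborel_pair.Fubini_integrable)
    show "integrable lborel (\<lambda>t. \<integral>s. norm (case (t, s) of (t, s) \<Rightarrow> u t * v s) \<partial>lborel)"
      using u by (simp add: norm_mult)
    show "AE t in lborel. integrable lborel (\<lambda>s. case (t, s) of (t, s) \<Rightarrow> u t * v s)"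
      using v by simp
  qed measurable
  have i1: "integrable (lborel \<Otimes>\<^sub>M lborel) (\<lambda>(t,s). h1 t s)"
    by (rule Bochner_Integration.integrable_bound[OF uv m1])
      (auto simp: h1_def norm_mult indicator_def)
  have i2: "integrable (lborel \<Otimes>\<^sub>M lborel) (\<lambda>(t,s). h2 t s)"
    by (rule Bochner_Integration.integrable_bound[OF uv m2])
      (auto simp: h2_def norm_mult indicator_def)
  have inner: "integrable lborel (\<lambda>s. h1 t s)" "integrable lborel (\<lambda>s. h2 t s)" for t
  proof -
    have "integrable lborel (\<lambda>s. u t * v s)" using v by simp
    then show "integrable lborel (\<lambda>s. h1 t s)" "integrable lborel (\<lambda>s. h2 t s)"
      unfolding h1_def h2_def
      by (auto elim!: Bochner_Integration.integrable_bound simp: norm_mult indicator_def)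
  qed
  have "(\<integral>s. v s * (\<integral>t. indicator {..s} t *\<^sub>R u t \<partial>lborel) \<partial>lborel) = (\<integral>s. \<integral>t. h2 t s \<partial>lborel \<partial>lborel)"
  proof (rule Bochner_Integration.integral_cong[OF refl])
    fix s
    have "(\<integral>t. indicator {..s} t *\<^sub>R u t \<partial>lborel) = (\<integral>t. indicator {..<s} t *\<^sub>R u t \<partial>lborel)"
      by (rule integral_cong_AE) (use AE_lborel_singleton[of s] in \<open>auto simp: indicator_def elim!: eventually_mono\<close>)
    then show "v s * (\<integral>t. indicator {..s} t *\<^sub>R u t \<partial>lborel) = (\<integral>t. h2 t s \<partial>lborel)"
      unfolding h2_def by (simp only: integral_mult_right_zero)
  qed
  also have "\<dots> = (\<integral>t. \<integral>s. h2 t s \<partial>lborel \<partial>lborel)"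
    by (rule lborel_pair.Fubini_integral[OF i2])
  finally have "(\<integral>t. u t * (\<integral>s. indicator {..t} s *\<^sub>R v s \<partial>lborel) \<partial>lborel)
    + (\<integral>s. v s * (\<integral>t. indicator {..s} t *\<^sub>R u t \<partial>lborel) \<partial>lborel)
    = (\<integral>t. \<integral>s. h1 t s \<partial>lborel \<partial>lborel) + (\<integral>t. \<integral>s. h2 t s \<partial>lborel \<partial>lborel)"
    unfolding h1_def by (simp only: integral_mult_right_zero)
  also have "\<dots> = (\<integral>t. (\<integral>s. h1 t s \<partial>lborel) + (\<integral>s. h2 t s \<partial>lborel) \<partial>lborel)"
    using lborel_pair.integrable_fst[OF i1] lborel_pair.integrable_fst[OF i2] by simp
  also have "\<dots> = (\<integral>t. u t * (\<integral>s. v s \<partial>lborel) \<partial>lborel)"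
  proof (rule Bochner_Integration.integral_cong[OF refl])
    fix t
    have "(\<integral>s. h1 t s \<partial>lborel) + (\<integral>s. h2 t s \<partial>lborel) = (\<integral>s. h1 t s + h2 t s \<partial>lborel)"
      using inner by simp
    also have "\<dots> = (\<integral>s. u t * v s \<partial>lborel)"
      by (rule Bochner_Integration.integral_cong) (auto simp: h1_def h2_def indicator_def)
    finally show "(\<integral>s. h1 t s \<partial>lborel) + (\<integral>s. h2 t s \<partial>lborel) = u t * (\<integral>s. v s \<partial>lborel)"
      by simp
  qed
  finally show ?thesis by simp
qed

text \<open>A primitive of a merely locally integrable function need not be differentiable
  everywhere, so the product rule is derived from \<open>fubini_triangle\<close>, applied to
  \<open>f\<close> and \<open>g\<close> cut to the interval: there the inner integral up to t is the
  increment of the primitive from a to t. All energy identities rest on this lemma.\<close>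

lemma prim_mult:
  assumes F: "prim f F" and G: "prim g G"
  shows "prim (\<lambda>x. f x * G x + g x * F x) (\<lambda>x. F x * G x)"
  unfolding prim_def
proof (intro conjI allI impI)
  have l: "loc_integrable (\<lambda>x. f x * G x)" "loc_integrable (\<lambda>x. g x * F x)"
    using F G by (auto intro: loc_integrable_mult_continuous prim_loc_integrable prim_continuous)
  then show "loc_integrable (\<lambda>x. f x * G x + g x * F x)"
    by (rule loc_integrable_add)
  fix a b :: real assume "a \<le> b"
  have aux: "(\<integral>t. (indicator {a..b} t *\<^sub>R p t) * (\<integral>s. indicator {..t} s *\<^sub>R (indicator {a..b} s *\<^sub>R q s) \<partial>lborel) \<partial>lborel)
      = (LINT x:{a..b}|lborel. p x * Q x) - Q a * (P b - P a)"
    if P: "prim p P" and Q: "prim q Q" for p q P Q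
  proof -
    have "(\<integral>t. (indicator {a..b} t *\<^sub>R p t) * (\<integral>s. indicator {..t} s *\<^sub>R (indicator {a..b} s *\<^sub>R q s) \<partial>lborel) \<partial>lborel)
      = (LINT t:{a..b}|lborel. p t * Q t - Q a * p t)"
      unfolding set_lebesgue_integral_def
    proof (rule Bochner_Integration.integral_cong[OF refl])
      fix t
      show "(indicator {a..b} t *\<^sub>R p t) * (\<integral>s. indicator {..t} s *\<^sub>R (indicator {a..b} s *\<^sub>R q s) \<partial>lborel)
        = indicator {a..b} t *\<^sub>R (p t * Q t - Q a * p t)"
      proof (cases "t \<in> {a..b}")
        case True
        have "(\<integral>s. indicator {..t} s *\<^sub>R (indicator {a..b} s *\<^sub>R q s) \<partial>lborel) = (LINT s:{a..t}|lborel. q s)"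
          unfolding set_lebesgue_integral_def
          by (rule Bochner_Integration.integral_cong) (use True in \<open>auto simp: indicator_def\<close>)
        then show ?thesis
          using True prim_integral[OF Q, of a t] by (simp add: right_diff_distrib mult.commute)
      qed auto
    qed
    also have "\<dots> = (LINT x:{a..b}|lborel. p x * Q x) - Q a * (P b - P a)"
      using loc_integrable_set_integrable[OF loc_integrable_mult_continuous[OF prim_loc_integrable[OF P] prim_continuous[OF Q]]]
        prim_set_integrable[OF P] prim_integral[OF P \<open>a \<le> b\<close>] by simp
    finally show ?thesis .
  qed
  have "((LINT x:{a..b}|lborel. f x * G x) - G a * (F b - F a))
      + ((LINT x:{a..b}|lborel. g x * F x) - F a * (G b - G a))
      = (LINT x:{a..b}|lborel. f x) * (LINT x:{a..b}|lborel. g x)"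
    unfolding aux[OF F G, symmetric] aux[OF G F, symmetric]
    unfolding set_lebesgue_integral_def
    by (rule fubini_triangle)
      (use prim_set_integrable[OF F] prim_set_integrable[OF G] in \<open>auto simp: set_integrable_def\<close>)
  then show "F b * G b - F a * G a = (LINT x:{a..b}|lborel. f x * G x + g x * F x)"
    using l by (simp add: loc_integrable_set_integrable prim_integral[OF F \<open>a \<le> b\<close>]
      prim_integral[OF G \<open>a \<le> b\<close>] algebra_simps)
qed

text \<open>An integrable function need not tend to 0, but it cannot have modulus at least
  \<open>e\<close> throughout an interval of length (M + 1) / e, where M is its L1 norm. Hence small
  values occur arbitrarily far out on both sides.\<close>

lemma integrable_small_at_infinity:
  fixes G :: cfun
  assumes "integrable lborel G" "e > 0"
  shows "\<exists>x\<ge>N. cmod (G x) < e" "\<exists>x\<le>N. cmod (G x) < e"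
proof -
  define M where "M = (\<integral>x. cmod (G x) \<partial>lborel)"
  define m where "m = (M + 1) / e"
  have "0 \<le> M" unfolding M_def by (rule Bochner_Integration.integral_nonneg) simp
  then have "0 < m" using \<open>e > 0\<close> by (simp add: m_def)
  have *: "\<exists>x\<in>{a..a+m}. cmod (G x) < e" for a
  proof (rule ccontr)
    assume "\<not> (\<exists>x\<in>{a..a+m}. cmod (G x) < e)"
    then have "(\<integral>x. indicator {a..a+m} x * e \<partial>lborel) \<le> M"
      unfolding M_def using assms
      by (intro integral_mono integrable_mult_left integrable_real_indicator integrable_norm)
        (auto simp: not_less emeasure_lborel_Icc_eq split: split_indicator)
    then show False
      using \<open>0 < m\<close> \<open>e > 0\<close> by (simp add: m_def)
  qed
  show "\<exists>x\<ge>N. cmod (G x) < e" using *[of N] by auto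
  show "\<exists>x\<le>N. cmod (G x) < e" using *[of "N - m"] by auto
qed

text \<open>On the whole line the boundary function \<open>G\<close> is known only to be integrable.
  The intervals of integration therefore get endpoints picked where \<open>G\<close> is small, and
  dominated convergence does the rest.\<close>

lemma prim_integral_zero:
  assumes "prim g G" "integrable lborel g" "integrable lborel G"
  shows "(\<integral>x. g x \<partial>lborel) = 0"
proof -
  have ex: "\<exists>x\<ge>real n. cmod (G x) < 1 / Suc n" "\<exists>x\<le>- real n. cmod (G x) < 1 / Suc n" for n
    by (rule integrable_small_at_infinity[OF assms(3)], simp)+
  define p m where "p n = (SOME x. x \<ge> real n \<and> cmod (G x) < 1 / Suc n)"
    and "m n = (SOME x. x \<le> - real n \<and> cmod (G x) < 1 / Suc n)" for n
  have p: "p n \<ge> real n" "cmod (G (p n)) < 1 / Suc n" for n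
    using someI_ex[OF ex(1)] unfolding p_def by auto
  have m: "m n \<le> - real n" "cmod (G (m n)) < 1 / Suc n" for n
    using someI_ex[OF ex(2)] unfolding m_def by auto
  have "(\<lambda>n. LINT x:{m n..p n}|lborel. g x) \<longlonglongrightarrow> (\<integral>x. g x \<partial>lborel)"
    unfolding set_lebesgue_integral_def
  proof (rule integral_dominated_convergence[where w = "\<lambda>x. norm (g x)"])
    show "AE x in lborel. (\<lambda>n. indicator {m n..p n} x *\<^sub>R g x) \<longlonglongrightarrow> g x"
    proof (rule AE_I2, rule tendsto_eventually)
      fix x :: real
      obtain N :: nat where N: "\<bar>x\<bar> \<le> real N" using real_arch_simple by blast
      show "\<forall>\<^sub>F n in sequentially. indicator {m n..p n} x *\<^sub>R g x = g x"
      proof (rule eventually_sequentiallyI[of N])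
        fix n assume "N \<le> n"
        then have "x \<in> {m n..p n}"
          using N p(1)[of n] m(1)[of n] by (simp add: abs_le_iff)
        then show "indicator {m n..p n} x *\<^sub>R g x = g x"
          by simp
      qed
    qed
    show "AE x in lborel. norm (indicator {m n..p n} x *\<^sub>R g x) \<le> norm (g x)" for n
      by (auto simp: indicator_def)
  qed (use assms(2) in auto)
  moreover have "(LINT x:{m n..p n}|lborel. g x) = G (p n) - G (m n)" for n
    by (rule prim_integral[OF assms(1)]) (use p(1)[of n] m(1)[of n] in linarith)
  ultimately have "(\<lambda>n. G (p n) - G (m n)) \<longlonglongrightarrow> (\<integral>x. g x \<partial>lborel)"
    by simp
  moreover have "(\<lambda>n. G (p n) - G (m n)) \<longlonglongrightarrow> 0 - 0"
  proof (rule tendsto_diff)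
    show "(\<lambda>n. G (p n)) \<longlonglongrightarrow> 0"
      by (rule Lim_null_comparison[OF _ LIMSEQ_Suc[OF lim_1_over_n]])
        (rule always_eventually, use p(2) in \<open>auto intro: less_imp_le simp del: of_nat_Suc\<close>)
    show "(\<lambda>n. G (m n)) \<longlonglongrightarrow> 0"
      by (rule Lim_null_comparison[OF _ LIMSEQ_Suc[OF lim_1_over_n]])
        (rule always_eventually, use m(2) in \<open>auto intro: less_imp_le simp del: of_nat_Suc\<close>)
  qed
  ultimately show ?thesis
    using LIMSEQ_unique by fastforce
qed

section \<open>Test functions\<close>

definition smooth :: "cfun \<Rightarrow> bool" where
  "smooth \<phi> \<longleftrightarrow> (\<forall>n. (vderiv ^^ n) \<phi> differentiable_on UNIV)"

lemma test_funs_iff: "\<phi> \<in> test_funs \<longleftrightarrow> smooth \<phi> \<and> compact (closure {x. \<phi> x \<noteq> 0})"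
  by (simp add: test_funs_def smooth_def)

lemma vderiv_eqI: "(\<And>x. (f has_vector_derivative f' x) (at x)) \<Longrightarrow> vderiv f = f'"
  by (simp add: vderiv_def vector_derivative_at fun_eq_iff)

lemma differentiable_onI: "(\<And>x. (f has_vector_derivative f' x) (at x)) \<Longrightarrow> f differentiable_on UNIV"
  by (auto simp: differentiable_on_def intro: differentiableI_vector)

text \<open>Smoothness as a greatest fixed point: every class of functions that is closed under
  differentiation consists of smooth functions. No formula for an n-th derivative is then required;
  only an invariant class has to be named.\<close>

lemma smooth_coinduct:
  assumes "P \<phi>" "\<And>f. P f \<Longrightarrow> \<exists>f'. (\<forall>x. (f has_vector_derivative f' x) (at x)) \<and> P f'"
  shows "smooth \<phi>"
  unfolding smooth_def
proof
  fix n
  have "P ((vderiv ^^ n) \<phi>)"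
  proof (induction n)
    case (Suc n)
    then obtain f' where "\<And>x. ((vderiv ^^ n) \<phi> has_vector_derivative f' x) (at x)" "P f'"
      using assms(2) by blast
    then show ?case using vderiv_eqI[of "(vderiv ^^ n) \<phi>" f'] by simp
  qed (simp add: assms(1))
  then obtain f' where "\<And>x. ((vderiv ^^ n) \<phi> has_vector_derivative f' x) (at x)"
    using assms(2) by blast
  then show "(vderiv ^^ n) \<phi> differentiable_on UNIV"
    by (rule differentiable_onI)
qed

lemma smooth_has_vderiv: "smooth \<phi> \<Longrightarrow> (\<phi> has_vector_derivative vderiv \<phi> x) (at x)"
  unfolding smooth_def vderiv_def
  by (drule spec[of _ 0]) (simp add: differentiable_on_def flip: vector_derivative_works)

lemma smooth_vderiv: "smooth \<phi> \<Longrightarrow> smooth (vderiv \<phi>)"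
  unfolding smooth_def
proof
  fix n
  assume "\<forall>n. (vderiv ^^ n) \<phi> differentiable_on UNIV"
  then have "(vderiv ^^ Suc n) \<phi> differentiable_on UNIV" by blast
  then show "(vderiv ^^ n) (vderiv \<phi>) differentiable_on UNIV"
    by (simp add: funpow_swap1)
qed

lemma smooth_of_deriv:
  assumes "\<And>x. (f has_vector_derivative f' x) (at x)" "smooth f'"
  shows "smooth f"
proof (rule smooth_coinduct[where P = "\<lambda>g. g = f \<or> smooth g"])
  fix g assume "g = f \<or> smooth g"
  then show "\<exists>g'. (\<forall>x. (g has_vector_derivative g' x) (at x)) \<and> (g' = f \<or> smooth g')"
  proof
    assume "g = f"
    then show ?thesis using assms by (intro exI[of _ f']) simp
  next
    assume "smooth g"
    then show ?thesis by (intro exI[of _ "vderiv g"]) (simp add: smooth_has_vderiv smooth_vderiv)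
  qed
qed simp

lemma smooth_continuous: "smooth \<phi> \<Longrightarrow> continuous_on UNIV \<phi>"
  by (meson continuous_at_imp_continuous_on has_vector_derivative_continuous smooth_has_vderiv)

lemma smooth_prim: "smooth \<phi> \<Longrightarrow> prim (vderiv \<phi>) \<phi>"
  by (intro prim_C1 smooth_has_vderiv smooth_continuous smooth_vderiv)

text \<open>The algebra generated by \<open>S\<close> over the smooth functions. If it contains the
  derivatives of the generators, the product rule closes it under differentiation, which makes it an
  invariant for \<open>smooth_coinduct\<close>. With \<open>S\<close> empty this yields sums and
  products of smooth functions.\<close>

inductive salg :: "cfun set \<Rightarrow> cfun \<Rightarrow> bool" for S where
  gen: "f \<in> S \<Longrightarrow> salg S f"
| smooth: "smooth f \<Longrightarrow> salg S f"
| add: "salg S f \<Longrightarrow> salg S g \<Longrightarrow> salg S (\<lambda>x. f x + g x)"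
| mult: "salg S f \<Longrightarrow> salg S g \<Longrightarrow> salg S (\<lambda>x. f x * g x)"

lemma salg_smooth:
  assumes "\<And>f. f \<in> S \<Longrightarrow> \<exists>f'. (\<forall>x. (f has_vector_derivative f' x) (at x)) \<and> salg S f'"
    and "salg S f"
  shows "smooth f"
proof (rule smooth_coinduct[where P = "salg S", OF assms(2)])
  fix f assume "salg S f"
  then show "\<exists>f'. (\<forall>x. (f has_vector_derivative f' x) (at x)) \<and> salg S f'"
  proof induction
    case (gen f)
    then show ?case by (rule assms(1))
  next
    case (smooth f)
    then show ?case using smooth_has_vderiv smooth_vderiv salg.smooth by blast
  next
    case (add f g)
    then obtain f' g' where "\<forall>x. (f has_vector_derivative f' x) (at x)" "salg S f'"
      "\<forall>x. (g has_vector_derivative g' x) (at x)" "salg S g'" by blast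
    then show ?case
      by (intro exI[of _ "\<lambda>x. f' x + g' x"]) (auto intro: salg.add has_vector_derivative_add)
  next
    case (mult f g)
    then obtain f' g' where "\<forall>x. (f has_vector_derivative f' x) (at x)" "salg S f'"
      "\<forall>x. (g has_vector_derivative g' x) (at x)" "salg S g'" by blast
    with mult show ?case
      by (intro exI[of _ "\<lambda>x. f x * g' x + f' x * g x"])
        (auto intro: salg.add salg.mult has_vector_derivative_mult)
  qed
qed

lemma smooth_add: "smooth f \<Longrightarrow> smooth g \<Longrightarrow> smooth (\<lambda>x. f x + g x)"
  and smooth_mult: "smooth f \<Longrightarrow> smooth g \<Longrightarrow> smooth (\<lambda>x. f x * g x)"
  by (rule salg_smooth[of "{}"]; auto intro: salg.intros)+

lemma smooth_const: "smooth (\<lambda>_. c)"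
  by (rule smooth_coinduct[where P = "\<lambda>f. \<exists>c. f = (\<lambda>_. c)"]) (auto intro!: exI[of _ "\<lambda>_. 0"])

lemma smooth_of_real: "smooth complex_of_real"
  by (rule smooth_of_deriv[OF _ smooth_const[of 1]])
    (use has_vector_derivative_of_real[OF DERIV_ident] in simp)

lemma smooth_affine:
  assumes "smooth \<phi>"
  shows "smooth (\<lambda>x. \<phi> (c * x + d))"
\<comment> \<open>The factor \<open>k\<close> absorbs the powers of \<open>c\<close> that the chain
  rule produces.\<close>
proof (rule smooth_coinduct[where P = "\<lambda>f. \<exists>\<phi> k. smooth \<phi> \<and> f = (\<lambda>x. k * \<phi> (c * x + d))"])
  show "\<exists>\<psi> k. smooth \<psi> \<and> (\<lambda>x. \<phi> (c * x + d)) = (\<lambda>x. k * \<psi> (c * x + d))"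
    using assms by (intro exI[of _ \<phi>] exI[of _ "1::complex"]) simp
next
  fix f assume "\<exists>\<phi> k. smooth \<phi> \<and> f = (\<lambda>x. k * \<phi> (c * x + d))"
  then obtain \<phi> k where \<phi>: "smooth \<phi>" and f: "f = (\<lambda>x. k * \<phi> (c * x + d))" by blast
  have "((\<lambda>x. \<phi> (c * x + d)) has_vector_derivative c *\<^sub>R vderiv \<phi> (c * x + d)) (at x)" for x
  proof -
    have "((\<lambda>x. c * x + d) has_vector_derivative c) (at x)"
      by (auto intro!: derivative_eq_intros)
    from vector_diff_chain_at[OF this smooth_has_vderiv[OF \<phi>]] show ?thesis
      by (simp add: o_def)
  qed
  then have "(f has_vector_derivative (k * complex_of_real c) * vderiv \<phi> (c * x + d)) (at x)" for x
    unfolding f using has_vector_derivative_mult_right[of "\<lambda>x. \<phi> (c * x + d)" _ "at x" k]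
    by (auto simp: scaleR_conv_of_real mult.assoc)
  then show "\<exists>f'. (\<forall>x. (f has_vector_derivative f' x) (at x)) \<and>
      (\<exists>\<phi> k. smooth \<phi> \<and> f' = (\<lambda>x. k * \<phi> (c * x + d)))"
    using smooth_vderiv[OF \<phi>] by (intro exI[of _ "\<lambda>x. (k * complex_of_real c) * vderiv \<phi> (c * x + d)"]) blast
qed

lemma smooth_real_polynomial:
  "real_polynomial_function p \<Longrightarrow> smooth (\<lambda>x::real. complex_of_real (p x))"
proof (induction rule: real_polynomial_function.induct)
  case (linear f)
  have "(\<lambda>x. complex_of_real (f x)) = (\<lambda>x. complex_of_real x * complex_of_real (f 1))"
  proof
    fix x
    show "complex_of_real (f x) = complex_of_real x * complex_of_real (f 1)"
      using linear_cmul[OF bounded_linear.linear[OF linear], of x 1]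
      unfolding of_real_mult[symmetric] by simp
  qed
  then show ?case
    using smooth_mult[OF smooth_of_real smooth_const] by simp
qed (auto intro: smooth_const smooth_add smooth_mult)

lemma smooth_polynomial:
  assumes "polynomial_function (p :: cfun)"
  shows "smooth p"
proof -
  have "real_polynomial_function (Re \<circ> p)" "real_polynomial_function (Im \<circ> p)"
    using assms bounded_linear_Re bounded_linear_Im by (auto simp: polynomial_function_def)
  then have "smooth (\<lambda>x. complex_of_real (Re (p x)) + \<i> * complex_of_real (Im (p x)))"
    by (auto intro!: smooth_add smooth_mult smooth_const dest: smooth_real_polynomial simp: o_def)
  then show ?thesis
    by (simp flip: complex_eq)
qed

text \<open>Stone-Weierstrass takes the place of mollification. Compact support is lost here and
  restored later by multiplying with a plateau function.\<close>

lemma smooth_approx: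
  fixes g :: cfun
  assumes "continuous_on {a..b} g" "e > 0"
  shows "\<exists>p. smooth p \<and> (\<forall>x\<in>{a..b}. cmod (g x - p x) < e)"
  using Stone_Weierstrass_polynomial_function[OF compact_Icc assms] smooth_polynomial by blast

section \<open>Bump functions and a smooth step built from exp(-1/x)\<close>

definition flat :: "nat \<Rightarrow> real \<Rightarrow> real" where
  "flat k x = (if 0 < x then exp (- inverse x) * inverse x ^ k else 0)"

lemma flat_tendsto_0: "(flat k \<longlongrightarrow> 0) (at 0)"
proof (rule filterlim_split_at)
  show "(flat k \<longlongrightarrow> 0) (at_left 0)"
    by (rule tendsto_eventually) (auto simp: flat_def eventually_at_filter)
  have "((\<lambda>x::real. inverse x ^ k / exp (inverse x)) \<longlongrightarrow> 0) (at_right 0)"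
    by (rule filterlim_compose[OF tendsto_power_div_exp_0 filterlim_inverse_at_top_right])
  then show "(flat k \<longlongrightarrow> 0) (at_right 0)"
    by (rule Lim_transform_eventually)
      (auto simp: flat_def eventually_at_filter exp_minus field_simps)
qed

text \<open>Differentiating exp(-1/x) x^(-k) stays within linear combinations of the family. At 0
  the difference quotient of \<open>flat k\<close> is \<open>flat (k + 1)\<close> on the right and 0
  on the left, so the single limit \<open>flat_tendsto_0\<close> settles differentiability of every
  order.\<close>

lemma flat_deriv: "(flat k has_real_derivative flat (k + 2) x - real k * flat (k + 1) x) (at x)"
proof -
  consider "0 < x" | "x = 0" | "x < 0" by linarith
  then show ?thesis
  proof cases
    case 1
    have "((\<lambda>x. exp (- inverse x) * inverse x ^ k) has_real_derivative
        exp (- inverse x) * inverse x ^ (k + 2) - real k * (exp (- inverse x) * inverse x ^ (k + 1))) (at x)"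
    proof -
      have d1: "((\<lambda>x. inverse x ^ k) has_real_derivative - real k * inverse x ^ (k + 1)) (at x)"
      proof -
        have "x \<noteq> 0" using 1 by simp
        show ?thesis
          by (rule DERIV_cong[OF DERIV_power[OF DERIV_inverse[OF \<open>x \<noteq> 0\<close>]]]) (cases k; simp add: algebra_simps)
      qed
      have d2: "((\<lambda>x. exp (- inverse x)) has_real_derivative exp (- inverse x) * inverse x ^ 2) (at x)"
        using 1 by (auto intro!: derivative_eq_intros simp: power2_eq_square)
      have "exp (- inverse x) * (- real k * inverse x ^ (k + 1)) + exp (- inverse x) * inverse x ^ 2 * inverse x ^ k
        = exp (- inverse x) * inverse x ^ (k + 2) - real k * (exp (- inverse x) * inverse x ^ (k + 1))"
      proof -
        have "e * (- r * (a * i)) + e * i\<^sup>2 * a = e * (a * i\<^sup>2) - r * (e * (a * i))" for e r a i :: real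
          by (simp add: algebra_simps)
        from this[of "exp (- inverse x)" "real k" "inverse x ^ k" "inverse x"] show ?thesis
          by (simp only: power_add power_one_right)
      qed
      then show ?thesis
        by (rule DERIV_cong[OF DERIV_mult'[OF d2 d1]])
    qed
    then have "(flat k has_real_derivative
        exp (- inverse x) * inverse x ^ (k + 2) - real k * (exp (- inverse x) * inverse x ^ (k + 1))) (at x)"
      by (rule has_field_derivative_transform_within_open[of _ _ _ "{0<..}"]) (use 1 in \<open>auto simp: flat_def\<close>)
    then show ?thesis using 1 by (simp add: flat_def)
  next
    case 2
    have "((\<lambda>y. (flat k y - flat k 0) / (y - 0)) \<longlongrightarrow> 0) (at 0)"
      by (rule Lim_transform_eventually[OF flat_tendsto_0[of "k + 1"]])
        (auto simp: flat_def eventually_at_filter field_simps)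
    then show ?thesis
      unfolding 2 has_field_derivative_iff by (simp add: flat_def)
  next
    case 3
    have "(flat k has_real_derivative 0) (at x)"
      by (rule has_field_derivative_transform_within_open[of "\<lambda>_. 0" _ _ "{..<0}"]) (use 3 in \<open>auto simp: flat_def\<close>)
    then show ?thesis using 3 by (simp add: flat_def)
  qed
qed

lemma smooth_flat: "smooth (\<lambda>x. complex_of_real (flat k x))"
proof (rule salg_smooth[where S = "range (\<lambda>k x. complex_of_real (flat k x))"])
  let ?S = "range (\<lambda>k x. complex_of_real (flat k x))"
  fix f assume "f \<in> ?S"
  then obtain k where f: "f = (\<lambda>x. complex_of_real (flat k x))" by blast
  define f' where "f' x = complex_of_real (flat (k + 2) x) + (- of_nat k) * complex_of_real (flat (k + 1) x)" for x
  have "(f has_vector_derivative f' x) (at x)" for x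
    unfolding f f'_def using has_vector_derivative_of_real[OF flat_deriv[of k x]] by simp
  moreover have "salg ?S f'"
    unfolding f'_def by (intro salg.add salg.mult salg.smooth[OF smooth_const] salg.gen rangeI)
  ultimately show "\<exists>f'. (\<forall>x. (f has_vector_derivative f' x) (at x)) \<and> salg ?S f'" by blast
qed (auto intro: salg.gen)

lemma test_funI:
  assumes "smooth \<phi>" "\<And>x. x \<notin> {a..b} \<Longrightarrow> \<phi> x = 0"
  shows "\<phi> \<in> test_funs"
proof -
  have "{x. \<phi> x \<noteq> 0} \<subseteq> {a..b}" using assms(2) by blast
  then have "bounded {x. \<phi> x \<noteq> 0}" by (rule bounded_subset[OF bounded_closed_interval])
  then show ?thesis using assms(1) by (simp add: test_funs_iff compact_closure)
qed

lemma vderiv_locally_const: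
  assumes "open S" "x \<in> S" "\<And>y. y \<in> S \<Longrightarrow> f y = c"
  shows "vderiv f x = 0"
proof -
  have "(f has_vector_derivative 0) (at x)"
    by (rule has_vector_derivative_transform_within_open[of "\<lambda>_. c" _ _ S]) (use assms in auto)
  then show ?thesis by (simp add: vderiv_def vector_derivative_at)
qed

lemma test_fun_support:
  assumes "\<phi> \<in> test_funs"
  shows "\<exists>R>0. \<forall>x. R \<le> \<bar>x\<bar> \<longrightarrow> \<phi> x = 0 \<and> vderiv \<phi> x = 0"
proof -
  have "bounded {x. \<phi> x \<noteq> 0}"
    using assms compact_closure unfolding test_funs_iff by blast
  then obtain B where B: "\<And>x. \<phi> x \<noteq> 0 \<Longrightarrow> \<bar>x\<bar> \<le> B"
    by (auto simp: bounded_iff)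
  \<comment> \<open>The extra 1 gives every point with R \<le> |x| a whole neighbourhood on which
    the function vanishes, so that its derivative vanishes there too.\<close>
  define R where "R = \<bar>B\<bar> + 1"
  show ?thesis
  proof (intro exI[of _ R] conjI allI impI)
    show "0 < R" by (simp add: R_def)
    show "\<phi> x = 0" if "R \<le> \<bar>x\<bar>" for x
      using B[of x] that by (cases "\<phi> x = 0") (auto simp: R_def)
    show "vderiv \<phi> x = 0" if "R \<le> \<bar>x\<bar>" for x
    proof (rule vderiv_locally_const[of "- {-\<bar>B\<bar>..\<bar>B\<bar>}"])
      show "x \<in> - {- \<bar>B\<bar>..\<bar>B\<bar>}" using that by (auto simp: R_def)
      show "\<phi> y = 0" if "y \<in> - {- \<bar>B\<bar>..\<bar>B\<bar>}" for y
        using B[of y] that by (cases "\<phi> y = 0") (auto simp: abs_le_iff)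
    qed auto
  qed
qed

lemma test_fun_smooth: "\<phi> \<in> test_funs \<Longrightarrow> smooth \<phi>"
  by (simp add: test_funs_iff)

lemma test_fun_vderiv:
  assumes "\<phi> \<in> test_funs"
  shows "vderiv \<phi> \<in> test_funs"
proof -
  obtain R where "\<forall>x. R \<le> \<bar>x\<bar> \<longrightarrow> \<phi> x = 0 \<and> vderiv \<phi> x = 0"
    using test_fun_support[OF assms] by blast
  then show ?thesis
    by (intro test_funI[of _ "- R" R] smooth_vderiv[OF test_fun_smooth[OF assms]]) (auto simp: abs_le_iff)
qed

lemma test_fun_mult:
  assumes "\<phi> \<in> test_funs" "smooth f"
  shows "(\<lambda>x. \<phi> x * f x) \<in> test_funs"
proof -
  obtain R where "\<forall>x. R \<le> \<bar>x\<bar> \<longrightarrow> \<phi> x = 0 \<and> vderiv \<phi> x = 0"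
    using test_fun_support[OF assms(1)] by blast
  then show ?thesis
    by (intro test_funI[of _ "- R" R] smooth_mult[OF test_fun_smooth[OF assms(1)] assms(2)]) (auto simp: abs_le_iff)
qed

text \<open>The factor \<open>Suc n\<close> sharpens the profile: exp(-1 / ((n + 1) y)) tends to 1
  for every y > 0, so these test functions tend to the indicator of the open interval while staying
  between 0 and 1.\<close>

definition bump :: "real \<Rightarrow> real \<Rightarrow> nat \<Rightarrow> real \<Rightarrow> real" where
  "bump a b n x = flat 0 (real (Suc n) * (x - a)) * flat 0 (real (Suc n) * (b - x))"

lemma bump_test_fun: "(\<lambda>x. complex_of_real (bump a b n x)) \<in> test_funs"
proof (rule test_funI[of _ a b])
  have "smooth (\<lambda>x. complex_of_real (flat 0 (real (Suc n) * x + (- real (Suc n) * a))) *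
      complex_of_real (flat 0 ((- real (Suc n)) * x + real (Suc n) * b)))"
    by (intro smooth_mult smooth_affine[OF smooth_flat])
  moreover have "c * x + (- c * a) = c * (x - a)" "(- c) * x + c * b = c * (b - x)" for c x :: real
    by (simp_all add: right_diff_distrib)
  ultimately show "smooth (\<lambda>x. complex_of_real (bump a b n x))"
    by (simp only: bump_def of_real_mult)
  show "complex_of_real (bump a b n x) = 0" if "x \<notin> {a..b}" for x
  proof -
    have "real (Suc n) * (x - a) \<le> 0 \<or> real (Suc n) * (b - x) \<le> 0"
      using that by (auto simp: mult_le_0_iff simp del: of_nat_Suc)
    then show ?thesis by (auto simp: bump_def flat_def simp del: of_nat_Suc)
  qed
qed

lemma flat_bounds: "0 \<le> flat 0 x" "flat 0 x \<le> 1"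
  by (auto simp: flat_def)

lemma bump_bounds: "0 \<le> bump a b n x" "bump a b n x \<le> 1"
  using flat_bounds by (auto simp: bump_def mult_le_one)

lemma bump_tendsto: "(\<lambda>n. bump a b n x) \<longlonglongrightarrow> indicator {a<..<b} x"
proof -
  have *: "(\<lambda>n. flat 0 (real (Suc n) * y)) \<longlonglongrightarrow> (if 0 < y then 1 else 0)" for y
  proof (cases "0 < y")
    case True
    have "(\<lambda>n. exp (- (inverse (real (Suc n)) * inverse y))) \<longlonglongrightarrow> exp (- (0 * inverse y))"
      by (intro tendsto_intros LIMSEQ_inverse_real_of_nat)
    then show ?thesis using True by (simp add: flat_def)
  next
    case False
    then have "\<not> 0 < real (Suc n) * y" for n by (simp add: zero_less_mult_iff del: of_nat_Suc)
    then show ?thesis using False by (simp add: flat_def del: of_nat_Suc)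
  qed
  have "(\<lambda>n. bump a b n x) \<longlonglongrightarrow> (if 0 < x - a then 1 else 0) * (if 0 < b - x then 1 else 0)"
    unfolding bump_def by (intro tendsto_mult *)
  then show ?thesis by (simp add: indicator_def split: if_splits)
qed

lemma bump_pos: "a < x \<Longrightarrow> x < b \<Longrightarrow> 0 < bump a b n x"
  by (auto simp: bump_def flat_def zero_less_mult_iff)

text \<open>The mean value theorem shows that the integral of a bump is nonzero without computing
  it. The normalised bump is used twice: its primitive is the smooth step, and it is the reference
  function in \<open>weak_deriv_zero_imp_const\<close>.\<close>

lemma test_fun_integral_one:
  "\<exists>\<eta>\<in>test_funs. (\<forall>x. x \<notin> {0<..<1} \<longrightarrow> \<eta> x = 0) \<and> (LINT x:{0..1}|lborel. \<eta> x) = 1"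
proof -
  define b where "b x = complex_of_real (bump 0 1 0 x)" for x
  have bt: "b \<in> test_funs" unfolding b_def by (rule bump_test_fun)
  have cont: "continuous_on UNIV b" by (intro smooth_continuous test_fun_smooth bt)
  obtain B where B: "prim b B" using prim_exists[OF loc_integrable_continuous[OF cont]] by blast
  have "\<exists>z>0. z < 1 \<and> Re (B 1) - Re (B 0) = (1 - 0) * Re (b z)"
  proof (rule MVT2)
    show "DERIV (\<lambda>x. Re (B x)) x :> Re (b x)" for x
      using bounded_linear.has_vector_derivative[OF bounded_linear_Re prim_deriv[OF B cont]]
      by (simp add: has_real_derivative_iff_has_vector_derivative)
  qed auto
  then obtain z where "0 < z" "z < 1" "Re (B 1) - Re (B 0) = Re (b z)" by auto
  then have "B 1 - B 0 \<noteq> 0"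
    using bump_pos[of 0 z 1 0] by (auto simp: b_def)
  then have nz: "(LINT x:{0..1}|lborel. b x) \<noteq> 0"
    using prim_integral[OF B, of 0 1] by simp
  show ?thesis
  proof (intro bexI[of _ "\<lambda>x. b x * inverse (LINT x:{0..1}|lborel. b x)"] conjI allI impI)
    show "(\<lambda>x. b x * inverse (LINT x:{0..1}|lborel. b x)) \<in> test_funs"
      by (rule test_fun_mult[OF bt smooth_const])
    show "b x * inverse (LINT x:{0..1}|lborel. b x) = 0" if "x \<notin> {0<..<1}" for x
      using that by (auto simp: b_def bump_def flat_def)
    show "(LINT x:{0..1}|lborel. b x * inverse (LINT x:{0..1}|lborel. b x)) = 1"
      using nz by (simp add: set_integral_mult_left)
  qed
qed

lemma smooth_step:
  "\<exists>s. smooth s \<and> (\<forall>x\<le>0. s x = 0) \<and> (\<forall>x\<ge>1. s x = 1)"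
proof -
  obtain \<eta> where \<eta>: "\<eta> \<in> test_funs" "\<forall>x. x \<notin> {0<..<1} \<longrightarrow> \<eta> x = 0" "(LINT x:{0..1}|lborel. \<eta> x) = 1"
    using test_fun_integral_one by blast
  have cont: "continuous_on UNIV \<eta>" by (intro smooth_continuous test_fun_smooth \<eta>)
  obtain s where s: "prim \<eta> s" "s 0 = 0"
    using prim_exists[OF loc_integrable_continuous[OF cont]] by blast
  have zero: "(LINT x:{a..b}|lborel. \<eta> x) = 0" if "b \<le> 0 \<or> 1 \<le> a" for a b
  proof -
    have "indicator {a..b} x *\<^sub>R \<eta> x = 0" for x
      using that \<eta>(2) by (auto simp: indicator_def)
    then show ?thesis unfolding set_lebesgue_integral_def by (simp only: integral_zero)
  qed
  show ?thesis
  proof (intro exI[of _ s] conjI allI impI)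
    show "smooth s"
      by (rule smooth_of_deriv[OF prim_deriv[OF s(1) cont] test_fun_smooth[OF \<eta>(1)]])
    show "s x = 0" if "x \<le> 0" for x
      using prim_integral[OF s(1) that] zero[of 0 x] s(2) by simp
    have "s 1 = 1"
      using prim_integral[OF s(1), of 0 1] \<eta>(3) s(2) by simp
    then show "s x = 1" if "1 \<le> x" for x
      using prim_integral[OF s(1) that] zero[of x 1] by simp
  qed
qed

section \<open>Weak derivatives\<close>

lemma integral_compact_support:
  assumes "loc_integrable f" "\<And>x. R \<le> \<bar>x\<bar> \<Longrightarrow> f x = 0"
  shows "integrable lborel f" "(\<integral>x. f x \<partial>lborel) = (LINT x:{-R..R}|lborel. f x)"
proof -
  have eq: "(\<lambda>x. indicator {-R..R} x *\<^sub>R f x) = f"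
  proof
    fix x
    show "indicator {-R..R} x *\<^sub>R f x = f x"
      using assms(2)[of x] by (cases "R \<le> \<bar>x\<bar>") (auto simp: indicator_def abs_le_iff)
  qed
  show "integrable lborel f"
    using loc_integrable_set_integrable[OF assms(1), of "-R" R] unfolding set_integrable_def eq .
  show "(\<integral>x. f x \<partial>lborel) = (LINT x:{-R..R}|lborel. f x)"
    unfolding set_lebesgue_integral_def eq ..
qed

lemma test_fun_mult_integrable:
  assumes "loc_integrable g" "\<phi> \<in> test_funs"
  shows "integrable lborel (\<lambda>x. g x * \<phi> x)"
proof -
  obtain R where "\<forall>x. R \<le> \<bar>x\<bar> \<longrightarrow> \<phi> x = 0 \<and> vderiv \<phi> x = 0"
    using test_fun_support[OF assms(2)] by blast
  then show ?thesis
    by (intro integral_compact_support(1)[where R = R] loc_integrable_mult_continuous[OF assms(1)]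
      smooth_continuous[OF test_fun_smooth[OF assms(2)]]) auto
qed

lemma prim_has_weak_deriv:
  assumes "prim g F"
  shows "has_weak_deriv F g"
  unfolding has_weak_deriv_def
proof (intro conjI ballI)
  show "loc_integrable F" by (rule loc_integrable_continuous[OF prim_continuous[OF assms]])
  show "loc_integrable g" by (rule prim_loc_integrable[OF assms])
  fix \<phi> :: cfun assume \<phi>: "\<phi> \<in> test_funs"
  obtain R where R: "0 < R" "\<forall>x. R \<le> \<bar>x\<bar> \<longrightarrow> \<phi> x = 0 \<and> vderiv \<phi> x = 0"
    using test_fun_support[OF \<phi>] by blast
  have i: "integrable lborel (\<lambda>x. F x * vderiv \<phi> x)" "integrable lborel (\<lambda>x. g x * \<phi> x)"
    by (intro test_fun_mult_integrable \<phi> test_fun_vderiv \<open>loc_integrable F\<close> \<open>loc_integrable g\<close>)+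
  have p: "prim (\<lambda>x. g x * \<phi> x + vderiv \<phi> x * F x) (\<lambda>x. F x * \<phi> x)"
    by (rule prim_mult[OF assms smooth_prim[OF test_fun_smooth[OF \<phi>]]])
  have "(\<integral>x. g x * \<phi> x + vderiv \<phi> x * F x \<partial>lborel) = (LINT x:{-R..R}|lborel. g x * \<phi> x + vderiv \<phi> x * F x)"
    by (rule integral_compact_support(2)[OF prim_loc_integrable[OF p]]) (use R in auto)
  also have "\<dots> = F R * \<phi> R - F (-R) * \<phi> (-R)"
    using prim_integral[OF p, of "-R" R] R(1) by simp
  also have "\<dots> = 0" using R by simp
  finally have "(\<integral>x. g x * \<phi> x + F x * vderiv \<phi> x \<partial>lborel) = 0"
    by (simp only: mult.commute[of "vderiv \<phi> _"])
  then show "(\<integral>x. F x * vderiv \<phi> x \<partial>lborel) = - (\<integral>x. g x * \<phi> x \<partial>lborel)"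
    using i by (simp add: eq_neg_iff_add_eq_0 add.commute)
qed

section \<open>The fundamental lemma of the calculus of variations\<close>

lemma AE_zero_of_prim_const:
  assumes "prim g (\<lambda>_. c)"
  shows "AE x in lborel. g x = 0"
proof -
  have z: "(LINT x:{a..b}|lborel. g x) = 0" for a b
    using prim_integral[OF assms, of a b] by (cases "a \<le> b") (auto simp: set_lebesgue_integral_def)
  have "AE x in lborel. indicator {- real n..real n} x *\<^sub>R g x = 0" for n
  proof -
    define h where "h x = indicator {- real n..real n} x *\<^sub>R g x" for x
    have h: "integrable lborel h"
      using prim_set_integrable[OF assms, of "- real n" "real n"] unfolding h_def set_integrable_def .
    have hs: "set_integrable lborel A h" if "A \<in> sets borel" for A
      unfolding set_integrable_def by (rule integrable_mult_indicator) (use that h in auto)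
    have h0: "(\<integral>x. h x \<partial>lborel) = 0"
      using z unfolding h_def set_lebesgue_integral_def .
    \<comment> \<open>The half lines form an intersection-stable generator of the Borel sets, and
      the sets on which the integral of \<open>h\<close> vanishes are closed under complements and
      countable disjoint unions. Cutting \<open>g\<close> to a bounded interval makes
      \<open>h\<close> integrable on the whole line, which the complement step requires.\<close>
    have "(LINT x:A|lborel. h x) = 0" if "A \<in> sets borel" for A
    proof -
      have "Int_stable (range (\<lambda>a::real. {..a}))"
        unfolding Int_stable_def by (auto simp: image_iff Int_atMost)
      moreover have "range (\<lambda>a::real. {..a}) \<subseteq> Pow UNIV" by auto
      moreover have "A \<in> sigma_sets UNIV (range (\<lambda>a::real. {..a}))"
        using that unfolding borel_eq_atMost by (simp add: sets_measure_of)
      ultimately show ?thesis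
      proof (induction rule: sigma_sets_induct_disjoint)
        case (basic A)
        then obtain a where "A = {..a}" by blast
        then have "(LINT x:A|lborel. h x) = (LINT x:{- real n..min a (real n)}|lborel. g x)"
          unfolding set_lebesgue_integral_def h_def
          by (intro Bochner_Integration.integral_cong) (auto simp: indicator_def)
        then show ?case using z by simp
      next
        case empty
        then show ?case by (simp add: set_lebesgue_integral_def)
      next
        case (compl A)
        then have A: "A \<in> sets borel" unfolding borel_eq_atMost by (simp add: sets_measure_of)
        have "(LINT x:UNIV - A|lborel. h x) = (\<integral>x. h x - indicator A x *\<^sub>R h x \<partial>lborel)"
          unfolding set_lebesgue_integral_def
          by (intro Bochner_Integration.integral_cong) (auto simp: indicator_def)
        also have "\<dots> = (\<integral>x. h x \<partial>lborel) - (LINT x:A|lborel. h x)"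
          using h hs[OF A] unfolding set_lebesgue_integral_def set_integrable_def
          by (rule Bochner_Integration.integral_diff)
        finally show ?case using compl h0 by simp
      next
        case (union A)
        then have A: "A i \<in> sets borel" for i
          unfolding borel_eq_atMost by (auto simp: sets_measure_of)
        have "(LINT x:(\<Union>i. A i)|lborel. h x) = (\<Sum>i. (LINT x:(A i)|lborel. h x))"
        proof (rule lebesgue_integral_countable_add)
          show "set_integrable lborel (\<Union>i. A i) h" by (rule hs) (use A in auto)
          show "A i \<inter> A j = {}" if "i \<noteq> j" for i j
            using union(1) that by (auto simp: disjoint_family_on_def)
        qed (use A in auto)
        then show ?case using union by simp
      qed
    qed
    then have "AE x in lborel. h x = 0"
      by (intro sigma_finite_measure.density_zero[OF sigma_finite_lborel] h) auto
    then show ?thesis by (simp only: h_def)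
  qed
  then have "AE x in lborel. \<forall>n. indicator {- real n..real n} x *\<^sub>R g x = 0"
    by (simp only: AE_all_countable) blast
  then show ?thesis
  proof eventually_elim
    case (elim x)
    obtain n :: nat where "\<bar>x\<bar> \<le> real n" using real_arch_simple by blast
    then have "indicator {- real n..real n} x = (1::real)" by (simp add: abs_le_iff)
    with spec[OF elim, of n] show ?case by simp
  qed
qed

text \<open>Testing against bumps and passing to the limit shows that \<open>g\<close> integrates to
  0 over every interval, so that the constant 0 is a primitive of \<open>g\<close>.\<close>

lemma fundamental_lemma:
  assumes g: "loc_integrable g" and z: "\<And>\<phi>. \<phi> \<in> test_funs \<Longrightarrow> (\<integral>x. g x * \<phi> x \<partial>lborel) = 0"
  shows "AE x in lborel. g x = 0"
proof (rule AE_zero_of_prim_const[of _ 0])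
  have "(LINT x:{a..b}|lborel. g x) = 0" for a b
  proof -
    note [measurable] = loc_integrable_measurable[OF g]
    have [measurable]: "(\<lambda>x. complex_of_real (bump a b n x)) \<in> borel_measurable borel" for n
      by (intro borel_measurable_continuous_onI smooth_continuous test_fun_smooth bump_test_fun)
    have "(\<lambda>n. \<integral>x. g x * complex_of_real (bump a b n x) \<partial>lborel) \<longlonglongrightarrow> (LINT x:{a<..<b}|lborel. g x)"
      unfolding set_lebesgue_integral_def
    proof (rule integral_dominated_convergence)
      show "integrable lborel (\<lambda>x. cmod (indicator {a..b} x *\<^sub>R g x))"
        using loc_integrable_set_integrable[OF g, of a b] unfolding set_integrable_def
        by (rule integrable_norm)
      show "AE x in lborel. (\<lambda>n. g x * complex_of_real (bump a b n x)) \<longlonglongrightarrow> indicator {a<..<b} x *\<^sub>R g x"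
      proof (rule AE_I2)
        fix x
        have "(\<lambda>n. g x * complex_of_real (bump a b n x)) \<longlonglongrightarrow> g x * complex_of_real (indicator {a<..<b} x)"
          by (intro tendsto_intros bump_tendsto)
        then show "(\<lambda>n. g x * complex_of_real (bump a b n x)) \<longlonglongrightarrow> indicator {a<..<b} x *\<^sub>R g x"
          by (simp add: scaleR_conv_of_real mult.commute)
      qed
      show "AE x in lborel. norm (g x * complex_of_real (bump a b n x)) \<le> cmod (indicator {a..b} x *\<^sub>R g x)" for n
      proof (rule AE_I2)
        fix x
        have "bump a b n x = 0" if "x \<notin> {a..b}"
          using that by (auto simp: bump_def flat_def zero_less_mult_iff simp del: of_nat_Suc)
        then show "norm (g x * complex_of_real (bump a b n x)) \<le> cmod (indicator {a..b} x *\<^sub>R g x)"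
          using mult_left_mono[OF bump_bounds(2)[of a b n x] norm_ge_zero[of "g x"]] bump_bounds(1)[of a b n x]
          by (cases "x \<in> {a..b}") (simp_all add: norm_mult)
      qed
    qed measurable
    then have "(\<lambda>n. 0) \<longlonglongrightarrow> (LINT x:{a<..<b}|lborel. g x)"
      by (simp only: z[OF bump_test_fun])
    from LIMSEQ_unique[OF this tendsto_const] have "(LINT x:{a<..<b}|lborel. g x) = 0" .
    moreover have "(LINT x:{a..b}|lborel. g x) = (LINT x:{a<..<b}|lborel. g x)"
      unfolding set_lebesgue_integral_def
    proof (rule integral_cong_AE)
      show "AE x in lborel. indicator {a..b} x *\<^sub>R g x = indicator {a<..<b} x *\<^sub>R g x"
        using AE_lborel_singleton[of a] AE_lborel_singleton[of b]
        by eventually_elim (auto simp: indicator_def)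
    qed measurable
    ultimately show ?thesis by simp
  qed
  then show "prim g (\<lambda>_. 0)"
    by (simp add: prim_def g)
qed

lemma weak_deriv_unique:
  assumes "has_weak_deriv f g" "has_weak_deriv f h"
  shows "AE x in lborel. g x = h x"
proof -
  have l: "loc_integrable g" "loc_integrable h"
    using assms by (auto simp: has_weak_deriv_def)
  have "AE x in lborel. g x - h x = 0"
  proof (rule fundamental_lemma[OF loc_integrable_diff[OF l]])
    fix \<phi> :: cfun assume \<phi>: "\<phi> \<in> test_funs"
    have "(\<integral>x. g x * \<phi> x \<partial>lborel) = (\<integral>x. h x * \<phi> x \<partial>lborel)"
      using assms \<phi> unfolding has_weak_deriv_def by simp
    then show "(\<integral>x. (g x - h x) * \<phi> x \<partial>lborel) = 0"
      using test_fun_mult_integrable[OF l(1) \<phi>] test_fun_mult_integrable[OF l(2) \<phi>]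
      by (simp add: left_diff_distrib)
  qed
  then show ?thesis by simp
qed

lemma test_fun_scale: "\<phi> \<in> test_funs \<Longrightarrow> (\<lambda>x. c * \<phi> x) \<in> test_funs"
  using test_fun_mult[OF _ smooth_const[of c], of \<phi>] by (simp only: mult.commute)

lemma test_fun_add:
  assumes "\<phi> \<in> test_funs" "\<psi> \<in> test_funs"
  shows "(\<lambda>x. \<phi> x + \<psi> x) \<in> test_funs"
proof -
  obtain R where R: "\<forall>x. R \<le> \<bar>x\<bar> \<longrightarrow> \<phi> x = 0 \<and> vderiv \<phi> x = 0"
    using test_fun_support[OF assms(1)] by blast
  obtain S where S: "\<forall>x. S \<le> \<bar>x\<bar> \<longrightarrow> \<psi> x = 0 \<and> vderiv \<psi> x = 0"
    using test_fun_support[OF assms(2)] by blast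
  show ?thesis
  proof (rule test_funI[of _ "- max R S" "max R S"])
    show "smooth (\<lambda>x. \<phi> x + \<psi> x)"
      by (rule smooth_add[OF assms[THEN test_fun_smooth]])
    show "\<phi> x + \<psi> x = 0" if "x \<notin> {- max R S..max R S}" for x
    proof -
      have "R \<le> \<bar>x\<bar>" "S \<le> \<bar>x\<bar>" using that by auto
      then show ?thesis using R S by simp
    qed
  qed
qed

text \<open>The primitive that starts at -R vanishes to the left of the support, and to the right of
  it because the total integral is 0.\<close>

lemma test_fun_antiderivative:
  assumes "\<psi> \<in> test_funs" "(\<integral>x. \<psi> x \<partial>lborel) = 0"
  shows "\<exists>\<phi>\<in>test_funs. vderiv \<phi> = \<psi>"
proof -
  obtain R where R: "0 < R" "\<forall>x. R \<le> \<bar>x\<bar> \<longrightarrow> \<psi> x = 0 \<and> vderiv \<psi> x = 0"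
    using test_fun_support[OF assms(1)] by blast
  have cont: "continuous_on UNIV \<psi>" by (rule smooth_continuous[OF test_fun_smooth[OF assms(1)]])
  obtain F where F: "prim \<psi> F" using prim_exists[OF loc_integrable_continuous[OF cont]] by blast
  define \<phi> where "\<phi> x = F x - F (- R)" for x
  have p: "prim \<psi> \<phi>"
    using prim_diff[OF F prim_const[of "F (- R)"]] by (simp add: \<phi>_def[abs_def])
  have sup: "\<phi> x = 0" if "x \<notin> {-R..R}" for x
  proof (cases "x \<le> - R")
    case True
    have "(LINT t:{x..-R}|lborel. \<psi> t) = 0"
      unfolding set_lebesgue_integral_def
      by (rule integral_eq_zero_AE) (use R in \<open>auto simp: indicator_def\<close>)
    then show ?thesis using prim_integral[OF p True] by (simp add: \<phi>_def)
  next
    case False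
    with that have "R \<le> x" by auto
    have "(LINT t:{R..x}|lborel. \<psi> t) = 0"
      unfolding set_lebesgue_integral_def
      by (rule integral_eq_zero_AE) (use R in \<open>auto simp: indicator_def\<close>)
    then have "\<phi> x = \<phi> R" using prim_integral[OF p \<open>R \<le> x\<close>] by simp
    also have "\<dots> = (LINT t:{-R..R}|lborel. \<psi> t)"
      using prim_integral[OF p, of "-R" R] R(1) by (simp add: \<phi>_def)
    also have "\<dots> = 0"
      using integral_compact_support(2)[OF loc_integrable_continuous[OF cont], of R] R assms(2) by simp
    finally show ?thesis .
  qed
  have "\<phi> \<in> test_funs"
    by (rule test_funI[OF smooth_of_deriv[OF prim_deriv[OF p cont] test_fun_smooth[OF assms(1)]] sup])
  moreover have "vderiv \<phi> = \<psi>" by (rule vderiv_eqI[OF prim_deriv[OF p cont]])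
  ultimately show ?thesis by blast
qed

lemma test_fun_integrable: "\<phi> \<in> test_funs \<Longrightarrow> integrable lborel \<phi>"
  using test_fun_mult_integrable[OF loc_integrable_continuous[OF continuous_on_const[of _ 1]]] by simp

text \<open>The argument of Du Bois-Reymond: a test function minus its integral times the normalised
  bump has integral 0, hence is the derivative of a test function, and \<open>u\<close> pairs to 0
  with it. The constant is the pairing of \<open>u\<close> with the normalised bump.\<close>

lemma weak_deriv_zero_imp_const:
  assumes u: "loc_integrable u" and z: "\<And>\<phi>. \<phi> \<in> test_funs \<Longrightarrow> (\<integral>x. u x * vderiv \<phi> x \<partial>lborel) = 0"
  shows "\<exists>c. AE x in lborel. u x = c"
proof -
  obtain \<eta> where \<eta>: "\<eta> \<in> test_funs" "\<forall>x. x \<notin> {0<..<1} \<longrightarrow> \<eta> x = 0" "(LINT x:{0..1}|lborel. \<eta> x) = 1"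
    using test_fun_integral_one by blast
  have "(\<lambda>x. indicator {0..1} x *\<^sub>R \<eta> x) = \<eta>"
    using \<eta>(2) by (auto simp: indicator_def fun_eq_iff)
  then have \<eta>1: "(\<integral>x. \<eta> x \<partial>lborel) = 1"
    using \<eta>(3) by (simp only: set_lebesgue_integral_def)
  define c where "c = (\<integral>x. u x * \<eta> x \<partial>lborel)"
  have "AE x in lborel. u x - c = 0"
  proof (rule fundamental_lemma)
    show "loc_integrable (\<lambda>x. u x - c)"
      by (intro loc_integrable_diff u loc_integrable_continuous continuous_on_const)
    fix \<psi> :: cfun assume \<psi>: "\<psi> \<in> test_funs"
    define I where "I = (\<integral>x. \<psi> x \<partial>lborel)"
    have t: "(\<lambda>x. \<psi> x + (- I) * \<eta> x) \<in> test_funs"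
      by (intro test_fun_add \<psi> test_fun_scale \<eta>)
    have "(\<integral>x. \<psi> x + (- I) * \<eta> x \<partial>lborel) = I + (- I) * 1"
      using test_fun_integrable[OF \<psi>] test_fun_integrable[OF \<eta>(1)] \<eta>1 by (simp add: I_def)
    then obtain \<phi> where "\<phi> \<in> test_funs" "vderiv \<phi> = (\<lambda>x. \<psi> x + (- I) * \<eta> x)"
      using test_fun_antiderivative[OF t] by auto
    then have "(\<integral>x. u x * (\<psi> x + (- I) * \<eta> x) \<partial>lborel) = 0"
      using z[of \<phi>] by simp
    moreover have "u x * (\<psi> x + (- I) * \<eta> x) = u x * \<psi> x + (- I) * (u x * \<eta> x)" for x
      by (simp add: algebra_simps)
    ultimately have "(\<integral>x. u x * \<psi> x \<partial>lborel) - I * c = 0"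
      using test_fun_mult_integrable[OF u \<psi>] test_fun_mult_integrable[OF u \<eta>(1)]
      by (simp add: c_def)
    then have "(\<integral>x. u x * \<psi> x \<partial>lborel) = c * I"
      by (simp add: mult.commute)
    then show "(\<integral>x. (u x - c) * \<psi> x \<partial>lborel) = 0"
      using test_fun_mult_integrable[OF u \<psi>] test_fun_integrable[OF \<psi>]
      by (simp add: left_diff_distrib I_def)
  qed
  then show ?thesis by auto
qed

text \<open>\<open>f\<close> and any primitive of \<open>g\<close> differ by a function with zero
  weak derivative. This is the passage from distributional derivatives to continuous
  representatives, for which the product rule \<open>prim_mult\<close> is available.\<close>

lemma has_weak_deriv_imp_prim:
  assumes "has_weak_deriv f g"
  shows "\<exists>F. prim g F \<and> (AE x in lborel. f x = F x)"
proof -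
  have l: "loc_integrable f" "loc_integrable g"
    using assms by (auto simp: has_weak_deriv_def)
  obtain G where G: "prim g G" using prim_exists[OF l(2)] by blast
  have lG: "loc_integrable G" by (rule loc_integrable_continuous[OF prim_continuous[OF G]])
  have "\<exists>c. AE x in lborel. f x - G x = c"
  proof (rule weak_deriv_zero_imp_const[OF loc_integrable_diff[OF l(1) lG]])
    fix \<phi> :: cfun assume \<phi>: "\<phi> \<in> test_funs"
    have "(\<integral>x. f x * vderiv \<phi> x \<partial>lborel) = (\<integral>x. G x * vderiv \<phi> x \<partial>lborel)"
      using assms prim_has_weak_deriv[OF G] \<phi> by (simp add: has_weak_deriv_def)
    then show "(\<integral>x. (f x - G x) * vderiv \<phi> x \<partial>lborel) = 0"
      using test_fun_mult_integrable[OF l(1) test_fun_vderiv[OF \<phi>]]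
        test_fun_mult_integrable[OF lG test_fun_vderiv[OF \<phi>]]
      by (simp add: left_diff_distrib)
  qed
  then obtain c where c: "AE x in lborel. f x - G x = c" by blast
  have "prim g (\<lambda>x. G x + c)"
    using prim_add[OF G prim_const[of c]] by simp
  moreover have "AE x in lborel. f x = G x + c"
    using c by eventually_elim (simp add: diff_eq_eq add.commute)
  ultimately show ?thesis by blast
qed

lemma has_weak_deriv_AE_cong:
  assumes "has_weak_deriv F g" "f \<in> borel_measurable borel" "AE x in lborel. f x = F x"
  shows "has_weak_deriv f g"
proof -
  have l: "loc_integrable F" "loc_integrable g"
    using assms by (auto simp: has_weak_deriv_def)
  have "AE x in lborel. F x = f x" using assms(3) by eventually_elim simp
  then have lf: "loc_integrable f" by (rule loc_integrable_AE_cong[OF l(1) assms(2)])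
  have "(\<integral>x. f x * vderiv \<phi> x \<partial>lborel) = (\<integral>x. F x * vderiv \<phi> x \<partial>lborel)" if "\<phi> \<in> test_funs" for \<phi>
    using test_fun_mult_integrable[OF l(1) test_fun_vderiv[OF that]]
      test_fun_mult_integrable[OF lf test_fun_vderiv[OF that]] assms(3)
    by (intro integral_cong_AE) auto
  then show ?thesis
    using assms(1) lf by (simp add: has_weak_deriv_def)
qed

lemma weak_deriv_of_prim:
  assumes "prim g F" "f \<in> borel_measurable borel" "AE x in lborel. f x = F x"
  shows "weakly_diff f" "has_weak_deriv f (weak_deriv f)" "AE x in lborel. weak_deriv f x = g x"
    "weak_deriv f \<in> borel_measurable borel"
proof -
  have h: "has_weak_deriv f g"
    by (rule has_weak_deriv_AE_cong[OF prim_has_weak_deriv[OF assms(1)] assms(2,3)])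
  then show "weakly_diff f" by (auto simp: weakly_diff_def)
  show h2: "has_weak_deriv f (weak_deriv f)"
    unfolding weak_deriv_def by (rule someI[of "\<lambda>g. has_weak_deriv f g" g, OF h])
  show "AE x in lborel. weak_deriv f x = g x" by (rule weak_deriv_unique[OF h2 h])
  show "weak_deriv f \<in> borel_measurable borel"
    using h2 by (auto simp: has_weak_deriv_def intro: loc_integrable_measurable)
qed

section \<open>Linear second-order equations\<close>

text \<open>Integrates a bound by a power of |t| outwards from 0 on both sides. Two applications
  give the factor 1 / ((2 n + 1) (2 n + 2)) gained in each Picard step.\<close>

lemma prim_power_bound:
  assumes p: "prim g G" and cont: "continuous_on UNIV g" and "G 0 = 0"
    and bnd: "\<And>t. \<bar>t\<bar> \<le> R \<Longrightarrow> cmod (g t) \<le> C * \<bar>t\<bar> ^ n" and x: "\<bar>x\<bar> \<le> R"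
  shows "cmod (G x) \<le> C * \<bar>x\<bar> ^ Suc n / Suc n"
proof -
  have contG: "continuous_on S G" for S
    by (rule continuous_on_subset[OF prim_continuous[OF p]]) simp
  consider "0 < x" | "x = 0" | "x < 0" by linarith
  then show ?thesis
  proof cases
    case 1
    have "cmod (G x - G 0) \<le> C * x ^ Suc n / Suc n - C * 0 ^ Suc n / Suc n"
    proof (rule differentiable_bound_general[OF 1, of G "\<lambda>t. C * t ^ Suc n / Suc n" g "\<lambda>t. C * t ^ n"])
      show "continuous_on {0..x} G" by (rule contG)
      show "continuous_on {0..x} (\<lambda>t. C * t ^ Suc n / real (Suc n))"
        by (intro continuous_intros) simp
      fix t assume t: "0 < t" "t < x"
      show "(G has_vector_derivative g t) (at t)" by (rule prim_deriv[OF p cont])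
      show "((\<lambda>t. C * t ^ Suc n / real (Suc n)) has_vector_derivative C * t ^ n) (at t)"
        unfolding has_real_derivative_iff_has_vector_derivative[symmetric]
        by (rule DERIV_cong[OF DERIV_cdivide[OF DERIV_cmult[OF DERIV_pow]]]) (simp del: of_nat_Suc)
      show "cmod (g t) \<le> C * t ^ n" using bnd[of t] t x by simp
    qed
    then show ?thesis using 1 assms(3) by simp
  next
    case 2
    then show ?thesis using assms(3) by simp
  next
    case 3
    have "cmod (G 0 - G x) \<le> - (C * (- 0) ^ Suc n / Suc n) - - (C * (- x) ^ Suc n / Suc n)"
    proof (rule differentiable_bound_general[OF 3, of G "\<lambda>t. - (C * (- t) ^ Suc n / Suc n)" g "\<lambda>t. C * (- t) ^ n"])
      show "continuous_on {x..0} G" by (rule contG)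
      show "continuous_on {x..0} (\<lambda>t. - (C * (- t) ^ Suc n / real (Suc n)))"
        by (intro continuous_intros) simp
      fix t assume t: "x < t" "t < 0"
      show "(G has_vector_derivative g t) (at t)" by (rule prim_deriv[OF p cont])
      have "((\<lambda>t. (- t) ^ Suc n) has_real_derivative real (Suc n) * (- 1 * (- t) ^ n)) (at t)"
        by (rule DERIV_cong[OF DERIV_power[OF DERIV_minus[OF DERIV_ident]]]) simp
      from DERIV_minus[OF DERIV_cdivide[OF DERIV_cmult[OF this, of C], of "real (Suc n)"]]
      show "((\<lambda>t. - (C * (- t) ^ Suc n / real (Suc n))) has_vector_derivative C * (- t) ^ n) (at t)"
        unfolding has_real_derivative_iff_has_vector_derivative[symmetric]
        by (rule DERIV_cong) (simp del: of_nat_Suc)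
      show "cmod (g t) \<le> C * (- t) ^ n" using bnd[of t] t x by simp
    qed
    then show ?thesis using 3 assms(3) by simp
  qed
qed

section \<open>Picard iteration for the second-order Volterra equation\<close>

definition antider :: "cfun \<Rightarrow> cfun" where
  "antider g = (SOME F. prim g F \<and> F 0 = 0)"

lemma antider:
  assumes "continuous_on UNIV g"
  shows "prim g (antider g)" "antider g 0 = 0" "continuous_on UNIV (antider g)"
proof -
  have "\<exists>F. prim g F \<and> F 0 = 0"
    using prim_exists[OF loc_integrable_continuous[OF assms]] by blast
  then have "prim g (antider g) \<and> antider g 0 = 0"
    unfolding antider_def by (rule someI_ex)
  then show "prim g (antider g)" "antider g 0 = 0" by auto
  then show "continuous_on UNIV (antider g)" using prim_continuous by blast
qed

lemma prim_sum:
  assumes "\<And>i::nat. prim (f i) (F i)"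
  shows "prim (\<lambda>x. \<Sum>i<n. f i x) (\<lambda>x. \<Sum>i<n. F i x)"
proof (induction n)
  case 0
  then show ?case using prim_const[of 0] by simp
next
  case (Suc n)
  then show ?case using prim_add[OF Suc assms[of n]] by simp
qed

primrec picard :: "cfun \<Rightarrow> cfun \<Rightarrow> nat \<Rightarrow> cfun" where
  "picard Q F 0 = F"
| "picard Q F (Suc n) = antider (antider (\<lambda>x. Q x * picard Q F n x))"

context
  fixes Q F :: cfun
  assumes Q: "continuous_on UNIV Q" and F: "continuous_on UNIV F"
begin

lemma picard_continuous: "continuous_on UNIV (picard Q F n)"
  by (induction n) (auto intro!: F Q antider(3) continuous_intros)

lemma picard_step_continuous: "continuous_on UNIV (\<lambda>x. Q x * picard Q F n x)"
  by (intro continuous_intros Q picard_continuous)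

lemma picard_bound:
  assumes "\<And>t. \<bar>t\<bar> \<le> R \<Longrightarrow> cmod (Q t) \<le> M" "\<And>t. \<bar>t\<bar> \<le> R \<Longrightarrow> cmod (F t) \<le> B" "0 \<le> M" "0 \<le> B"
  shows "\<bar>x\<bar> \<le> R \<Longrightarrow> cmod (picard Q F n x) \<le> B * M ^ n / fact (2 * n) * \<bar>x\<bar> ^ (2 * n)"
proof (induction n arbitrary: x)
  case 0
  then show ?case using assms(2) by simp
next
  case (Suc n)
  let ?c = "M * (B * M ^ n / fact (2 * n))"
  have 1: "cmod (Q t * picard Q F n t) \<le> ?c * \<bar>t\<bar> ^ (2 * n)" if "\<bar>t\<bar> \<le> R" for t
    using mult_mono[OF assms(1)[OF that] Suc.IH[OF that] \<open>0 \<le> M\<close> norm_ge_zero]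
    by (simp only: norm_mult mult.assoc)
  have 2: "cmod (antider (\<lambda>x. Q x * picard Q F n x) t) \<le> ?c / Suc (2 * n) * \<bar>t\<bar> ^ Suc (2 * n)" if "\<bar>t\<bar> \<le> R" for t
    using prim_power_bound[OF antider(1)[OF picard_step_continuous] picard_step_continuous
      antider(2)[OF picard_step_continuous] 1 that] by simp
  note c = antider(3)[OF picard_step_continuous]
  have "cmod (picard Q F (Suc n) x) \<le> ?c / Suc (2 * n) * \<bar>x\<bar> ^ Suc (Suc (2 * n)) / Suc (Suc (2 * n))"
    using prim_power_bound[OF antider(1)[OF c] c antider(2)[OF c] 2 Suc.prems] by simp
  also have "\<dots> = B * M ^ Suc n / fact (2 * Suc n) * \<bar>x\<bar> ^ (2 * Suc n)"
    by (simp add: field_simps)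
  finally show ?case .
qed

text \<open>The Picard series converges uniformly on compact intervals by the M-test, each step
  integrating twice and hence contributing to the factorial of 2 n. The conclusion says that f - F,
  and not \<open>f\<close>, is a second primitive of Q f, so \<open>F\<close> need only be
  continuous.\<close>

lemma volterra_exists:
  "\<exists>f f1. continuous_on UNIV f \<and> prim (\<lambda>x. Q x * f x) f1 \<and> f1 0 = 0 \<and>
     prim f1 (\<lambda>x. f x - F x) \<and> f 0 = F 0"
proof -
  define f where "f x = (\<Sum>n. picard Q F n x)" for x
  define s where "s n x = (\<Sum>i<n. picard Q F i x)" for n x
  have bound: "\<exists>M\<ge>0. \<exists>B\<ge>0. (\<forall>t. \<bar>t\<bar> \<le> R \<longrightarrow> cmod (Q t) \<le> M) \<and> (\<forall>t. \<bar>t\<bar> \<le> R \<longrightarrow> cmod (F t) \<le> B)" for R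
  proof -
    obtain M where M: "\<forall>x\<in>{-R..R}. cmod (Q x) \<le> M" using continuous_locally_bounded[OF Q] by blast
    obtain B where B: "\<forall>x\<in>{-R..R}. cmod (F x) \<le> B" using continuous_locally_bounded[OF F] by blast
    show ?thesis
    proof (rule exI[of _ "\<bar>M\<bar>"], rule conjI[OF abs_ge_zero], rule exI[of _ "\<bar>B\<bar>"], intro conjI allI impI)
      fix t assume "\<bar>t\<bar> \<le> R"
      then have "t \<in> {-R..R}" by (simp add: abs_le_iff)
      then have "cmod (Q t) \<le> M" "cmod (F t) \<le> B" using M B by blast+
      then show "cmod (Q t) \<le> \<bar>M\<bar>" "cmod (F t) \<le> \<bar>B\<bar>" by linarith+
    qed simp_all
  qed
  have unif: "uniform_limit {-R..R} s f sequentially" for R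
  proof -
    obtain M B where MB: "0 \<le> M" "0 \<le> B" "\<forall>t. \<bar>t\<bar> \<le> R \<longrightarrow> cmod (Q t) \<le> M" "\<forall>t. \<bar>t\<bar> \<le> R \<longrightarrow> cmod (F t) \<le> B"
      using bound[of R] by blast
    have "uniform_limit {-R..R} (\<lambda>n x. \<Sum>i<n. picard Q F i x) (\<lambda>x. \<Sum>i. picard Q F i x) sequentially"
    proof (rule Weierstrass_m_test)
      fix n x assume "x \<in> {-R..R}"
      then have x: "\<bar>x\<bar> \<le> R" by auto
      have "cmod (picard Q F n x) \<le> B * M ^ n / fact (2 * n) * \<bar>x\<bar> ^ (2 * n)"
        by (rule picard_bound[of R]) (use MB x in auto)
      also have "\<dots> \<le> B * M ^ n / fact n * R ^ (2 * n)"
        using MB(1,2) x by (intro mult_mono divide_left_mono power_mono fact_mono) auto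
      also have "\<dots> = B * (inverse (fact n) * (M * R\<^sup>2) ^ n)"
        unfolding power_mult power_mult_distrib by (simp add: field_simps)
      finally show "cmod (picard Q F n x) \<le> B * (inverse (fact n) * (M * R\<^sup>2) ^ n)" .
    qed (intro summable_mult summable_exp)
    then show ?thesis by (simp only: s_def[abs_def] f_def[abs_def])
  qed
  have cont_s: "continuous_on UNIV (s n)" for n
    unfolding s_def[abs_def] by (intro continuous_on_sum picard_continuous)
  have cont_f: "continuous_on UNIV f"
  proof -
    have "isCont f x" for x
    proof -
      have "continuous_on {-(\<bar>x\<bar>+1)..\<bar>x\<bar>+1} f"
        by (rule uniform_limit_theorem[OF _ unif]) (auto intro!: always_eventually continuous_on_subset[OF cont_s])
      then show ?thesis
        by (rule continuous_on_interior) (simp, linarith)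
    qed
    then show ?thesis by (simp add: continuous_at_imp_continuous_on)
  qed
  have cont_Qf: "continuous_on UNIV (\<lambda>x. Q x * f x)"
    by (intro continuous_intros Q cont_f)
  define f1 where "f1 = antider (\<lambda>x. Q x * f x)"
  define v where "v = antider f1"
  note f1 = antider[OF cont_Qf, folded f1_def]
  note v = antider[OF f1(3), folded v_def]
  have "f x = F x + v x" for x
  proof -
    define R where "R = \<bar>x\<bar>"
    obtain M where M: "0 \<le> M" "\<forall>t. \<bar>t\<bar> \<le> R \<longrightarrow> cmod (Q t) \<le> M" using bound[of R] by blast
    \<comment> \<open>The second primitive of Q (f - s n) that vanishes to first order at 0 is v -
      (s (n + 1) - F), since one more iteration turns the partial sum \<open>s n\<close> into
      \<open>s (Suc n)\<close> without its first term. So the distance of \<open>s n\<close> from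
      \<open>f\<close> controls the defect in the limit equation.\<close>
    have est: "cmod (v x - (s (Suc n) x - F x)) \<le> M * e * R * R"
      if e: "0 \<le> e" "\<And>t. \<bar>t\<bar> \<le> R \<Longrightarrow> cmod (s n t - f t) \<le> e" for n e
    proof -
      let ?g = "\<lambda>x. Q x * f x - (\<Sum>i<n. Q x * picard Q F i x)"
      let ?G = "\<lambda>x. f1 x - (\<Sum>i<n. antider (\<lambda>x. Q x * picard Q F i x) x)"
      let ?H = "\<lambda>x. v x - (\<Sum>i<n. picard Q F (Suc i) x)"
      have pG: "prim ?g ?G"
        by (intro prim_diff f1 prim_sum antider(1) picard_step_continuous)
      have pH: "prim ?G ?H"
        unfolding picard.simps by (intro prim_diff v prim_sum antider(1) antider(3) picard_step_continuous)
      have cg: "continuous_on UNIV ?g"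
        by (intro continuous_intros Q cont_f picard_continuous)
      have "cmod (?g t) \<le> (M * e) * \<bar>t\<bar> ^ 0" if "\<bar>t\<bar> \<le> R" for t
      proof -
        have "?g t = Q t * (f t - s n t)"
          by (simp add: s_def sum_distrib_left right_diff_distrib)
        then have "cmod (?g t) = cmod (Q t) * cmod (s n t - f t)"
          by (simp add: norm_mult norm_minus_commute)
        also have "\<dots> \<le> M * e"
          using M e that by (intro mult_mono) auto
        finally show ?thesis by simp
      qed
      from prim_power_bound[OF pG cg _ this]
      have G: "cmod (?G t) \<le> (M * e) * \<bar>t\<bar> ^ 1" if "\<bar>t\<bar> \<le> R" for t
        using that f1(2) antider(2)[OF picard_step_continuous] by simp
      have H0: "?H 0 = 0"
        using v(2) antider(2)[OF antider(3)[OF picard_step_continuous]] by simp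
      have xR: "\<bar>x\<bar> \<le> R" by (simp add: R_def)
      have "cmod (?H x) \<le> (M * e) * \<bar>x\<bar> ^ Suc 1 / Suc 1"
        by (rule prim_power_bound[OF pH prim_continuous[OF pG] H0 G xR])
      also have "\<dots> \<le> M * e * R * R"
      proof -
        have "0 \<le> (M * e) * (\<bar>x\<bar> * \<bar>x\<bar>)" using M(1) e(1) by simp
        then show ?thesis by (simp add: R_def mult.assoc)
      qed
      also have "(\<Sum>i<n. picard Q F (Suc i) x) = s (Suc n) x - F x"
        unfolding s_def sum.lessThan_Suc_shift by simp
      finally show ?thesis .
    qed
    have "(\<lambda>n. s (Suc n) x - F x) \<longlonglongrightarrow> v x"
    proof (rule tendstoI)
      fix \<epsilon> :: real assume "0 < \<epsilon>"
      define e where "e = \<epsilon> / (M * R * R + 1)"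
      have MR: "0 \<le> M * R * R" using M(1) by (simp add: R_def)
      then have e: "0 < e" using \<open>0 < \<epsilon>\<close> by (simp add: e_def)
      have "M * e * R * R < \<epsilon>"
      proof -
        have "M * e * R * R = (M * R * R) * e" by simp
        also have "\<dots> < (M * R * R + 1) * e" using e by simp
        also have "\<dots> = \<epsilon>" using MR by (simp add: e_def)
        finally show ?thesis .
      qed
      have "\<forall>\<^sub>F n in sequentially. \<forall>t\<in>{-R..R}. dist (s n t) (f t) < e"
        using unif[of R] e by (simp add: uniform_limit_iff)
      then show "\<forall>\<^sub>F n in sequentially. dist (s (Suc n) x - F x) (v x) < \<epsilon>"
      proof eventually_elim
        case (elim n)
        have "cmod (v x - (s (Suc n) x - F x)) \<le> M * e * R * R"
          by (rule est) (use elim e in \<open>auto simp: dist_norm abs_le_iff less_imp_le\<close>)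
        then show ?case using \<open>M * e * R * R < \<epsilon>\<close> by (simp add: dist_norm norm_minus_commute)
      qed
    qed
    moreover have "(\<lambda>n. s (Suc n) x - F x) \<longlonglongrightarrow> f x - F x"
    proof (intro tendsto_intros LIMSEQ_Suc)
      have "x \<in> {-R..R}" by (auto simp: R_def)
      then show "(\<lambda>n. s n x) \<longlonglongrightarrow> f x" by (rule tendsto_uniform_limitI[OF unif])
    qed
    ultimately have "v x = f x - F x" by (rule LIMSEQ_unique)
    then show ?thesis by simp
  qed
  then have "v = (\<lambda>x. f x - F x)" by auto
  with cont_f f1 v show ?thesis
    by (intro exI[of _ f] exI[of _ f1]) auto
qed

end

text \<open>As \<open>h\<close> is only locally integrable it is kept out of the iteration: a second
  primitive of -h with Cauchy data (a, b) serves as the continuous inhomogeneity of the Volterra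
  equation.\<close>

lemma linear_ode_exists:
  assumes Q: "continuous_on UNIV Q" and h: "loc_integrable h"
  shows "\<exists>f f1. prim f1 f \<and> prim (\<lambda>x. Q x * f x - h x) f1 \<and> f 0 = a \<and> f1 0 = b"
proof -
  obtain H where H: "prim h H" "H 0 = 0"
    using prim_exists[OF h] by blast
  define F1 where "F1 x = b - H x" for x
  have F1: "prim (\<lambda>x. - h x) F1"
    using prim_diff[OF prim_const H(1)] by (simp add: F1_def[abs_def])
  obtain F where F: "prim F1 F" "F 0 = a"
    using prim_exists[OF loc_integrable_continuous[OF prim_continuous[OF F1]]] by blast
  obtain f f1 where f: "continuous_on UNIV f" "prim (\<lambda>x. Q x * f x) f1" "f1 0 = 0"
    "prim f1 (\<lambda>x. f x - F x)" "f 0 = F 0"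
    using volterra_exists[OF Q prim_continuous[OF F(1)]] by blast
  have "prim (\<lambda>x. f1 x + F1 x) f"
    using prim_add[OF f(4) F(1)] by simp
  moreover have "prim (\<lambda>x. Q x * f x - h x) (\<lambda>x. f1 x + F1 x)"
    using prim_add[OF f(2) F1] by simp
  ultimately show ?thesis
    using f F H by (intro exI[of _ f] exI[of _ "\<lambda>x. f1 x + F1 x"]) (simp add: F1_def)
qed

section \<open>A priori estimates\<close>

definition wd :: "real \<Rightarrow> real" where "wd x = - 2 * sinh x * cosh x * (w x)\<^sup>2"
definition q :: "real \<Rightarrow> real" where "q x = x\<^sup>2 * sinh x"
definition qd :: "real \<Rightarrow> real" where "qd x = 2 * x * sinh x + x\<^sup>2 * cosh x"

lemma abs_sinh_le_cosh: "\<bar>sinh x\<bar> \<le> cosh x" for x :: real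
  by (rule power2_le_imp_le) (simp_all add: cosh_square_real)

lemma w_pos: "0 < w x"
  by (rule weight_pos[OF weight_w])

lemma w_cosh: "w x * (cosh x)\<^sup>2 = 1"
  by (simp add: w_eq)

lemma w_deriv: "(w has_real_derivative wd x) (at x)"
proof -
  have "1 + (sinh x)\<^sup>2 \<noteq> 0"
    by (simp flip: cosh_square_real)
  then show ?thesis
    unfolding w_def[abs_def] wd_def
    by (auto intro!: derivative_eq_intros simp: power2_eq_square)
qed

lemma abs_wd_le: "\<bar>wd x\<bar> \<le> 2 * w x"
proof -
  have "\<bar>wd x\<bar> = 2 * (\<bar>sinh x\<bar> * cosh x) * (w x * w x)"
    by (simp add: wd_def abs_mult power2_eq_square)
  also have "\<dots> \<le> 2 * (cosh x * cosh x) * (w x * w x)"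
    by (intro mult_right_mono mult_left_mono abs_sinh_le_cosh) (auto simp: less_imp_le[OF w_pos])
  also have "\<dots> = 2 * w x * (w x * (cosh x)\<^sup>2)"
    by (simp add: power2_eq_square)
  finally show ?thesis by (simp only: w_cosh mult_1_right)
qed

lemma q_deriv: "(q has_real_derivative qd x) (at x)"
  unfolding q_def[abs_def] qd_def by (auto intro!: derivative_eq_intros simp: power2_eq_square)

text \<open>As q is odd and its derivative even, y \<ge> 0 suffices, where cosh y \<le> sinh y + 1
  bounds the derivative by 2 y sinh y + y^2 sinh y + y^2. For y > 1 the three terms are at most 2 q,
  q and 2 q; on [0, 1] the outer two are at most 3 and 1.\<close>

lemma abs_qd_le: "\<bar>qd x\<bar> \<le> 5 * \<bar>q x\<bar> + 5"
proof -
  have nn: "qd y \<le> 5 * q y + 5" if y: "0 \<le> y" for y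
  proof -
    have s0: "0 \<le> sinh y" using y by simp
    have c: "cosh y \<le> sinh y + 1"
      using y by (simp add: cosh_def sinh_def field_simps)
    show ?thesis
    proof (cases "y \<le> 1")
      case True
      have "exp (1::real) \<le> 3" by (rule exp_le)
      have "sinh 1 = (exp 1 - exp (-1)) / (2::real)" by (simp add: sinh_def)
      also have "\<dots> \<le> (3 - 0) / 2"
        by (intro divide_right_mono diff_mono \<open>exp 1 \<le> 3\<close>) simp_all
      finally have "sinh 1 \<le> (3/2::real)" by simp
      moreover have "sinh y \<le> sinh 1" using True by simp
      ultimately have s: "sinh y \<le> 3/2" by linarith
      have "y\<^sup>2 \<le> 1" using y True by (simp add: power_le_one)
      have "2 * y * sinh y \<le> 2 * 1 * (3/2)" using True y s s0 by (intro mult_mono) auto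
      moreover have "y\<^sup>2 * cosh y \<le> y\<^sup>2 * sinh y + y\<^sup>2"
        using mult_left_mono[OF c, of "y\<^sup>2"] by (simp add: algebra_simps)
      moreover have "0 \<le> y\<^sup>2 * sinh y" using s0 by simp
      ultimately show ?thesis using \<open>y\<^sup>2 \<le> 1\<close> unfolding qd_def q_def by linarith
    next
      case False
      have "2 \<le> exp (1::real)" using exp_ge_add_one_self[of 1] by simp
      then have "inverse (exp (1::real)) \<le> inverse 2" by (intro le_imp_inverse_le) auto
      with \<open>2 \<le> exp (1::real)\<close> have "1/2 \<le> sinh (1::real)" by (simp add: sinh_def exp_minus)
      moreover have "sinh 1 \<le> sinh y" using False by simp
      ultimately have s: "1/2 \<le> sinh y" by linarith
      have "y \<le> y\<^sup>2" using False by (simp add: self_le_power)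
      from mult_right_mono[OF this s0] have "2 * y * sinh y \<le> 2 * (y\<^sup>2 * sinh y)" by simp
      moreover have "y\<^sup>2 * cosh y \<le> y\<^sup>2 * sinh y + y\<^sup>2"
        using mult_left_mono[OF c, of "y\<^sup>2"] by (simp add: algebra_simps)
      moreover have "y\<^sup>2 \<le> 2 * (y\<^sup>2 * sinh y)"
        using mult_left_mono[OF s, of "y\<^sup>2"] by simp
      moreover have "0 \<le> y\<^sup>2 * sinh y" using s0 by simp
      ultimately show ?thesis unfolding qd_def q_def by linarith
    qed
  qed
  have "0 \<le> qd \<bar>x\<bar>" "0 \<le> q \<bar>x\<bar>" by (simp_all add: qd_def q_def)
  moreover have "qd x = qd \<bar>x\<bar>" by (cases "0 \<le> x") (simp_all add: qd_def)
  moreover have "q x = q \<bar>x\<bar> \<or> q x = - q \<bar>x\<bar>" by (cases "0 \<le> x") (simp_all add: q_def)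
  ultimately have "\<bar>qd x\<bar> = qd \<bar>x\<bar>" "\<bar>q x\<bar> = q \<bar>x\<bar>" by auto
  then show ?thesis using nn[of "\<bar>x\<bar>"] by simp
qed

lemma continuous_q: "continuous_on S q"
  unfolding q_def[abs_def] by (intro continuous_intros)

lemma continuous_qd: "continuous_on S qd"
  unfolding qd_def[abs_def] by (intro continuous_intros)

lemma continuous_wd: "continuous_on S wd"
  unfolding wd_def[abs_def] by (intro continuous_intros continuous_w)

lemma prim_of_real:
  assumes "\<And>x. (p has_real_derivative p' x) (at x)" "continuous_on UNIV p'"
  shows "prim (\<lambda>x. complex_of_real (p' x)) (\<lambda>x. complex_of_real (p x))"
  by (rule prim_C1[OF has_vector_derivative_of_real[OF assms(1)]])
    (intro continuous_intros assms(2))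

lemma prim_w: "prim (\<lambda>x. complex_of_real (wd x)) (\<lambda>x. complex_of_real (w x))"
  by (rule prim_of_real[OF w_deriv continuous_wd])

lemma prim_q: "prim (\<lambda>x. complex_of_real (qd x)) (\<lambda>x. complex_of_real (q x))"
  by (rule prim_of_real[OF q_deriv continuous_qd])

definition Q :: cfun where
  "Q x = 3 - \<i> * complex_of_real (q x) / 3"

lemma continuous_Q: "continuous_on S Q"
  unfolding Q_def[abs_def] by (intro continuous_intros continuous_q) simp

section \<open>Pointwise forms of the two energy inequalities\<close>

lemma Re_mult_cnj_bound: "\<bar>Re (a * cnj b)\<bar> \<le> cmod a * cmod b" "\<bar>Im (a * cnj b)\<bar> \<le> cmod a * cmod b"
  using abs_Re_le_cmod[of "a * cnj b"] abs_Im_le_cmod[of "a * cnj b"] by (simp_all add: norm_mult)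

lemma mult_cnj_square: "a * cnj a = complex_of_real ((cmod a)\<^sup>2)"
  by (simp only: complex_norm_square)

text \<open>With a, b, W for f, f', w, this bounds the real part of the derivative of f' cnj f w
  from below; the contribution of \<open>r\<close> is imaginary and drops out. Of the coefficient 3
  of |a|^2, the drift term takes 2 through 2 |b a| \<le> |b|^2 / 2 + 2 |a|^2 and the source takes
  1/2. What remains is 1/2 for both |a|^2 and |b|^2.\<close>

lemma energy_pointwise:
  fixes a b h :: complex and r W W' :: real
  assumes "\<bar>W'\<bar> \<le> 2 * W"
  shows "W / 2 * ((cmod a)\<^sup>2 + (cmod b)\<^sup>2 - (cmod h)\<^sup>2)
    \<le> Re ((((3 - \<i> * complex_of_real r / 3) * a - h) * cnj a + cnj b * b) * complex_of_real W
        + complex_of_real W' * (b * cnj a))"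
proof -
  have W: "0 \<le> W" using assms by linarith
  let ?A = "cmod a" and ?B = "cmod b" and ?H = "cmod h"
  have "(((3 - \<i> * complex_of_real r / 3) * a - h) * cnj a + cnj b * b)
    = (3 - \<i> * complex_of_real r / 3) * (a * cnj a) - h * cnj a + b * cnj b"
    by (simp add: algebra_simps)
  also have "Re \<dots> = 3 * ?A\<^sup>2 - Re (h * cnj a) + ?B\<^sup>2"
    unfolding mult_cnj_square by simp
  finally have eq: "Re ((((3 - \<i> * complex_of_real r / 3) * a - h) * cnj a + cnj b * b) * complex_of_real W
      + complex_of_real W' * (b * cnj a))
    = (3 * ?A\<^sup>2 - Re (h * cnj a) + ?B\<^sup>2) * W + W' * Re (b * cnj a)"
    by (simp only: plus_complex.sel Re_complex_of_real Im_complex_of_real times_complex.sel mult_zero_right mult_zero_left diff_0_right)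
  have "Re (h * cnj a) \<le> ?H\<^sup>2 / 2 + ?A\<^sup>2 / 2"
    using Re_mult_cnj_bound(1)[of h a] two_mult_le_squares[of ?H ?A] by linarith
  then have 1: "(5/2 * ?A\<^sup>2 - ?H\<^sup>2 / 2 + ?B\<^sup>2) * W \<le> (3 * ?A\<^sup>2 - Re (h * cnj a) + ?B\<^sup>2) * W"
    using W by (intro mult_right_mono) auto
  have "\<bar>W' * Re (b * cnj a)\<bar> \<le> (2 * W) * (?B * ?A)"
    unfolding abs_mult by (intro mult_mono assms Re_mult_cnj_bound) (use W in auto)
  also have "\<dots> \<le> W * (?B\<^sup>2 / 2 + 2 * ?A\<^sup>2)"
  proof -
    have "2 * (?B * ?A) \<le> ?B\<^sup>2 / 2 + 2 * ?A\<^sup>2"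
      using zero_le_power2[of "?B - 2 * ?A"] by (simp add: power2_eq_square algebra_simps)
    from mult_left_mono[OF this W] show ?thesis by (simp only: mult_ac)
  qed
  finally have 2: "- (W * (?B\<^sup>2 / 2 + 2 * ?A\<^sup>2)) \<le> W' * Re (b * cnj a)" by linarith
  have "W / 2 * (?A\<^sup>2 + ?B\<^sup>2 - ?H\<^sup>2) = (5/2 * ?A\<^sup>2 - ?H\<^sup>2 / 2 + ?B\<^sup>2) * W - W * (?B\<^sup>2 / 2 + 2 * ?A\<^sup>2)"
    by (simp add: algebra_simps)
  with 1 2 show ?thesis unfolding eq by linarith
qed

text \<open>Here r W stands for q w and P for its derivative. In the imaginary part |f'|^2 drops out
  and \<open>Q\<close> contributes r^2 |a|^2 / 3. The source and the derivative of the multiplier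
  each consume 1/12 of r^2 |a|^2, which leaves 1/6. Completing the squares costs 3 |h|^2 and 147
  |b|^2; the constant 150 also covers the remaining 5/2 (|a|^2 + |b|^2).\<close>

lemma separation_pointwise:
  fixes a b h :: complex and r W P :: real
  assumes P: "\<bar>P\<bar> \<le> (7 * \<bar>r\<bar> + 5) * W" and W: "0 \<le> W"
  shows "W * (r\<^sup>2 * (cmod a)\<^sup>2 / 6 - 3 * (cmod h)\<^sup>2 - 150 * ((cmod a)\<^sup>2 + (cmod b)\<^sup>2))
    \<le> - Im ((((3 - \<i> * complex_of_real r / 3) * a - h) * cnj a + cnj b * b) * complex_of_real (r * W)
        + complex_of_real P * (b * cnj a))"
proof -
  let ?A = "cmod a" and ?B = "cmod b" and ?H = "cmod h" and ?R = "\<bar>r\<bar>"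
  have "(((3 - \<i> * complex_of_real r / 3) * a - h) * cnj a + cnj b * b)
    = (3 - \<i> * complex_of_real r / 3) * (a * cnj a) - h * cnj a + b * cnj b"
    by (simp add: algebra_simps)
  also have "Im \<dots> = - (r / 3 * ?A\<^sup>2) - Im (h * cnj a)"
    unfolding mult_cnj_square by simp
  finally have eq: "- Im ((((3 - \<i> * complex_of_real r / 3) * a - h) * cnj a + cnj b * b) * complex_of_real (r * W)
      + complex_of_real P * (b * cnj a))
    = (r / 3 * ?A\<^sup>2 + Im (h * cnj a)) * (r * W) - P * Im (b * cnj a)"
    by (simp only: plus_complex.sel Re_complex_of_real Im_complex_of_real times_complex.sel mult_zero_right mult_zero_left add_0_right add_0_left)
      (simp add: algebra_simps)
  have "\<bar>Im (h * cnj a) * r\<bar> \<le> (?H * ?A) * ?R"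
    unfolding abs_mult by (intro mult_right_mono Re_mult_cnj_bound) auto
  also have "\<dots> \<le> 3 * ?H\<^sup>2 + (?R * ?A)\<^sup>2 / 12"
    using zero_le_power2[of "6 * ?H - ?R * ?A"] by (simp add: power2_eq_square algebra_simps)
  finally have 1: "- (3 * ?H\<^sup>2 + (?R * ?A)\<^sup>2 / 12) \<le> Im (h * cnj a) * r" by linarith
  have "\<bar>P * Im (b * cnj a)\<bar> \<le> ((7 * ?R + 5) * W) * (?B * ?A)"
    unfolding abs_mult by (intro mult_mono P Re_mult_cnj_bound) (use W in auto)
  also have "\<dots> = W * (7 * (?R * ?A) * ?B + 5 * ?A * ?B)"
    by (simp add: algebra_simps)
  also have "\<dots> \<le> W * ((?R * ?A)\<^sup>2 / 12 + 150 * (?A\<^sup>2 + ?B\<^sup>2))"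
  proof (rule mult_left_mono[OF _ W])
    have "7 * (?R * ?A) * ?B \<le> (?R * ?A)\<^sup>2 / 12 + 147 * ?B\<^sup>2"
      using zero_le_power2[of "?R * ?A - 42 * ?B"] by (simp add: power2_eq_square algebra_simps)
    moreover have "5 * ?A * ?B \<le> 5/2 * (?A\<^sup>2 + ?B\<^sup>2)"
      using two_mult_le_squares[of ?A ?B] by simp
    moreover have "147 * ?B\<^sup>2 + 5/2 * (?A\<^sup>2 + ?B\<^sup>2) \<le> 150 * (?A\<^sup>2 + ?B\<^sup>2)"
      using zero_le_power2[of ?A] zero_le_power2[of ?B] unfolding distrib_left by linarith
    ultimately show "7 * (?R * ?A) * ?B + 5 * ?A * ?B \<le> (?R * ?A)\<^sup>2 / 12 + 150 * (?A\<^sup>2 + ?B\<^sup>2)"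
      by linarith
  qed
  finally have 2: "P * Im (b * cnj a) \<le> W * ((?R * ?A)\<^sup>2 / 12 + 150 * (?A\<^sup>2 + ?B\<^sup>2))" by linarith
  have RA: "(?R * ?A)\<^sup>2 = r\<^sup>2 * ?A\<^sup>2" by (simp add: power_mult_distrib)
  have "W * (r\<^sup>2 * ?A\<^sup>2 / 6 - 3 * ?H\<^sup>2 - 150 * (?A\<^sup>2 + ?B\<^sup>2))
    = W * (r\<^sup>2 * ?A\<^sup>2 / 3 - (3 * ?H\<^sup>2 + r\<^sup>2 * ?A\<^sup>2 / 12)) - W * (r\<^sup>2 * ?A\<^sup>2 / 12 + 150 * (?A\<^sup>2 + ?B\<^sup>2))"
    by (simp add: algebra_simps)
  also have "\<dots> \<le> W * (r\<^sup>2 * ?A\<^sup>2 / 3 + Im (h * cnj a) * r) - P * Im (b * cnj a)"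
    using mult_left_mono[OF 1 W] 2 unfolding RA by (simp add: right_diff_distrib distrib_left)
  also have "\<dots> = (r / 3 * ?A\<^sup>2 + Im (h * cnj a)) * (r * W) - P * Im (b * cnj a)"
    by (simp add: algebra_simps power2_eq_square)
  finally show ?thesis unfolding eq .
qed

text \<open>On a compact interval the reciprocal of the weight is bounded by continuity, and |f|
  \<le> 1 + |f|^2.\<close>

lemma L2_loc_integrable:
  assumes \<rho>: "weight \<rho>" "continuous_on UNIV \<rho>" and f: "f \<in> L2 \<rho>"
  shows "loc_integrable f"
  unfolding loc_integrable_def set_integrable_def
proof (intro allI)
  fix a b :: real
  note [measurable] = L2_measurable[OF f] weight_measurable[OF \<rho>(1)]
  have "continuous_on UNIV (\<lambda>x. complex_of_real (inverse (\<rho> x)))"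
    by (intro continuous_intros \<rho>(2)) (use weight_pos[OF \<rho>(1)] in \<open>auto simp: less_le\<close>)
  from continuous_locally_bounded[OF this, of a b]
  obtain C where C: "\<forall>x\<in>{a..b}. cmod (complex_of_real (inverse (\<rho> x))) \<le> C" by blast
  show "integrable lborel (\<lambda>x. indicator {a..b} x *\<^sub>R f x)"
  proof (rule Bochner_Integration.integrable_bound)
    show "integrable lborel (\<lambda>x. indicator {a..b} x + C * ((cmod (f x))\<^sup>2 * \<rho> x))"
      using L2_integrable[OF f] by (intro Bochner_Integration.integrable_add integrable_mult_right integrable_real_indicator)
        (auto simp: emeasure_lborel_Icc_eq)
    show "AE x in lborel. norm (indicator {a..b} x *\<^sub>R f x) \<le> norm (indicator {a..b} x + C * ((cmod (f x))\<^sup>2 * \<rho> x))"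
    proof (rule AE_I2)
      fix x
      show "norm (indicator {a..b} x *\<^sub>R f x) \<le> norm (indicator {a..b} x + C * ((cmod (f x))\<^sup>2 * \<rho> x))"
      proof (cases "x \<in> {a..b}")
        case True
        have pos: "0 < \<rho> x" by (rule weight_pos[OF \<rho>(1)])
        then have "inverse (\<rho> x) \<le> C" using bspec[OF C True] unfolding norm_of_real by simp
        then have "1 \<le> C * \<rho> x" using pos by (simp add: field_simps)
        from mult_left_mono[OF this, of "(cmod (f x))\<^sup>2"]
        have "(cmod (f x))\<^sup>2 \<le> C * ((cmod (f x))\<^sup>2 * \<rho> x)" by (simp add: mult_ac)
        moreover have "cmod (f x) \<le> 1 + (cmod (f x))\<^sup>2"
          using two_mult_le_squares[of 1 "cmod (f x)"] norm_ge_zero[of "f x"] by (simp; linarith)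
        ultimately show ?thesis using True by simp
      qed simp
    qed
  qed measurable
qed

text \<open>The derivative of f' cnj f p for a multiplier p: p = w gives the energy estimate, p = q
  w the separation estimate.\<close>

lemma prim_energy:
  assumes "prim f1 f" "prim f2 f1" "prim p' p"
  shows "prim (\<lambda>x. (f2 x * cnj (f x) + cnj (f1 x) * f1 x) * p x + p' x * (f1 x * cnj (f x)))
    (\<lambda>x. (f1 x * cnj (f x)) * p x)"
  by (rule prim_mult[OF prim_mult[OF assms(2) prim_cnj[OF assms(1)]] assms(3)])

lemma set_integral_Re:
  assumes "set_integrable M S f"
  shows "set_integrable M S (\<lambda>x. Re (f x))" "(LINT x:S|M. Re (f x)) = Re (LINT x:S|M. f x)"
  using assms integrable_Re[of M "\<lambda>x. indicator S x *\<^sub>R f x"] integral_Re[of M "\<lambda>x. indicator S x *\<^sub>R f x"]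
  by (simp_all add: set_integrable_def set_lebesgue_integral_def)

lemma set_integral_Im:
  assumes "set_integrable M S f"
  shows "set_integrable M S (\<lambda>x. Im (f x))" "(LINT x:S|M. Im (f x)) = Im (LINT x:S|M. f x)"
  using assms integrable_Im[of M "\<lambda>x. indicator S x *\<^sub>R f x"] integral_Im[of M "\<lambda>x. indicator S x *\<^sub>R f x"]
  by (simp_all add: set_integrable_def set_lebesgue_integral_def)

lemma L2_set_integral:
  assumes "weight \<rho>" "h \<in> L2 \<rho>" "S \<in> sets borel"
  shows "set_integrable lborel S (\<lambda>x. (cmod (h x))\<^sup>2 * \<rho> x)"
    "(LINT x:S|lborel. (cmod (h x))\<^sup>2 * \<rho> x) \<le> (L2_norm \<rho> h)\<^sup>2"
proof -
  show *: "set_integrable lborel S (\<lambda>x. (cmod (h x))\<^sup>2 * \<rho> x)"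
    unfolding set_integrable_def by (rule integrable_mult_indicator) (use assms L2_integrable in auto)
  show "(LINT x:S|lborel. (cmod (h x))\<^sup>2 * \<rho> x) \<le> (L2_norm \<rho> h)\<^sup>2"
    unfolding L2_norm_square[OF assms(1)] set_lebesgue_integral_def
    by (rule integral_mono[OF *[unfolded set_integrable_def] L2_integrable[OF assms(2)]])
      (use weight_pos[OF assms(1)] in \<open>simp add: indicator_def less_imp_le\<close>)
qed

lemma set_integrable_continuous:
  fixes g :: "real \<Rightarrow> real"
  shows "continuous_on UNIV g \<Longrightarrow> set_integrable lborel {a..b} g"
  by (intro borel_integrable_atLeastAtMost') (auto intro: continuous_on_subset)

lemma prim_qw: "prim (\<lambda>x. complex_of_real (qd x * w x + wd x * q x)) (\<lambda>x. complex_of_real (q x * w x))"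
  using prim_mult[OF prim_q prim_w] by simp

lemma qw_deriv_bound: "\<bar>qd x * w x + wd x * q x\<bar> \<le> (7 * \<bar>q x\<bar> + 5) * w x"
proof -
  have "\<bar>qd x * w x + wd x * q x\<bar> \<le> \<bar>qd x\<bar> * w x + \<bar>wd x\<bar> * \<bar>q x\<bar>"
    using abs_triangle_ineq[of "qd x * w x" "wd x * q x"] w_pos[of x] by (simp add: abs_mult)
  also have "\<dots> \<le> (5 * \<bar>q x\<bar> + 5) * w x + (2 * w x) * \<bar>q x\<bar>"
    by (intro add_mono mult_right_mono abs_qd_le abs_wd_le) (use w_pos[of x] in auto)
  finally show ?thesis by (simp add: algebra_simps)
qed

text \<open>The boundary function f' cnj f p vanishes at both endpoints together with f, so the
  pointwise inequalities can be integrated against 0. Inserting the first bound into the second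
  gives the constant 6 (3 + 150) = 918.\<close>

lemma dirichlet_estimate:
  assumes f: "prim f1 f" and f1: "prim (\<lambda>x. Q x * f x - h x) f1" and h: "h \<in> L2 w"
    and R: "0 \<le> R" "f R = 0" "f (- R) = 0"
  shows "(LINT x:{-R..R}|lborel. ((cmod (f x))\<^sup>2 + (cmod (f1 x))\<^sup>2) * w x) \<le> (L2_norm w h)\<^sup>2"
    and "(LINT x:{-R..R}|lborel. (q x)\<^sup>2 * (cmod (f x))\<^sup>2 * w x) \<le> 918 * (L2_norm w h)\<^sup>2"
proof -
  let ?S = "{-R..R}"
  let ?H = "(L2_norm w h)\<^sup>2"
  note hi = L2_set_integral[OF weight_w h, of ?S, simplified]
  have ef: "set_integrable lborel ?S (\<lambda>x. ((cmod (f x))\<^sup>2 + (cmod (f1 x))\<^sup>2) * w x)"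
    by (intro set_integrable_continuous continuous_intros continuous_w prim_continuous[OF f] prim_continuous[OF f1])
  have qf: "set_integrable lborel ?S (\<lambda>x. (q x)\<^sup>2 * (cmod (f x))\<^sup>2 * w x)"
    by (intro set_integrable_continuous continuous_intros continuous_w continuous_q prim_continuous[OF f])
  let ?g = "\<lambda>x. ((Q x * f x - h x) * cnj (f x) + cnj (f1 x) * f1 x) * complex_of_real (w x)
      + complex_of_real (wd x) * (f1 x * cnj (f x))"
  have p: "prim ?g (\<lambda>x. (f1 x * cnj (f x)) * complex_of_real (w x))"
    by (rule prim_energy[OF f f1 prim_w])
  have g0: "(LINT x:?S|lborel. ?g x) = 0"
    using prim_integral[OF p, of "-R" R] R by simp
  then have z: "(LINT x:?S|lborel. Re (?g x)) = 0"
    by (simp only: set_integral_Re(2)[OF prim_set_integrable[OF p]] g0 zero_complex.sel)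
  have "(LINT x:?S|lborel. 1/2 * (((cmod (f x))\<^sup>2 + (cmod (f1 x))\<^sup>2) * w x - (cmod (h x))\<^sup>2 * w x))
      \<le> (LINT x:?S|lborel. Re (?g x))"
  proof (rule set_integral_mono)
    show "set_integrable lborel ?S (\<lambda>x. 1/2 * (((cmod (f x))\<^sup>2 + (cmod (f1 x))\<^sup>2) * w x - (cmod (h x))\<^sup>2 * w x))"
      by (intro set_integrable_mult_right set_integral_diff ef hi)
    show "set_integrable lborel ?S (\<lambda>x. Re (?g x))"
      by (rule set_integral_Re(1)[OF prim_set_integrable[OF p]])
    show "1/2 * (((cmod (f x))\<^sup>2 + (cmod (f1 x))\<^sup>2) * w x - (cmod (h x))\<^sup>2 * w x) \<le> Re (?g x)" for x
      using energy_pointwise[OF abs_wd_le[of x], of "f x" "f1 x" "h x" "q x"]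
      unfolding Q_def by (simp add: algebra_simps)
  qed
  then show 1: "(LINT x:?S|lborel. ((cmod (f x))\<^sup>2 + (cmod (f1 x))\<^sup>2) * w x) \<le> ?H"
    unfolding z using ef hi by simp
  let ?k = "\<lambda>x. ((Q x * f x - h x) * cnj (f x) + cnj (f1 x) * f1 x) * complex_of_real (q x * w x)
      + complex_of_real (qd x * w x + wd x * q x) * (f1 x * cnj (f x))"
  have p2: "prim ?k (\<lambda>x. (f1 x * cnj (f x)) * complex_of_real (q x * w x))"
    by (rule prim_energy[OF f f1 prim_qw])
  have k0: "(LINT x:?S|lborel. ?k x) = 0"
    using prim_integral[OF p2, of "-R" R] R by simp
  then have z2: "(LINT x:?S|lborel. - Im (?k x)) = 0"
    by (simp only: set_integral_uminus[OF set_integral_Im(1)[OF prim_set_integrable[OF p2]]]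
      set_integral_Im(2)[OF prim_set_integrable[OF p2]] k0 zero_complex.sel neg_equal_0_iff_equal)
  have "(LINT x:?S|lborel. 1/6 * ((q x)\<^sup>2 * (cmod (f x))\<^sup>2 * w x) - 3 * ((cmod (h x))\<^sup>2 * w x)
        - 150 * (((cmod (f x))\<^sup>2 + (cmod (f1 x))\<^sup>2) * w x))
      \<le> (LINT x:?S|lborel. - Im (?k x))"
  proof (rule set_integral_mono)
    show "set_integrable lborel ?S (\<lambda>x. 1/6 * ((q x)\<^sup>2 * (cmod (f x))\<^sup>2 * w x) - 3 * ((cmod (h x))\<^sup>2 * w x)
        - 150 * (((cmod (f x))\<^sup>2 + (cmod (f1 x))\<^sup>2) * w x))"
      by (intro set_integrable_mult_right set_integral_diff ef qf hi)
    show "set_integrable lborel ?S (\<lambda>x. - Im (?k x))"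
      using set_integrable_mult_right[of "-1", OF set_integral_Im(1)[OF prim_set_integrable[OF p2], of "-R" R]]
      by (simp only: mult_minus1)
    show "1/6 * ((q x)\<^sup>2 * (cmod (f x))\<^sup>2 * w x) - 3 * ((cmod (h x))\<^sup>2 * w x)
        - 150 * (((cmod (f x))\<^sup>2 + (cmod (f1 x))\<^sup>2) * w x) \<le> - Im (?k x)" for x
    proof -
      have "1/6 * ((q x)\<^sup>2 * (cmod (f x))\<^sup>2 * w x) - 3 * ((cmod (h x))\<^sup>2 * w x)
        - 150 * (((cmod (f x))\<^sup>2 + (cmod (f1 x))\<^sup>2) * w x)
        = w x * ((q x)\<^sup>2 * (cmod (f x))\<^sup>2 / 6 - 3 * (cmod (h x))\<^sup>2 - 150 * ((cmod (f x))\<^sup>2 + (cmod (f1 x))\<^sup>2))"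
        by (simp add: algebra_simps)
      also have "\<dots> \<le> - Im (?k x)"
        unfolding Q_def by (rule separation_pointwise[OF qw_deriv_bound less_imp_le[OF w_pos]])
      finally show ?thesis .
    qed
  qed
  then have "1/6 * (LINT x:?S|lborel. (q x)\<^sup>2 * (cmod (f x))\<^sup>2 * w x) - 3 * (LINT x:?S|lborel. (cmod (h x))\<^sup>2 * w x)
      - 150 * (LINT x:?S|lborel. ((cmod (f x))\<^sup>2 + (cmod (f1 x))\<^sup>2) * w x) \<le> 0"
    unfolding z2 using ef qf hi(1) by (simp add: set_integral_diff del: mult_eq_0_iff)
  then show "(LINT x:?S|lborel. (q x)\<^sup>2 * (cmod (f x))\<^sup>2 * w x) \<le> 918 * ?H"
    using 1 hi(2) by linarith
qed

section \<open>Control of the Cauchy data at 0\<close>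

lemma origin_bound:
  assumes "prim g G"
  shows "cmod (G 0) \<le> (LINT x:{0..1}|lborel. cmod (G x) + cmod (g x))"
proof -
  \<comment> \<open>The factor 1 - x is 1 at 0 and 0 at 1, so integrating the derivative of G (1 -
    x) over [0, 1] isolates the value at 0.\<close>
  have l: "prim (\<lambda>_. - 1) (\<lambda>x. complex_of_real (1 - x))"
  proof -
    have "prim (\<lambda>x. complex_of_real (- 1)) (\<lambda>x. complex_of_real (1 - x))"
      by (rule prim_of_real[OF DERIV_cong[OF DERIV_diff[OF DERIV_const DERIV_ident]]]) auto
    then show ?thesis by simp
  qed
  let ?k = "\<lambda>x. g x * complex_of_real (1 - x) + (- 1) * G x"
  have p: "prim ?k (\<lambda>x. G x * complex_of_real (1 - x))"
    by (rule prim_mult[OF assms l])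
  have gi: "set_integrable lborel {0..1} (\<lambda>x. cmod (G x) + cmod (g x))"
    using prim_set_integrable[OF assms]
      loc_integrable_set_integrable[OF loc_integrable_continuous[OF prim_continuous[OF assms]]]
    by (intro set_integral_add set_integrable_norm)
  have "cmod (G 0) = cmod (LINT x:{0..1}|lborel. ?k x)"
    using prim_integral[OF p, of 0 1] by simp
  also have "\<dots> \<le> (LINT x:{0..1}|lborel. cmod (?k x))"
    by (rule set_integral_norm_bound[OF prim_set_integrable[OF p]])
  also have "\<dots> \<le> (LINT x:{0..1}|lborel. cmod (G x) + cmod (g x))"
  proof (rule set_integral_mono[OF set_integrable_norm[OF prim_set_integrable[OF p]] gi])
    fix x :: real assume x: "x \<in> {0..1}"
    have "cmod (?k x) \<le> cmod (g x * complex_of_real (1 - x)) + cmod (G x)"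
      using norm_triangle_ineq[of "g x * complex_of_real (1 - x)" "(- 1) * G x"] by simp
    also have "cmod (g x * complex_of_real (1 - x)) \<le> cmod (g x) * 1"
      unfolding norm_mult norm_of_real using x by (intro mult_left_mono) auto
    finally show "cmod (?k x) \<le> cmod (G x) + cmod (g x)" by simp
  qed
  finally show ?thesis .
qed

lemma le_one_plus_square: "t \<le> 1 + t\<^sup>2" for t :: real
proof -
  have "2 * t \<le> 1 + t\<^sup>2" using two_mult_le_squares[of 1 t] by simp
  moreover have "0 \<le> t\<^sup>2" by simp
  ultimately show ?thesis by linarith
qed

text \<open>\<open>origin_bound\<close> is applied to f and to f', with f'' expressed through the
  equation, so only integrals over [0, 1] enter. There the weight is at least 1 / (cosh 1)^2, and t
  \<le> 1 + t^2 turns first powers into squares. The 8 collects the ones from 4 |f|, 2 |f'|, |q f|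
  and |h|.\<close>

lemma origin_bounds:
  assumes f: "prim f1 f" and f1: "prim (\<lambda>x. Q x * f x - h x) f1" and h: "h \<in> L2 w" and R: "1 \<le> R"
    and K1: "(LINT x:{-R..R}|lborel. ((cmod (f x))\<^sup>2 + (cmod (f1 x))\<^sup>2) * w x) \<le> K1"
    and K2: "(LINT x:{-R..R}|lborel. (q x)\<^sup>2 * (cmod (f x))\<^sup>2 * w x) \<le> K2"
  shows "cmod (f 0) + cmod (f1 0) \<le> 8 + (cosh 1)\<^sup>2 * (4 * K1 + K2 + (L2_norm w h)\<^sup>2)"
proof -
  let ?C = "(cosh (1::real))\<^sup>2"
  let ?f2 = "\<lambda>x. Q x * f x - h x"
  let ?e = "\<lambda>x. ((cmod (f x))\<^sup>2 + (cmod (f1 x))\<^sup>2) * w x"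
  let ?s = "\<lambda>x. (q x)\<^sup>2 * (cmod (f x))\<^sup>2 * w x"
  let ?h = "\<lambda>x. (cmod (h x))\<^sup>2 * w x"
  have ei: "set_integrable lborel {a..b} ?e" for a b
    by (intro set_integrable_continuous continuous_intros continuous_w prim_continuous[OF f] prim_continuous[OF f1])
  have si: "set_integrable lborel {a..b} ?s" for a b
    by (intro set_integrable_continuous continuous_intros continuous_w continuous_q prim_continuous[OF f])
  note hi = L2_set_integral[OF weight_w h, of "{0..1}", simplified]
  have ci: "set_integrable lborel {a..b} (\<lambda>_. c)" for a b c :: real
    by (intro set_integrable_continuous continuous_on_const)
  have ni: "set_integrable lborel {0..1} (\<lambda>x. cmod (f x))" "set_integrable lborel {0..1} (\<lambda>x. cmod (f1 x))"
    "set_integrable lborel {0..1} (\<lambda>x. cmod (?f2 x))"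
    using prim_set_integrable[OF f1, of 0 1] prim_set_integrable[OF f, of 0 1]
      loc_integrable_set_integrable[OF loc_integrable_continuous[OF prim_continuous[OF f]], of 0 1]
    by (auto intro!: set_integrable_norm)
  have sub: "(LINT x:{0..1}|lborel. k x) \<le> (LINT x:{-R..R}|lborel. k x)"
    if "\<And>a b. set_integrable lborel {a..b} k" "\<And>x. 0 \<le> k x" for k :: "real \<Rightarrow> real"
    unfolding set_lebesgue_integral_def
    by (rule integral_mono) (use that R in \<open>auto simp: set_integrable_def indicator_def\<close>)
  have w0: "0 \<le> w x" for x using w_pos[of x] by simp
  have "cmod (f 0) + cmod (f1 0) \<le> (LINT x:{0..1}|lborel. cmod (f x) + cmod (f1 x))
      + (LINT x:{0..1}|lborel. cmod (f1 x) + cmod (?f2 x))"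
    by (intro add_mono origin_bound f f1)
  also have "\<dots> = (LINT x:{0..1}|lborel. (cmod (f x) + cmod (f1 x)) + (cmod (f1 x) + cmod (?f2 x)))"
    by (intro set_integral_add(2)[symmetric] set_integral_add(1) ni)
  also have "\<dots> \<le> (LINT x:{0..1}|lborel. 8 + ?C * (4 * ?e x + ?s x + ?h x))"
  proof (rule set_integral_mono)
    show "set_integrable lborel {0..1} (\<lambda>x. (cmod (f x) + cmod (f1 x)) + (cmod (f1 x) + cmod (?f2 x)))"
      by (intro set_integral_add(1) ni)
    show "set_integrable lborel {0..1} (\<lambda>x. 8 + ?C * (4 * ?e x + ?s x + ?h x))"
      by (intro set_integral_add(1) set_integrable_mult_right ei si hi ci)
    fix x :: real assume x: "x \<in> {0..1}"
    let ?a = "cmod (f x)" and ?b = "cmod (f1 x)" and ?c = "cmod (h x)"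
    have "cmod (Q x) \<le> 3 + \<bar>q x\<bar>"
    proof -
      have "cmod (Q x) \<le> cmod 3 + cmod (\<i> * complex_of_real (q x) / 3)"
        unfolding Q_def by (rule norm_triangle_ineq4)
      then show ?thesis by (simp add: norm_mult norm_divide)
    qed
    then have "cmod (?f2 x) \<le> (3 + \<bar>q x\<bar>) * ?a + ?c"
      using norm_triangle_ineq4[of "Q x * f x" "h x"] mult_right_mono[of "cmod (Q x)" "3 + \<bar>q x\<bar>" ?a]
      by (simp add: norm_mult)
    then have "(?a + ?b) + (?b + cmod (?f2 x)) \<le> 4 * ?a + 2 * ?b + \<bar>q x\<bar> * ?a + ?c"
      by (simp add: algebra_simps)
    also have "\<dots> \<le> 4 * (1 + ?a\<^sup>2) + 2 * (1 + ?b\<^sup>2) + (1 + (\<bar>q x\<bar> * ?a)\<^sup>2) + (1 + ?c\<^sup>2)"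
      by (intro add_mono mult_left_mono le_one_plus_square) auto
    also have "\<dots> \<le> 8 + (4 * (?a\<^sup>2 + ?b\<^sup>2) + (q x)\<^sup>2 * ?a\<^sup>2 + ?c\<^sup>2)"
      by (simp add: power_mult_distrib)
    also have "\<dots> \<le> 8 + (?C * w x) * (4 * (?a\<^sup>2 + ?b\<^sup>2) + (q x)\<^sup>2 * ?a\<^sup>2 + ?c\<^sup>2)"
    proof -
      have "cosh x \<le> cosh 1" using x by (simp add: cosh_real_nonneg_le_iff)
      then have "(cosh x)\<^sup>2 \<le> ?C" by (rule power_mono) simp
      then have "1 \<le> ?C * w x"
        using mult_left_mono[of "(cosh x)\<^sup>2" ?C "w x"] w0[of x] by (simp add: w_cosh mult.commute)
      from mult_right_mono[OF this, of "4 * (?a\<^sup>2 + ?b\<^sup>2) + (q x)\<^sup>2 * ?a\<^sup>2 + ?c\<^sup>2"] show ?thesis by simp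
    qed
    also have "\<dots> = 8 + ?C * (4 * ?e x + ?s x + ?h x)" by (simp add: algebra_simps)
    finally show "(?a + ?b) + (?b + cmod (?f2 x)) \<le> 8 + ?C * (4 * ?e x + ?s x + ?h x)" .
  qed
  also have "\<dots> = 8 + ?C * (4 * (LINT x:{0..1}|lborel. ?e x) + (LINT x:{0..1}|lborel. ?s x) + (LINT x:{0..1}|lborel. ?h x))"
  proof -
    have "(LINT x:{0..1::real}|lborel. (8::real)) = 8"
      by (simp add: set_lebesgue_integral_def)
    moreover have "set_integrable lborel {0..1} (\<lambda>x. 4 * ?e x + ?s x)" "set_integrable lborel {0..1} (\<lambda>x. 4 * ?e x)"
      "set_integrable lborel {0..1} (\<lambda>x. ?C * (4 * ?e x + ?s x + ?h x))"
      by (intro set_integral_add(1) set_integrable_mult_right ei si hi)+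
    ultimately show ?thesis
      using ei[of 0 1] si[of 0 1] hi(1) ci[of 0 1 8] by (simp only: set_integral_add(2) set_integral_mult_right)
  qed
  also have "\<dots> \<le> 8 + ?C * (4 * K1 + K2 + (L2_norm w h)\<^sup>2)"
  proof -
    have "(LINT x:{0..1}|lborel. ?e x) \<le> K1"
      by (rule order_trans[OF sub K1]) (use ei w0 in auto)
    moreover have "(LINT x:{0..1}|lborel. ?s x) \<le> K2"
      by (rule order_trans[OF sub K2]) (use si w0 in auto)
    ultimately show ?thesis
      using hi(2) by (intro add_left_mono mult_left_mono) auto
  qed
  finally show ?thesis .
qed

section \<open>Solutions on the whole line\<close>

text \<open>The estimate with zero source gives a continuous nonnegative integrand with integral 0.
  Only its value at 0 is recorded, because the Cauchy data there are the coefficients with respect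
  to the fundamental system used for shooting.\<close>

lemma homogeneous_dirichlet_trivial:
  assumes f: "prim f1 f" and f1: "prim (\<lambda>x. Q x * f x) f1" and R: "0 < R" "f R = 0" "f (- R) = 0"
  shows "f 0 = 0" "f1 0 = 0"
proof -
  let ?k = "\<lambda>x. ((cmod (f x))\<^sup>2 + (cmod (f1 x))\<^sup>2) * w x"
  have cont: "continuous_on UNIV ?k"
    by (intro continuous_intros continuous_w prim_continuous[OF f] prim_continuous[OF f1])
  have nn: "0 \<le> ?k x" for x using w_pos[of x] by simp
  have "(LINT x:{-R..R}|lborel. ?k x) \<le> (L2_norm w (\<lambda>_. 0))\<^sup>2"
    by (rule dirichlet_estimate(1)[OF f _ L2_zero]) (use f1 R in auto)
  then have "(LINT x:{-R..R}|lborel. ?k x) \<le> 0"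
    by (simp only: L2_norm_zero zero_power2)
  moreover have "(LINT x:{-R..R}|lborel. ?k x) = integral {-R..R} ?k"
    by (rule set_borel_integral_eq_integral(2)[OF set_integrable_continuous[OF cont]])
  moreover have "0 \<le> integral {-R..R} ?k"
    by (rule Henstock_Kurzweil_Integration.integral_nonneg)
      (use nn in \<open>auto intro: integrable_continuous_interval continuous_on_subset[OF cont]\<close>)
  ultimately have "integral {-R..R} ?k = 0" by linarith
  moreover have "integral {-R..R} ?k = 0 \<longleftrightarrow> (\<forall>x\<in>{-R..R}. ?k x = 0)"
    by (rule integral_eq_0_iff) (use nn R(1) in \<open>auto intro: continuous_on_subset[OF cont]\<close>)
  ultimately have "?k 0 = 0" using R(1) by simp
  then have "(cmod (f 0))\<^sup>2 + (cmod (f1 0))\<^sup>2 = 0" using w_pos[of 0] by simp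
  then show "f 0 = 0" "f1 0 = 0" by (simp_all add: sum_power2_eq_zero_iff)
qed

text \<open>Cramer's rule with injectivity in place of a determinant condition. If the determinant
  were 0, the vectors (v', -u') and (v, -u) would lie in the kernel, so all four coefficients would
  vanish; but then (1, 0) would lie in the kernel as well.\<close>

lemma linear_system_solvable:
  fixes u v u' v' :: complex
  assumes "\<And>a b. a * u + b * v = 0 \<Longrightarrow> a * u' + b * v' = 0 \<Longrightarrow> a = 0 \<and> b = 0"
  shows "\<exists>a b. a * u + b * v = p \<and> a * u' + b * v' = r"
proof -
  define d where "d = u * v' - v * u'"
  have "d \<noteq> 0"
  proof
    assume d: "d = 0"
    have "v' = 0 \<and> - u' = 0"
      by (rule assms) (use d in \<open>simp_all add: d_def algebra_simps\<close>)
    moreover have "v = 0 \<and> - u = 0"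
      by (rule assms) (use d in \<open>simp_all add: d_def algebra_simps\<close>)
    ultimately show False using assms[of 1 0] by simp
  qed
  show ?thesis
  proof (intro exI conjI)
    have "(p * v' - v * r) * u + (u * r - p * u') * v = p * d"
      "(p * v' - v * r) * u' + (u * r - p * u') * v' = r * d"
      by (simp_all add: d_def algebra_simps)
    then show "((p * v' - v * r) / d) * u + ((u * r - p * u') / d) * v = p"
      "((p * v' - v * r) / d) * u' + ((u * r - p * u') / d) * v' = r"
      using \<open>d \<noteq> 0\<close> by (simp_all add: divide_simps)
  qed
qed

definition total_energy :: "cfun \<Rightarrow> cfun \<Rightarrow> real \<Rightarrow> real" where
  "total_energy f f1 x = ((cmod (f x))\<^sup>2 + (cmod (f1 x))\<^sup>2) * w x + (q x)\<^sup>2 * (cmod (f x))\<^sup>2 * w x"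

lemma total_energy_nonneg: "0 \<le> total_energy f f1 x"
  using w_pos[of x] by (simp add: total_energy_def)

lemma continuous_total_energy:
  assumes "continuous_on UNIV f" "continuous_on UNIV f1"
  shows "continuous_on UNIV (total_energy f f1)"
  unfolding total_energy_def[abs_def] by (intro continuous_intros continuous_w continuous_q assms)

lemma weighted_solution_exists:
  assumes h: "h \<in> L2 w"
  shows "\<exists>f f1. prim f1 f \<and> prim (\<lambda>x. Q x * f x - h x) f1 \<and> integrable lborel (total_energy f f1) \<and>
    (\<integral>x. total_energy f f1 x \<partial>lborel) \<le> 919 * (L2_norm w h)\<^sup>2"
proof -
  let ?H = "(L2_norm w h)\<^sup>2"
  obtain p p1 where p: "prim p1 p" "prim (\<lambda>x. Q x * p x - h x) p1" "p 0 = 0" "p1 0 = 0"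
    using linear_ode_exists[OF continuous_Q L2_loc_integrable[OF weight_w continuous_w h]] by blast
  have "\<exists>f f1. prim f1 f \<and> prim (\<lambda>x. Q x * f x) f1 \<and> f 0 = a \<and> f1 0 = b" for a b
    using linear_ode_exists[OF continuous_Q loc_integrable_continuous[OF continuous_on_const[of _ 0]]] by simp
  then obtain u u1 v v1 where u: "prim u1 u" "prim (\<lambda>x. Q x * u x) u1" "u 0 = 1" "u1 0 = 0"
    and v: "prim v1 v" "prim (\<lambda>x. Q x * v x) v1" "v 0 = 0" "v1 0 = 1"
    by blast
  \<comment> \<open>The solutions of the inhomogeneous equation, indexed by their Cauchy data (a, b)
    at 0: convergence of the data is pointwise convergence of the solutions and their
    derivatives.\<close>
  define F where "F a b x = p x + (a * u x + b * v x)" for a b x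
  define F1 where "F1 a b x = p1 x + (a * u1 x + b * v1 x)" for a b x
  have F0: "F a b 0 = a" "F1 a b 0 = b" for a b
    using p u v by (simp_all add: F_def F1_def)
  have hom: "prim (\<lambda>x. a * u1 x + b * v1 x) (\<lambda>x. a * u x + b * v x)"
    "prim (\<lambda>x. Q x * (a * u x + b * v x)) (\<lambda>x. a * u1 x + b * v1 x)" for a b
  proof -
    show "prim (\<lambda>x. a * u1 x + b * v1 x) (\<lambda>x. a * u x + b * v x)"
      by (intro prim_add prim_cmult u v)
    have "prim (\<lambda>x. a * (Q x * u x) + b * (Q x * v x)) (\<lambda>x. a * u1 x + b * v1 x)"
      by (intro prim_add prim_cmult u v)
    then show "prim (\<lambda>x. Q x * (a * u x + b * v x)) (\<lambda>x. a * u1 x + b * v1 x)"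
      by (simp only: distrib_left mult.left_commute[of "Q _"])
  qed
  have F: "prim (F1 a b) (F a b)" for a b
    unfolding F_def[abs_def] F1_def[abs_def] by (intro prim_add p hom)
  have F1: "prim (\<lambda>x. Q x * F a b x - h x) (F1 a b)" for a b
  proof -
    have "prim (\<lambda>x. (Q x * p x - h x) + Q x * (a * u x + b * v x)) (F1 a b)"
      unfolding F1_def[abs_def] by (intro prim_add p hom)
    moreover have "(Q x * p x - h x) + Q x * (a * u x + b * v x) = Q x * F a b x - h x" for x
      by (simp add: F_def algebra_simps)
    ultimately show ?thesis by simp
  qed
  \<comment> \<open>The Dirichlet conditions are a linear system for (a, b), and a kernel element
    yields a homogeneous Dirichlet solution, whose Cauchy data vanish. The radii start at 1 because
    \<open>origin_bounds\<close> integrates over [0, 1].\<close>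
  have "\<exists>a b. F a b (real (Suc n)) = 0 \<and> F a b (- real (Suc n)) = 0" for n
  proof -
    let ?R = "real (Suc n)"
    have "\<exists>a b. a * u ?R + b * v ?R = - p ?R \<and> a * u (- ?R) + b * v (- ?R) = - p (- ?R)"
    proof (rule linear_system_solvable)
      fix a b
      assume "a * u ?R + b * v ?R = 0" "a * u (- ?R) + b * v (- ?R) = 0"
      then have "a * u 0 + b * v 0 = 0" "a * u1 0 + b * v1 0 = 0"
        using homogeneous_dirichlet_trivial[OF hom, of ?R a b] by simp_all
      then show "a = 0 \<and> b = 0" using u v by simp
    qed
    then show ?thesis unfolding F_def by (metis add.right_inverse)
  qed
  then obtain a b where ab: "\<And>n. F (a n) (b n) (real (Suc n)) = 0" "\<And>n. F (a n) (b n) (- real (Suc n)) = 0"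
    by metis
  let ?f = "\<lambda>n. F (a n) (b n)" and ?f1 = "\<lambda>n. F1 (a n) (b n)"
  have est: "(LINT x:{-real (Suc n)..real (Suc n)}|lborel. ((cmod (?f n x))\<^sup>2 + (cmod (?f1 n x))\<^sup>2) * w x) \<le> ?H"
    "(LINT x:{-real (Suc n)..real (Suc n)}|lborel. (q x)\<^sup>2 * (cmod (?f n x))\<^sup>2 * w x) \<le> 918 * ?H" for n
    using dirichlet_estimate[OF F F1 h, of "real (Suc n)"] ab by auto
  define B where "B = 8 + (cosh (1::real))\<^sup>2 * (4 * ?H + 918 * ?H + ?H)"
  have "cmod (?f n 0) + cmod (?f1 n 0) \<le> B" for n
    unfolding B_def by (rule origin_bounds[OF F F1 h _ est]) simp
  then have "norm (a n, b n) \<le> B" for n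
    using norm_Pair_le[of "a n" "b n"] unfolding F0 by (rule order_trans[rotated])
  then have "bounded (range (\<lambda>n. (a n, b n)))"
    by (auto simp: bounded_iff)
  then obtain l r where r: "strict_mono r" "((\<lambda>n. (a n, b n)) \<circ> r) \<longlonglongrightarrow> l"
    using bounded_imp_convergent_subsequence by blast
  obtain \<alpha> \<beta> where l: "l = (\<alpha>, \<beta>)" by (cases l)
  have ar: "(\<lambda>n. a (r n)) \<longlonglongrightarrow> \<alpha>" and br: "(\<lambda>n. b (r n)) \<longlonglongrightarrow> \<beta>"
    using tendsto_fst[OF r(2)] tendsto_snd[OF r(2)] by (simp_all add: l o_def)
  let ?ind = "\<lambda>n. indicator {-real (Suc (r n))..real (Suc (r n))} :: real \<Rightarrow> real"
  let ?E = "\<lambda>n. total_energy (?f (r n)) (?f1 (r n))"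
  let ?e = "total_energy (F \<alpha> \<beta>) (F1 \<alpha> \<beta>)"
  have contE: "continuous_on UNIV (total_energy (F a b) (F1 a b))" for a b
    by (intro continuous_total_energy prim_continuous[OF F] prim_continuous[OF F1])
  note [measurable] = borel_measurable_continuous_onI[OF contE]
  have nn: "(\<integral>\<^sup>+x. ennreal (?ind n x * ?E n x) \<partial>lborel) \<le> ennreal (919 * ?H)" for n
  proof -
    let ?S = "{-real (Suc (r n))..real (Suc (r n))}"
    have i1: "set_integrable lborel ?S (\<lambda>x. ((cmod (?f (r n) x))\<^sup>2 + (cmod (?f1 (r n) x))\<^sup>2) * w x)"
      by (intro set_integrable_continuous continuous_intros continuous_w prim_continuous[OF F] prim_continuous[OF F1])
    have i2: "set_integrable lborel ?S (\<lambda>x. (q x)\<^sup>2 * (cmod (?f (r n) x))\<^sup>2 * w x)"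
      by (intro set_integrable_continuous continuous_intros continuous_w continuous_q prim_continuous[OF F])
    have "integrable lborel (\<lambda>x. ?ind n x * ?E n x)"
      using set_integrable_continuous[OF contE] unfolding set_integrable_def by simp
    then have "(\<integral>\<^sup>+x. ennreal (?ind n x * ?E n x) \<partial>lborel) = ennreal (\<integral>x. ?ind n x * ?E n x \<partial>lborel)"
      by (rule nn_integral_eq_integral) (auto simp: total_energy_nonneg)
    also have "(\<integral>x. ?ind n x * ?E n x \<partial>lborel) = (LINT x:?S|lborel. ?E n x)"
      by (simp add: set_lebesgue_integral_def)
    also have "\<dots> = (LINT x:?S|lborel. ((cmod (?f (r n) x))\<^sup>2 + (cmod (?f1 (r n) x))\<^sup>2) * w x)
        + (LINT x:?S|lborel. (q x)\<^sup>2 * (cmod (?f (r n) x))\<^sup>2 * w x)"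
      unfolding total_energy_def by (rule set_integral_add(2)[OF i1 i2])
    also have "\<dots> \<le> 919 * ?H"
      using est[of "r n"] by linarith
    finally show ?thesis by (simp add: ennreal_leI)
  qed
  have lim: "(\<lambda>n. ?ind n x * ?E n x) \<longlonglongrightarrow> ?e x" for x
  proof -
    obtain N :: nat where N: "\<bar>x\<bar> \<le> real N" using real_arch_simple by blast
    have "(\<lambda>n. ?E n x) \<longlonglongrightarrow> ?e x"
      unfolding total_energy_def F_def F1_def by (intro tendsto_intros ar br)
    moreover have "(\<lambda>n. ?ind n x) \<longlonglongrightarrow> 1"
    proof (rule tendsto_eventually, rule eventually_sequentiallyI[of N])
      fix n assume "N \<le> n"
      then have "real N \<le> real (Suc (r n))" using seq_suble[OF r(1), of n] by simp
      then show "?ind n x = 1" using N by (simp add: abs_le_iff del: of_nat_Suc)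
    qed
    ultimately have "(\<lambda>n. ?ind n x * ?E n x) \<longlonglongrightarrow> 1 * ?e x" by (rule tendsto_mult[rotated])
    then show ?thesis by simp
  qed
  \<comment> \<open>The truncated energies converge pointwise without a common majorant, so Fatou's
    lemma is used; it delivers integrability of the limit and the bound at once.\<close>
  have "(\<integral>\<^sup>+x. ennreal (?e x) \<partial>lborel) = (\<integral>\<^sup>+x. liminf (\<lambda>n. ennreal (?ind n x * ?E n x)) \<partial>lborel)"
    by (intro nn_integral_cong lim_imp_Liminf[symmetric] tendsto_ennrealI lim) simp
  also have "\<dots> \<le> liminf (\<lambda>n. \<integral>\<^sup>+x. ennreal (?ind n x * ?E n x) \<partial>lborel)"
    by (rule nn_integral_liminf) measurable
  also have "\<dots> \<le> ennreal (919 * ?H)"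
    by (rule Liminf_le) (use nn in auto)
  finally have fin: "(\<integral>\<^sup>+x. ennreal (?e x) \<partial>lborel) \<le> ennreal (919 * ?H)" .
  have int: "integrable lborel ?e"
    by (rule integrableI_nonneg) (use fin in \<open>auto simp: total_energy_nonneg intro: le_less_trans\<close>)
  have "ennreal (\<integral>x. ?e x \<partial>lborel) \<le> ennreal (919 * ?H)"
    using fin nn_integral_eq_integral[OF int] by (simp add: total_energy_nonneg)
  then have "(\<integral>x. ?e x \<partial>lborel) \<le> 919 * ?H"
    by (simp add: ennreal_le_iff)
  with F F1 int show ?thesis by blast
qed

section \<open>Cut-offs and density of test functions\<close>

lemma vderiv_mult:
  assumes "smooth f" "smooth g"
  shows "vderiv (\<lambda>x. f x * g x) = (\<lambda>x. f x * vderiv g x + vderiv f x * g x)"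
  by (rule vderiv_eqI[OF has_vector_derivative_mult[OF assms[THEN smooth_has_vderiv]]])

lemma vderiv_add:
  assumes "smooth f" "smooth g"
  shows "vderiv (\<lambda>x. f x + g x) = (\<lambda>x. vderiv f x + vderiv g x)"
  by (rule vderiv_eqI[OF has_vector_derivative_add[OF assms[THEN smooth_has_vderiv]]])

lemma vderiv_affine:
  assumes "smooth f"
  shows "vderiv (\<lambda>x. f (c * x + d)) = (\<lambda>x. complex_of_real c * vderiv f (c * x + d))"
proof (rule vderiv_eqI)
  fix x
  have "((\<lambda>x. c * x + d) has_vector_derivative c) (at x)"
    by (auto intro!: derivative_eq_intros)
  from vector_diff_chain_at[OF this smooth_has_vderiv[OF assms]]
  show "((\<lambda>x. f (c * x + d)) has_vector_derivative complex_of_real c * vderiv f (c * x + d)) (at x)"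
    by (simp add: o_def scaleR_conv_of_real)
qed

section \<open>Plateau functions with uniformly bounded derivatives\<close>

definition bounded_derivs :: "real \<Rightarrow> cfun \<Rightarrow> bool" where
  "bounded_derivs K f \<longleftrightarrow> smooth f \<and>
    (\<forall>x. cmod (f x) \<le> K \<and> cmod (vderiv f x) \<le> K \<and> cmod (vderiv (vderiv f) x) \<le> K)"

lemma bounded_derivs_affine:
  assumes "bounded_derivs K f" "\<bar>c\<bar> = 1"
  shows "bounded_derivs K (\<lambda>x. f (c * x + d))"
proof -
  have s: "smooth f" using assms(1) by (simp add: bounded_derivs_def)
  have "vderiv (vderiv (\<lambda>x. f (c * x + d))) = (\<lambda>x. complex_of_real c * (complex_of_real c * vderiv (vderiv f) (c * x + d)))"
    unfolding vderiv_affine[OF s]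
    using vderiv_mult[OF smooth_const[of "complex_of_real c"] smooth_affine[OF smooth_vderiv[OF s]], of c d]
    by (simp add: vderiv_affine[OF smooth_vderiv[OF s]] vderiv_locally_const[of UNIV _ "\<lambda>_. complex_of_real c"])
  then show ?thesis
    using assms by (simp add: bounded_derivs_def vderiv_affine smooth_affine norm_mult)
qed

text \<open>The second derivative of a product has four terms, counted with multiplicity, each of
  modulus at most K^2.\<close>

lemma bounded_derivs_mult:
  assumes f: "bounded_derivs K f" and g: "bounded_derivs K g"
  shows "bounded_derivs (4 * (K * K)) (\<lambda>x. f x * g x)"
proof -
  have s: "smooth f" "smooth g" using f g by (auto simp: bounded_derivs_def)
  have d2: "vderiv (vderiv (\<lambda>x. f x * g x)) = (\<lambda>x. (f x * vderiv (vderiv g) x + vderiv f x * vderiv g x)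
      + (vderiv f x * vderiv g x + vderiv (vderiv f) x * g x))"
    unfolding vderiv_mult[OF s] using s
    by (simp add: vderiv_add vderiv_mult smooth_mult smooth_vderiv)
  have "0 \<le> K" using f norm_ge_zero[of "f 0"] unfolding bounded_derivs_def by (meson order_trans)
  have b: "cmod (u * v) \<le> K * K" if "cmod u \<le> K" "cmod v \<le> K" for u v
    unfolding norm_mult using that \<open>0 \<le> K\<close> by (intro mult_mono) auto
  note fb = f[unfolded bounded_derivs_def, THEN conjunct2, rule_format]
  note gb = g[unfolded bounded_derivs_def, THEN conjunct2, rule_format]
  have KK: "0 \<le> K * K" using \<open>0 \<le> K\<close> by simp
  show ?thesis
    unfolding bounded_derivs_def
  proof (intro conjI allI)
    show "smooth (\<lambda>x. f x * g x)" by (rule smooth_mult[OF s])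
    fix x
    show "cmod (f x * g x) \<le> 4 * (K * K)"
      using b[of "f x" "g x"] fb[of x] gb[of x] KK by linarith
    show "cmod (vderiv (\<lambda>x. f x * g x) x) \<le> 4 * (K * K)"
      unfolding vderiv_mult[OF s]
      using b[of "f x" "vderiv g x"] b[of "vderiv f x" "g x"] fb[of x] gb[of x] KK
        norm_triangle_ineq[of "f x * vderiv g x" "vderiv f x * g x"] by linarith
    show "cmod (vderiv (vderiv (\<lambda>x. f x * g x)) x) \<le> 4 * (K * K)"
      unfolding d2
      using b[of "f x" "vderiv (vderiv g) x"] b[of "vderiv f x" "vderiv g x"] b[of "vderiv (vderiv f) x" "g x"]
        fb[of x] gb[of x]
        norm_triangle_ineq[of "f x * vderiv (vderiv g) x" "vderiv f x * vderiv g x"]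
        norm_triangle_ineq[of "vderiv f x * vderiv g x" "vderiv (vderiv f) x * g x"]
        norm_triangle_ineq[of "f x * vderiv (vderiv g) x + vderiv f x * vderiv g x" "vderiv f x * vderiv g x + vderiv (vderiv f) x * g x"]
      by linarith
  qed
qed

text \<open>Outside [0, 1] the step is locally constant, so bounds are required only on a compact
  interval.\<close>

lemma smooth_step_bounded:
  assumes "smooth s" "\<forall>x\<le>0. s x = 0" "\<forall>x\<ge>1. s x = 1"
  shows "\<exists>K. bounded_derivs K s"
proof -
  have ext: "\<exists>K. \<forall>x. cmod (g x) \<le> K"
    if g: "smooth g" and out: "\<And>x. x < 0 \<or> 1 < x \<Longrightarrow> cmod (g x) \<le> 1" for g
  proof -
    obtain K where K: "\<forall>x\<in>{0..1}. cmod (g x) \<le> K"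
      using continuous_locally_bounded[OF smooth_continuous[OF g]] by blast
    have "cmod (g x) \<le> max K 1" for x
    proof (cases "x \<in> {0..1}")
      case True
      then show ?thesis using K by (auto simp: le_max_iff_disj)
    next
      case False
      then show ?thesis using out[of x] by (auto simp: le_max_iff_disj)
    qed
    then show ?thesis by blast
  qed
  have d1: "vderiv s x = 0" if "x < 0 \<or> 1 < x" for x
    using that
  proof
    assume "x < 0"
    then show ?thesis by (intro vderiv_locally_const[of "{..<0}" x s 0]) (use assms in auto)
  next
    assume "1 < x"
    then show ?thesis by (intro vderiv_locally_const[of "{1<..}" x s 1]) (use assms in auto)
  qed
  have d2: "vderiv (vderiv s) x = 0" if "x < 0 \<or> 1 < x" for x
    using that
  proof
    assume "x < 0"
    then show ?thesis by (intro vderiv_locally_const[of "{..<0}" x _ 0]) (use d1 in auto)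
  next
    assume "1 < x"
    then show ?thesis by (intro vderiv_locally_const[of "{1<..}" x _ 0]) (use d1 in auto)
  qed
  have s0: "cmod (s x) \<le> 1" if "x < 0 \<or> 1 < x" for x
    using that assms by auto
  obtain K0 where "\<forall>x. cmod (s x) \<le> K0" using ext[OF assms(1) s0] by blast
  moreover obtain K1 where "\<forall>x. cmod (vderiv s x) \<le> K1"
    using ext[OF smooth_vderiv[OF assms(1)]] d1 by force
  moreover obtain K2 where "\<forall>x. cmod (vderiv (vderiv s) x) \<le> K2"
    using ext[OF smooth_vderiv[OF smooth_vderiv[OF assms(1)]]] d2 by force
  ultimately have "bounded_derivs (max K0 (max K1 K2)) s"
    using assms(1) by (auto simp: bounded_derivs_def le_max_iff_disj)
  then show ?thesis by blast
qed

text \<open>A product of a translated step and a reflected one. Translating instead of rescaling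
  keeps every transition zone of width 1, so that one bound on the function and its first two
  derivatives holds for all N.\<close>

lemma plateau_exists:
  "\<exists>ch :: nat \<Rightarrow> cfun. \<exists>K. \<forall>N. bounded_derivs K (ch N) \<and> (\<forall>x. \<bar>x\<bar> \<le> real N \<longrightarrow> ch N x = 1)
    \<and> (\<forall>x. real N + 1 \<le> \<bar>x\<bar> \<longrightarrow> ch N x = 0)"
proof -
  obtain s where s: "smooth s" "\<forall>x\<le>0. s x = 0" "\<forall>x\<ge>1. s x = 1"
    using smooth_step by blast
  obtain K where K: "bounded_derivs K s" using smooth_step_bounded[OF s] by blast
  define ch where "ch N x = s (1 * x + (real N + 1)) * s ((- 1) * x + (real N + 1))" for N x
  have "bounded_derivs (4 * (K * K)) (ch N)" for N
    unfolding ch_def[abs_def] by (intro bounded_derivs_mult bounded_derivs_affine K) auto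
  moreover have "ch N x = 1" if "\<bar>x\<bar> \<le> real N" for N x
  proof -
    have "1 \<le> 1 * x + (real N + 1)" "1 \<le> (- 1) * x + (real N + 1)" using that by auto
    then show ?thesis using s(3) unfolding ch_def by simp
  qed
  moreover have "ch N x = 0" if "real N + 1 \<le> \<bar>x\<bar>" for N x
  proof -
    have "1 * x + (real N + 1) \<le> 0 \<or> (- 1) * x + (real N + 1) \<le> 0" using that by auto
    then show ?thesis using s(2) unfolding ch_def by auto
  qed
  ultimately show ?thesis
    by (intro exI[of _ ch] exI[of _ "4 * (K * K)"]) blast
qed

definition plateau :: "nat \<Rightarrow> cfun" where
  "plateau = (SOME ch. \<exists>K. \<forall>N. bounded_derivs K (ch N) \<and> (\<forall>x. \<bar>x\<bar> \<le> real N \<longrightarrow> ch N x = 1)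
    \<and> (\<forall>x. real N + 1 \<le> \<bar>x\<bar> \<longrightarrow> ch N x = 0))"

definition plateau_bound :: real where
  "plateau_bound = (SOME K. \<forall>N. bounded_derivs K (plateau N) \<and> (\<forall>x. \<bar>x\<bar> \<le> real N \<longrightarrow> plateau N x = 1)
    \<and> (\<forall>x. real N + 1 \<le> \<bar>x\<bar> \<longrightarrow> plateau N x = 0))"

lemma plateau_spec:
  "\<forall>N. bounded_derivs plateau_bound (plateau N) \<and> (\<forall>x. \<bar>x\<bar> \<le> real N \<longrightarrow> plateau N x = 1)
    \<and> (\<forall>x. real N + 1 \<le> \<bar>x\<bar> \<longrightarrow> plateau N x = 0)"
proof -
  have "\<exists>K. \<forall>N. bounded_derivs K (plateau N) \<and> (\<forall>x. \<bar>x\<bar> \<le> real N \<longrightarrow> plateau N x = 1)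
    \<and> (\<forall>x. real N + 1 \<le> \<bar>x\<bar> \<longrightarrow> plateau N x = 0)"
    unfolding plateau_def by (rule someI_ex[OF plateau_exists])
  then show ?thesis
    unfolding plateau_bound_def by (rule someI_ex)
qed

lemma plateau_smooth: "smooth (plateau N)"
  using plateau_spec by (simp add: bounded_derivs_def)

lemma plateau_bounds:
  "cmod (plateau N x) \<le> plateau_bound" "cmod (vderiv (plateau N) x) \<le> plateau_bound"
  "cmod (vderiv (vderiv (plateau N)) x) \<le> plateau_bound"
  using plateau_spec by (auto simp: bounded_derivs_def)

lemma plateau_one: "\<bar>x\<bar> \<le> real N \<Longrightarrow> plateau N x = 1"
  using plateau_spec by blast

lemma plateau_zero: "real N + 1 \<le> \<bar>x\<bar> \<Longrightarrow> plateau N x = 0"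
  using plateau_spec by blast

lemma plateau_bound_ge_1: "1 \<le> plateau_bound"
  using plateau_bounds(1)[of 0 0] plateau_one[of 0 0] by simp

lemma vderiv_plateau_zero:
  assumes "\<bar>x\<bar> < real N"
  shows "vderiv (plateau N) x = 0" "vderiv (vderiv (plateau N)) x = 0"
proof -
  have d: "vderiv (plateau N) y = 0" if "\<bar>y\<bar> < real N" for y
    by (rule vderiv_locally_const[of "{- real N<..<real N}" y _ 1])
      (use that in \<open>auto intro: plateau_one\<close>)
  show "vderiv (plateau N) x = 0" using d assms by blast
  show "vderiv (vderiv (plateau N)) x = 0"
    by (rule vderiv_locally_const[of "{- real N<..<real N}" x _ 0])
      (use assms in \<open>auto intro!: d\<close>)
qed

lemma plateau_test_fun: "plateau N \<in> test_funs"
  by (rule test_funI[OF plateau_smooth, of "- (real N + 1)" "real N + 1"]) (auto intro!: plateau_zero)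

lemma eventually_plateau:
  "\<forall>\<^sub>F N in sequentially. plateau N x = 1 \<and> vderiv (plateau N) x = 0 \<and> vderiv (vderiv (plateau N)) x = 0"
proof -
  obtain M :: nat where M: "\<bar>x\<bar> < real M" using reals_Archimedean2 by blast
  show ?thesis
  proof (rule eventually_sequentiallyI[of M])
    fix N assume "M \<le> N"
    then have "\<bar>x\<bar> < real N" using M by simp
    then show "plateau N x = 1 \<and> vderiv (plateau N) x = 0 \<and> vderiv (vderiv (plateau N)) x = 0"
      using plateau_one[of x N] vderiv_plateau_zero[of x N] by simp
  qed
qed

text \<open>tanh is a primitive of \<open>w\<close>, so integrals over intervals are at most 2.
  Finiteness of the weighted measure puts the constants into the weighted space and thereby admits
  majorants of the form |u| + 1.\<close>

lemma w_integrable: "integrable lborel w"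
proof (rule integrableI_nonneg)
  note [measurable] = weight_measurable[OF weight_w]
  show "w \<in> borel_measurable lborel" by measurable
  show "AE x in lborel. 0 \<le> w x" using w_pos by (simp add: less_imp_le)
  let ?ind = "\<lambda>n::nat. indicator {-real n..real n} :: real \<Rightarrow> real"
  have p: "prim (\<lambda>x. complex_of_real (w x)) (\<lambda>x. complex_of_real (tanh x))"
  proof (rule prim_of_real[OF _ continuous_w])
    fix x :: real
    have "(cosh x)\<^sup>2 - (sinh x)\<^sup>2 = 1" by (simp add: cosh_square_real)
    then have "1 - (tanh x)\<^sup>2 = w x"
      by (simp add: w_eq tanh_def power_divide divide_simps)
    then show "(tanh has_real_derivative w x) (at x)"
      by (auto intro!: derivative_eq_intros)
  qed
  have b: "(\<integral>\<^sup>+x. ennreal (?ind n x * w x) \<partial>lborel) \<le> 2" for n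
  proof -
    have si: "set_integrable lborel {-real n..real n} w"
      by (rule set_integrable_continuous[OF continuous_w])
    have "complex_of_real (LINT x:{-real n..real n}|lborel. w x) = complex_of_real (tanh (real n) - tanh (- real n))"
      using prim_integral[OF p, of "- real n" "real n"] by (simp only: set_integral_complex_of_real) simp
    then have "(LINT x:{-real n..real n}|lborel. w x) = tanh (real n) - tanh (- real n)"
      by (simp only: of_real_eq_iff)
    also have "\<dots> \<le> 2"
      using tanh_real_lt_1[of "real n"] tanh_real_gt_neg1[of "- real n"] by linarith
    finally have "(\<integral>x. ?ind n x * w x \<partial>lborel) \<le> 2" by (simp add: set_lebesgue_integral_def)
    moreover have "(\<integral>\<^sup>+x. ennreal (?ind n x * w x) \<partial>lborel) = ennreal (\<integral>x. ?ind n x * w x \<partial>lborel)"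
      by (rule nn_integral_eq_integral) (use si w_pos in \<open>auto simp: set_integrable_def less_imp_le\<close>)
    ultimately show ?thesis
      by (simp add: ennreal_leI flip: ennreal_numeral)
  qed
  have "(\<integral>\<^sup>+x. ennreal (w x) \<partial>lborel) = (\<integral>\<^sup>+x. liminf (\<lambda>n. ennreal (?ind n x * w x)) \<partial>lborel)"
  proof (intro nn_integral_cong lim_imp_Liminf[symmetric] tendsto_ennrealI)
    fix x :: real
    obtain N :: nat where N: "\<bar>x\<bar> \<le> real N" using real_arch_simple by blast
    show "(\<lambda>n. ?ind n x * w x) \<longlonglongrightarrow> w x"
      by (rule tendsto_eventually, rule eventually_sequentiallyI[of N]) (use N in \<open>auto simp: indicator_def\<close>)
  qed simp
  also have "\<dots> \<le> liminf (\<lambda>n. \<integral>\<^sup>+x. ennreal (?ind n x * w x) \<partial>lborel)"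
    by (rule nn_integral_liminf) measurable
  also have "\<dots> \<le> 2"
    by (rule Liminf_le) (use b in auto)
  finally show "(\<integral>\<^sup>+x. ennreal (w x) \<partial>lborel) < \<infinity>"
    by (rule le_less_trans) simp
qed

lemma const_L2w: "(\<lambda>_. c) \<in> L2 w"
  using w_integrable by (simp add: L2_def)

lemma prim_zero_bound:
  assumes "prim g G" "G a = 0" "a \<le> x" "x \<le> b" "\<And>t. t \<in> {a..b} \<Longrightarrow> cmod (g t) \<le> e"
  shows "cmod (G x) \<le> e * (b - a)"
proof -
  have e: "0 \<le> e" by (rule order_trans[OF norm_ge_zero assms(5)[of a]]) (use assms(3,4) in simp)
  have "cmod (G x) = cmod (LINT t:{a..x}|lborel. g t)"
    using prim_integral[OF assms(1,3)] assms(2) by simp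
  also have "\<dots> \<le> (LINT t:{a..x}|lborel. cmod (g t))"
    by (rule set_integral_norm_bound[OF prim_set_integrable[OF assms(1)]])
  also have "\<dots> \<le> (LINT t:{a..x}|lborel. e)"
    by (rule set_integral_mono[OF set_integrable_norm[OF prim_set_integrable[OF assms(1)]]
      set_integrable_continuous[OF continuous_on_const]]) (use assms in auto)
  also have "\<dots> = e * (x - a)"
    using assms(3) by (simp add: set_lebesgue_integral_def)
  also have "\<dots> \<le> e * (b - a)"
    using assms(4) e by (intro mult_left_mono) auto
  finally show ?thesis .
qed

text \<open>Approximate the derivative by a polynomial, integrate, and cut off.\<close>

lemma test_fun_approx_compact:
  assumes G: "prim G1 G" "continuous_on UNIV G1"
    and supp: "\<And>x. real N \<le> \<bar>x\<bar> \<Longrightarrow> G x = 0" "\<And>x. real N \<le> \<bar>x\<bar> \<Longrightarrow> G1 x = 0" and "0 < e"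
  shows "\<exists>\<phi>\<in>test_funs. \<forall>x. (cmod (G x - \<phi> x) \<le> e \<and> cmod (G1 x - vderiv \<phi> x) \<le> e) \<and>
    (real N + 1 \<le> \<bar>x\<bar> \<longrightarrow> G x - \<phi> x = 0)"
proof -
  define R where "R = real N + 1"
  let ?K = plateau_bound
  have K: "1 \<le> ?K" by (rule plateau_bound_ge_1)
  \<comment> \<open>An error eta in the derivative grows to at most 2 R eta after integration over
    [-R, R]. With this choice the two terms of the product rule for the cut-off, K 2 R eta and K
    eta, add up to \<open>e\<close>.\<close>
  define \<eta> where "\<eta> = e / (?K * (2 * R + 1))"
  have R: "1 \<le> R" by (simp add: R_def)
  have pos: "0 < ?K * (2 * R + 1)" using K R by (intro mult_pos_pos) auto
  then have \<eta>: "0 < \<eta>" using \<open>0 < e\<close> by (simp add: \<eta>_def)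
  have \<eta>e: "?K * (\<eta> * (2 * R)) + ?K * \<eta> = e"
  proof -
    have "?K * (\<eta> * (2 * R)) + ?K * \<eta> = (?K * (2 * R + 1)) * \<eta>" by (simp add: algebra_simps)
    also have "\<dots> = e"
      unfolding \<eta>_def times_divide_eq_right
      by (rule nonzero_mult_div_cancel_left[OF less_imp_neq[OF pos, symmetric]])
    finally show ?thesis .
  qed
  obtain p where p: "smooth p" "\<forall>x\<in>{-R..R}. cmod (G1 x - p x) < \<eta>"
    using smooth_approx[OF continuous_on_subset[OF G(2)] \<eta>, of "-R" R] by auto
  obtain P0 where P0: "prim p P0"
    using prim_exists[OF loc_integrable_continuous[OF smooth_continuous[OF p(1)]]] by blast
  define P where "P x = P0 x - P0 (- R)" for x
  have P: "prim p P" using prim_diff[OF P0 prim_const[of "P0 (- R)"]] by (simp add: P_def[abs_def])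
  have sP: "smooth P" by (rule smooth_of_deriv[OF prim_deriv[OF P smooth_continuous[OF p(1)]] p(1)])
  have vP: "vderiv P = p" by (rule vderiv_eqI[OF prim_deriv[OF P smooth_continuous[OF p(1)]]])
  have GP: "cmod (G x - P x) \<le> \<eta> * (2 * R)" if x: "x \<in> {-R..R}" for x
  proof -
    have "cmod (G x - P x) \<le> \<eta> * (R - (- R))"
      by (rule prim_zero_bound[OF prim_diff[OF G(1) P]]) (use supp(1)[of "- R"] x p(2) in \<open>auto simp: R_def P_def less_imp_le\<close>)
    then show ?thesis by simp
  qed
  define \<phi> where "\<phi> x = plateau N x * P x" for x
  have \<phi>: "\<phi> \<in> test_funs"
    unfolding \<phi>_def[abs_def] by (rule test_fun_mult[OF plateau_test_fun sP])
  have v\<phi>: "vderiv \<phi> x = plateau N x * p x + vderiv (plateau N) x * P x" for x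
    unfolding \<phi>_def[abs_def] vderiv_mult[OF plateau_smooth sP] vP ..
  have out: "plateau N x = 0" "vderiv (plateau N) x = 0" if "x \<notin> {-R..R}" for x
  proof -
    show "plateau N x = 0" using that by (intro plateau_zero) (auto simp: R_def)
    show "vderiv (plateau N) x = 0"
      by (rule vderiv_locally_const[of "- {-R..R}" x _ 0])
        (use that in \<open>auto simp: R_def intro!: plateau_zero\<close>)
  qed
  \<comment> \<open>The plateau equals 1 wherever \<open>G\<close> is nonzero, so cutting off leaves
    \<open>G\<close> unchanged and both errors factor through G - P and G1 - p.\<close>
  have e1: "G x - \<phi> x = plateau N x * (G x - P x)" for x
    using plateau_one[of x N] supp(1)[of x] by (cases "\<bar>x\<bar> \<le> real N") (auto simp: \<phi>_def algebra_simps)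
  have e2: "G1 x - vderiv \<phi> x = plateau N x * (G1 x - p x) + vderiv (plateau N) x * (G x - P x)" for x
  proof (cases "\<bar>x\<bar> < real N")
    case True
    then show ?thesis
      using plateau_one[of x N] vderiv_plateau_zero(1)[OF True] by (simp add: v\<phi>)
  next
    case False
    then show ?thesis using supp[of x] by (simp add: v\<phi>)
  qed
  have b: "cmod (G x - \<phi> x) \<le> e \<and> cmod (G1 x - vderiv \<phi> x) \<le> e" for x
  proof (cases "x \<in> {-R..R}")
    case True
    have 1: "cmod (plateau N x * (G x - P x)) \<le> ?K * (\<eta> * (2 * R))"
      "cmod (vderiv (plateau N) x * (G x - P x)) \<le> ?K * (\<eta> * (2 * R))"
      "cmod (plateau N x * (G1 x - p x)) \<le> ?K * \<eta>"
      unfolding norm_mult using K bspec[OF p(2) True]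
      by (intro mult_mono plateau_bounds GP[OF True]; simp)+
    moreover have "0 \<le> ?K * \<eta>" using K \<eta> by simp
    ultimately show ?thesis
      unfolding e1 e2 using norm_triangle_ineq[of "plateau N x * (G1 x - p x)" "vderiv (plateau N) x * (G x - P x)"] \<eta>e
      by linarith
  next
    case False
    then show ?thesis unfolding e1 e2 using out[OF False] \<open>0 < e\<close> by simp
  qed
  moreover have "G x - \<phi> x = 0" if "real N + 1 \<le> \<bar>x\<bar>" for x
    using supp(1)[of x] plateau_zero[OF that] that by (simp add: \<phi>_def)
  ultimately show ?thesis using \<phi> by blast
qed

lemma L2w_null_sequence:
  assumes "\<And>n. f n \<in> borel_measurable borel" "k \<in> L2 w"
    and "\<And>x. (\<lambda>n. f n x) \<longlonglongrightarrow> 0" "\<And>n x. cmod (f n x) \<le> c * cmod (k x)"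
  shows "(\<lambda>n. L2_norm w (f n)) \<longlonglongrightarrow> 0"
  by (rule L2_norm_dominated_convergence[OF weight_w assms(1,2)]) (use assms(3,4) in auto)

text \<open>Each cut-off of F is approximated in the C1 sense within 1 / (N + 1), also after
  multiplication by \<open>m\<close>. The total error then tends to 0 at every point and has a fixed
  majorant: the uniform plateau bounds control the cut-off error, and the constant 1 controls the
  approximation error.\<close>

lemma form_norm_test_fun_approx:
  fixes m :: "real \<Rightarrow> real"
  assumes F: "prim F1 F" "continuous_on UNIV F1" and L: "F \<in> L2 w" "F1 \<in> L2 w"
    and m: "continuous_on UNIV m" "(\<lambda>x. complex_of_real (m x) * F x) \<in> L2 w" and "0 < e"
  shows "\<exists>\<phi>\<in>test_funs. (L2_norm w (\<lambda>x. F1 x - vderiv \<phi> x))\<^sup>2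
    + (L2_norm w (\<lambda>x. complex_of_real (m x) * (F x - \<phi> x)))\<^sup>2 + (L2_norm w (\<lambda>x. F x - \<phi> x))\<^sup>2 < e"
proof -
  let ?K = plateau_bound
  have K: "1 \<le> ?K" by (rule plateau_bound_ge_1)
  have "\<exists>\<phi>\<in>test_funs. \<forall>x. cmod (plateau N x * F x - \<phi> x) \<le> 1 / Suc N \<and>
      cmod ((F1 x * plateau N x + vderiv (plateau N) x * F x) - vderiv \<phi> x) \<le> 1 / Suc N \<and>
      cmod (complex_of_real (m x) * (plateau N x * F x - \<phi> x)) \<le> 1 / Suc N" for N
  proof -
    let ?G = "\<lambda>x. F x * plateau N x" and ?G1 = "\<lambda>x. F1 x * plateau N x + vderiv (plateau N) x * F x"
    have pG: "prim ?G1 ?G" by (rule prim_mult[OF F(1) smooth_prim[OF plateau_smooth]])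
    have cG: "continuous_on UNIV ?G1"
      by (intro continuous_intros F(2) prim_continuous[OF F(1)] smooth_continuous smooth_vderiv plateau_smooth)
    have z: "?G x = 0" "?G1 x = 0" if "real (N + 2) \<le> \<bar>x\<bar>" for x
    proof -
      have "plateau N x = 0" using that by (intro plateau_zero) simp
      moreover have "vderiv (plateau N) x = 0"
        by (rule vderiv_locally_const[of "- {-(real N + 1)..real N + 1}" x _ 0])
          (use that in \<open>auto intro!: plateau_zero\<close>)
      ultimately show "?G x = 0" "?G1 x = 0" by simp_all
    qed
    have "continuous_on UNIV (\<lambda>x. complex_of_real (m x))" by (intro continuous_intros m)
    from continuous_locally_bounded[OF this, of "- (real N + 3)" "real N + 3"]
    obtain M where M: "\<forall>x\<in>{- (real N + 3)..real N + 3}. cmod (complex_of_real (m x)) \<le> M" by blast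
    \<comment> \<open>Dividing by 1 + |M| protects the term multiplied by \<open>m\<close>. The
      radius N + 3 arises as follows: the cut-off and its derivative vanish from N + 2 on, and
      \<open>test_fun_approx_compact\<close> enlarges the support by 1.\<close>
    define \<delta> where "\<delta> = 1 / (real (Suc N) * (1 + \<bar>M\<bar>))"
    have M1: "0 < real (Suc N) * (1 + \<bar>M\<bar>)" by (intro mult_pos_pos) auto
    then have \<delta>: "0 < \<delta>" by (simp only: \<delta>_def zero_less_divide_1_iff)
    have \<delta>1: "(1 + \<bar>M\<bar>) * \<delta> = 1 / Suc N" by (simp add: \<delta>_def divide_simps)
    have \<delta>2: "\<delta> \<le> 1 / Suc N" unfolding \<delta>1[symmetric] using \<delta> by simp
    obtain \<phi> where \<phi>: "\<phi> \<in> test_funs" "\<forall>x. (cmod (?G x - \<phi> x) \<le> \<delta> \<and> cmod (?G1 x - vderiv \<phi> x) \<le> \<delta>) \<and>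
        (real (N + 2) + 1 \<le> \<bar>x\<bar> \<longrightarrow> ?G x - \<phi> x = 0)"
      using test_fun_approx_compact[OF pG cG z \<delta>] by blast
    show ?thesis
    proof (intro bexI[OF _ \<phi>(1)] allI conjI)
      fix x
      note \<phi>x = spec[OF \<phi>(2), of x]
      have c: "plateau N x * F x = F x * plateau N x" by (rule mult.commute)
      show "cmod (plateau N x * F x - \<phi> x) \<le> 1 / Suc N" unfolding c using \<phi>x \<delta>2 by linarith
      show "cmod (?G1 x - vderiv \<phi> x) \<le> 1 / Suc N" using \<phi>x \<delta>2 by linarith
      show "cmod (complex_of_real (m x) * (plateau N x * F x - \<phi> x)) \<le> 1 / Suc N"
      proof (cases "\<bar>x\<bar> \<le> real N + 3")
        case True
        then have "x \<in> {- (real N + 3)..real N + 3}" by (simp add: abs_le_iff)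
        with M have "cmod (complex_of_real (m x)) \<le> 1 + \<bar>M\<bar>" by force
        then have "cmod (complex_of_real (m x) * (plateau N x * F x - \<phi> x)) \<le> (1 + \<bar>M\<bar>) * \<delta>"
          unfolding norm_mult c using \<phi>x by (intro mult_mono) auto
        then show ?thesis by (simp only: \<delta>1)
      next
        case False
        then show ?thesis unfolding c using \<phi>x by simp
      qed
    qed
  qed
  then obtain \<phi> where \<phi>: "\<And>N. \<phi> N \<in> test_funs"
    "\<And>N x. cmod (plateau N x * F x - \<phi> N x) \<le> 1 / Suc N"
    "\<And>N x. cmod ((F1 x * plateau N x + vderiv (plateau N) x * F x) - vderiv (\<phi> N) x) \<le> 1 / Suc N"
    "\<And>N x. cmod (complex_of_real (m x) * (plateau N x * F x - \<phi> N x)) \<le> 1 / Suc N"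
    by metis
  have [measurable]: "\<phi> N \<in> borel_measurable borel" "vderiv (\<phi> N) \<in> borel_measurable borel" for N
    by (intro borel_measurable_continuous_onI smooth_continuous smooth_vderiv test_fun_smooth \<phi>)+
  note [measurable] = prim_measurable[OF F(1)] L2_measurable[OF L(2)] borel_measurable_continuous_onI[OF m(1)]
  have S: "1 / real (Suc N) \<le> 1" for N by simp
  \<comment> \<open>The summand 1 majorises the approximation error 1 / (N + 1); it is admissible
    because \<open>w\<close> is integrable.\<close>
  have k: "(\<lambda>x. complex_of_real (cmod (u x) + 1)) \<in> L2 w" if "u \<in> L2 w" for u
  proof -
    have "(\<lambda>x. complex_of_real (cmod (u x))) \<in> L2 w"
      by (rule L2_bound[OF weight_w _ that, of _ 1]) (use L2_measurable[OF that] in auto)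
    from L2_add[OF weight_w this const_L2w[of 1]] show ?thesis by simp
  qed
  have lim: "(\<lambda>N. g N) \<longlonglongrightarrow> 0" if "\<forall>\<^sub>F N in sequentially. cmod (g N) \<le> 1 / Suc N" for g :: "nat \<Rightarrow> complex"
    by (rule Lim_null_comparison[OF that LIMSEQ_Suc[OF lim_1_over_n]])
  have cut: "cmod (u - plateau N x * u) \<le> (1 + ?K) * cmod u" for N x u
    using norm_triangle_ineq4[of u "plateau N x * u"] mult_right_mono[OF plateau_bounds(1)[of N x] norm_ge_zero[of u]]
    by (simp add: norm_mult distrib_right)
  have bnd: "t \<le> (1 + 2 * ?K) * cmod (complex_of_real (s + 1))" if "t \<le> (1 + 2 * ?K) * s + 1" "0 \<le> s" for t s
  proof -
    have "(1 + 2 * ?K) * s + 1 \<le> (1 + 2 * ?K) * (s + 1)" using K by (simp add: algebra_simps)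
    moreover have "cmod (complex_of_real (s + 1)) = s + 1" using that(2) by (simp only: norm_of_real abs_of_nonneg)
    ultimately show ?thesis using that(1) by (simp only:)
  qed
  have "(\<lambda>N. L2_norm w (\<lambda>x. F x - \<phi> N x)) \<longlonglongrightarrow> 0"
  proof (rule L2w_null_sequence[OF _ k[OF L(1)]])
    show "(\<lambda>N. F x - \<phi> N x) \<longlonglongrightarrow> 0" for x
    proof (rule lim)
      show "\<forall>\<^sub>F N in sequentially. cmod (F x - \<phi> N x) \<le> 1 / Suc N"
        using eventually_plateau[of x]
      proof eventually_elim
        case (elim N)
        then show ?case using \<phi>(2)[of N x] by simp
      qed
    qed
    show "cmod (F x - \<phi> N x) \<le> (1 + 2 * ?K) * cmod (complex_of_real (cmod (F x) + 1))" for N x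
    proof (rule bnd)
      have "cmod (F x - \<phi> N x) \<le> cmod (F x - plateau N x * F x) + cmod (plateau N x * F x - \<phi> N x)"
        using norm_triangle_ineq[of "F x - plateau N x * F x" "plateau N x * F x - \<phi> N x"] by simp
      also have "\<dots> \<le> (1 + ?K) * cmod (F x) + 1"
        by (intro add_mono cut order_trans[OF \<phi>(2) S])
      also have "\<dots> \<le> (1 + 2 * ?K) * cmod (F x) + 1"
        using K by (intro add_right_mono mult_right_mono) auto
      finally show "cmod (F x - \<phi> N x) \<le> (1 + 2 * ?K) * cmod (F x) + 1" .
    qed simp
  qed measurable
  moreover have "(\<lambda>N. L2_norm w (\<lambda>x. complex_of_real (m x) * (F x - \<phi> N x))) \<longlonglongrightarrow> 0"
  proof (rule L2w_null_sequence[OF _ k[OF m(2)]])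
    show "(\<lambda>N. complex_of_real (m x) * (F x - \<phi> N x)) \<longlonglongrightarrow> 0" for x
    proof (rule lim)
      show "\<forall>\<^sub>F N in sequentially. cmod (complex_of_real (m x) * (F x - \<phi> N x)) \<le> 1 / Suc N"
        using eventually_plateau[of x]
      proof eventually_elim
        case (elim N)
        then show ?case using \<phi>(4)[of x N] by simp
      qed
    qed
    show "cmod (complex_of_real (m x) * (F x - \<phi> N x))
        \<le> (1 + 2 * ?K) * cmod (complex_of_real (cmod (complex_of_real (m x) * F x) + 1))" for N x
    proof (rule bnd)
      let ?u = "complex_of_real (m x) * F x"
      have "complex_of_real (m x) * (F x - \<phi> N x) = (?u - plateau N x * ?u) + complex_of_real (m x) * (plateau N x * F x - \<phi> N x)"
        by (simp add: algebra_simps)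
      then have "cmod (complex_of_real (m x) * (F x - \<phi> N x))
          \<le> cmod (?u - plateau N x * ?u) + cmod (complex_of_real (m x) * (plateau N x * F x - \<phi> N x))"
        using norm_triangle_ineq by simp
      also have "\<dots> \<le> (1 + ?K) * cmod ?u + 1"
        by (intro add_mono cut order_trans[OF \<phi>(4) S])
      also have "\<dots> \<le> (1 + 2 * ?K) * cmod ?u + 1"
        using K by (intro add_right_mono mult_right_mono) auto
      finally show "cmod (complex_of_real (m x) * (F x - \<phi> N x)) \<le> (1 + 2 * ?K) * cmod ?u + 1" .
    qed simp
  qed measurable
  moreover have "(\<lambda>N. L2_norm w (\<lambda>x. F1 x - vderiv (\<phi> N) x)) \<longlonglongrightarrow> 0"
  proof (rule L2w_null_sequence)
    have a: "(\<lambda>x. complex_of_real (cmod (F x))) \<in> L2 w"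
      by (rule L2_bound[OF weight_w _ L(1), of _ 1]) auto
    have b: "(\<lambda>x. complex_of_real (cmod (F1 x))) \<in> L2 w"
      by (rule L2_bound[OF weight_w _ L(2), of _ 1]) auto
    have "(\<lambda>x. complex_of_real (cmod (F x)) + complex_of_real (cmod (F1 x))) \<in> L2 w"
      by (rule L2_add[OF weight_w a b])
    from k[OF this] show "(\<lambda>x. complex_of_real (cmod (complex_of_real (cmod (F x)) + complex_of_real (cmod (F1 x))) + 1)) \<in> L2 w" .
    show "(\<lambda>N. F1 x - vderiv (\<phi> N) x) \<longlonglongrightarrow> 0" for x
    proof (rule lim)
      show "\<forall>\<^sub>F N in sequentially. cmod (F1 x - vderiv (\<phi> N) x) \<le> 1 / Suc N"
        using eventually_plateau[of x]
      proof eventually_elim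
        case (elim N)
        then show ?case using \<phi>(3)[of x N] by simp
      qed
    qed
    show "cmod (F1 x - vderiv (\<phi> N) x)
        \<le> (1 + 2 * ?K) * cmod (complex_of_real (cmod (complex_of_real (cmod (F x)) + complex_of_real (cmod (F1 x))) + 1))" for N x
    proof (rule bnd)
      have "cmod (complex_of_real (cmod (F x)) + complex_of_real (cmod (F1 x))) = cmod (F x) + cmod (F1 x)"
        unfolding of_real_add[symmetric] norm_of_real by simp
      note eq = this
      let ?g = "F1 x * plateau N x + vderiv (plateau N) x * F x"
      have "F1 x - vderiv (\<phi> N) x = ((F1 x - plateau N x * F1 x) - vderiv (plateau N) x * F x) + (?g - vderiv (\<phi> N) x)"
        by (simp add: algebra_simps)
      then have "cmod (F1 x - vderiv (\<phi> N) x)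
          \<le> cmod ((F1 x - plateau N x * F1 x) - vderiv (plateau N) x * F x) + cmod (?g - vderiv (\<phi> N) x)"
        by (rule ord_eq_le_trans[OF arg_cong[of _ _ cmod] norm_triangle_ineq])
      also have "\<dots> \<le> (cmod (F1 x - plateau N x * F1 x) + cmod (vderiv (plateau N) x * F x)) + 1"
        by (intro add_mono norm_triangle_ineq4 order_trans[OF \<phi>(3) S])
      also have "\<dots> \<le> ((1 + ?K) * cmod (F1 x) + ?K * cmod (F x)) + 1"
        by (intro add_mono cut order_refl) (simp add: norm_mult mult_right_mono plateau_bounds)
      also have "\<dots> \<le> (1 + 2 * ?K) * (cmod (F x) + cmod (F1 x)) + 1"
      proof -
        have "(1 + ?K) * cmod (F1 x) \<le> (1 + 2 * ?K) * cmod (F1 x)" "?K * cmod (F x) \<le> (1 + 2 * ?K) * cmod (F x)"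
          using K by (intro mult_right_mono; simp)+
        then show ?thesis by (simp add: distrib_left)
      qed
      finally show "cmod (F1 x - vderiv (\<phi> N) x)
          \<le> (1 + 2 * ?K) * cmod (complex_of_real (cmod (F x)) + complex_of_real (cmod (F1 x))) + 1" unfolding eq .
    qed simp
  qed measurable
  ultimately have "(\<lambda>N. (L2_norm w (\<lambda>x. F1 x - vderiv (\<phi> N) x))\<^sup>2
    + (L2_norm w (\<lambda>x. complex_of_real (m x) * (F x - \<phi> N x)))\<^sup>2 + (L2_norm w (\<lambda>x. F x - \<phi> N x))\<^sup>2) \<longlonglongrightarrow> 0\<^sup>2 + 0\<^sup>2 + 0\<^sup>2"
    by (intro tendsto_intros)
  then have "\<forall>\<^sub>F N in sequentially. (L2_norm w (\<lambda>x. F1 x - vderiv (\<phi> N) x))\<^sup>2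
    + (L2_norm w (\<lambda>x. complex_of_real (m x) * (F x - \<phi> N x)))\<^sup>2 + (L2_norm w (\<lambda>x. F x - \<phi> N x))\<^sup>2 < e"
    by (rule order_tendstoD(2)) (use \<open>0 < e\<close> in simp)
  then obtain N where "(L2_norm w (\<lambda>x. F1 x - vderiv (\<phi> N) x))\<^sup>2
    + (L2_norm w (\<lambda>x. complex_of_real (m x) * (F x - \<phi> N x)))\<^sup>2 + (L2_norm w (\<lambda>x. F x - \<phi> N x))\<^sup>2 < e"
    by (auto simp: eventually_sequentially)
  with \<phi>(1) show ?thesis by blast
qed

section \<open>The space \<open>DS\<close>\<close>

lemma total_energy_L2:
  assumes f: "continuous_on UNIV f" "continuous_on UNIV f1" and int: "integrable lborel (total_energy f f1)"
  shows "f \<in> L2 w" "f1 \<in> L2 w" "(\<lambda>x. complex_of_real (q x) * f x) \<in> L2 w"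
    "(L2_norm w f)\<^sup>2 + (L2_norm w (\<lambda>x. complex_of_real (q x) * f x))\<^sup>2 \<le> (\<integral>x. total_energy f f1 x \<partial>lborel)"
proof -
  have nn: "0 \<le> (cmod (f x))\<^sup>2 * w x" "0 \<le> (cmod (f1 x))\<^sup>2 * w x" "0 \<le> (cmod (complex_of_real (q x) * f x))\<^sup>2 * w x" for x
    using w_pos[of x] by (simp_all add: less_imp_le)
  have eq: "total_energy f f1 x = (cmod (f x))\<^sup>2 * w x + (cmod (f1 x))\<^sup>2 * w x + (cmod (complex_of_real (q x) * f x))\<^sup>2 * w x" for x
    by (simp add: total_energy_def norm_mult power_mult_distrib distrib_right)
  note m = borel_measurable_continuous_onI[OF f(1)] borel_measurable_continuous_onI[OF f(2)]
  have mq: "(\<lambda>x. complex_of_real (q x) * f x) \<in> borel_measurable borel"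
    by (intro borel_measurable_continuous_onI continuous_intros continuous_q f)
  have bd: "(cmod (f x))\<^sup>2 * w x \<le> total_energy f f1 x" "(cmod (f1 x))\<^sup>2 * w x \<le> total_energy f f1 x"
    "(cmod (complex_of_real (q x) * f x))\<^sup>2 * w x \<le> total_energy f f1 x" for x
    using nn[of x] unfolding eq by linarith+
  show L: "f \<in> L2 w" "f1 \<in> L2 w" "(\<lambda>x. complex_of_real (q x) * f x) \<in> L2 w"
    by (rule L2_dominated[OF weight_w _ int]; (rule m mq AE_I2)?, (rule bd)?)+
  have "(L2_norm w f)\<^sup>2 + (L2_norm w (\<lambda>x. complex_of_real (q x) * f x))\<^sup>2
    = (\<integral>x. (cmod (f x))\<^sup>2 * w x + (cmod (complex_of_real (q x) * f x))\<^sup>2 * w x \<partial>lborel)"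
    unfolding L2_norm_square[OF weight_w]
    by (rule Bochner_Integration.integral_add[symmetric, OF L2_integrable[OF L(1)] L2_integrable[OF L(3)]])
  also have "\<dots> \<le> (\<integral>x. total_energy f f1 x \<partial>lborel)"
    by (rule integral_mono[OF Bochner_Integration.integrable_add[OF L2_integrable[OF L(1)] L2_integrable[OF L(3)]] int])
      (use nn(2) in \<open>simp add: eq\<close>)
  finally show "(L2_norm w f)\<^sup>2 + (L2_norm w (\<lambda>x. complex_of_real (q x) * f x))\<^sup>2 \<le> (\<integral>x. total_energy f f1 x \<partial>lborel)" .
qed

lemma L2_cmod: "f \<in> L2 \<rho> \<Longrightarrow> (\<lambda>x. complex_of_real (cmod (f x))) \<in> L2 \<rho>"
  by (auto simp: L2_def)

lemma L2_bound_sum: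
  assumes "weight \<rho>" "f \<in> borel_measurable borel" "g \<in> L2 \<rho>" "h \<in> L2 \<rho>" "0 \<le> b" "0 \<le> c"
    and "AE x in lborel. cmod (f x) \<le> b * cmod (g x) + c * cmod (h x)"
  shows "f \<in> L2 \<rho>"
proof (rule L2_bound[OF assms(1,2), of _ 1])
  show "(\<lambda>x. complex_of_real b * complex_of_real (cmod (g x)) + complex_of_real c * complex_of_real (cmod (h x))) \<in> L2 \<rho>"
    by (intro L2_add assms L2_cmult L2_cmod)
  show "AE x in lborel. cmod (f x) \<le> 1 * cmod (complex_of_real b * complex_of_real (cmod (g x)) + complex_of_real c * complex_of_real (cmod (h x)))"
    using assms(7)
  proof eventually_elim
    case (elim x)
    then show ?case
      unfolding of_real_mult[symmetric] of_real_add[symmetric] norm_of_real by simp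
  qed
qed

definition form_multiplier :: "real \<Rightarrow> real \<Rightarrow> real" where
  "form_multiplier lam x = sqrt (cmod (V lam x))"

lemma continuous_form_multiplier: "continuous_on S (form_multiplier lam)"
  unfolding form_multiplier_def[abs_def] V_def[abs_def] by (intro continuous_intros)

text \<open>The inequality sqrt t \<le> 1 + t trades the square root of the potential for q itself,
  so the form condition follows from square integrability of f and q f.\<close>

lemma form_multiplier_bound: "form_multiplier lam x \<le> (1 + \<bar>lam\<bar>) + inverse \<bar>lam\<bar> * \<bar>q x\<bar>"
proof -
  have "sqrt t \<le> 1 + t" if "0 \<le> t" for t :: real
    by (rule real_le_lsqrt) (use that in \<open>auto simp: power2_eq_square algebra_simps\<close>)
  then have "form_multiplier lam x \<le> 1 + cmod (V lam x)"
    by (simp add: form_multiplier_def)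
  also have "cmod (V lam x) \<le> cmod (- complex_of_real lam) + cmod (\<i> / complex_of_real lam * complex_of_real (q x))"
    unfolding V_def q_def by (rule norm_triangle_ineq)
  also have "\<dots> = \<bar>lam\<bar> + inverse \<bar>lam\<bar> * \<bar>q x\<bar>"
    by (simp add: norm_mult norm_divide norm_inverse divide_inverse)
  finally show ?thesis by simp
qed

lemma form_multiplier_L2:
  assumes "F \<in> L2 w" "(\<lambda>x. complex_of_real (q x) * F x) \<in> L2 w"
  shows "(\<lambda>x. complex_of_real (form_multiplier lam x) * F x) \<in> L2 w"
proof (rule L2_bound_sum[OF weight_w _ assms])
  show "(\<lambda>x. complex_of_real (form_multiplier lam x) * F x) \<in> borel_measurable borel"
    using borel_measurable_continuous_onI[OF continuous_form_multiplier] L2_measurable[OF assms(1)] by measurable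
  show "0 \<le> 1 + \<bar>lam\<bar>" "0 \<le> inverse \<bar>lam\<bar>" by simp_all
  show "AE x in lborel. cmod (complex_of_real (form_multiplier lam x) * F x)
    \<le> (1 + \<bar>lam\<bar>) * cmod (F x) + inverse \<bar>lam\<bar> * cmod (complex_of_real (q x) * F x)"
  proof (rule AE_I2)
    fix x
    have "0 \<le> form_multiplier lam x" by (simp add: form_multiplier_def)
    then show "cmod (complex_of_real (form_multiplier lam x) * F x)
      \<le> (1 + \<bar>lam\<bar>) * cmod (F x) + inverse \<bar>lam\<bar> * cmod (complex_of_real (q x) * F x)"
      using mult_right_mono[OF form_multiplier_bound[of lam x] norm_ge_zero[of "F x"]]
      by (simp add: norm_mult distrib_right mult.assoc)
  qed
qed

abbreviation weak2 :: "cfun \<Rightarrow> cfun" where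
  "weak2 f \<equiv> weak_deriv (weak_deriv f)"

lemma weak2_of_prim:
  assumes "f \<in> borel_measurable borel" "AE x in lborel. f x = F x" "prim F1 F" "prim F2 F1"
  shows "AE x in lborel. weak2 f x = F2 x" "weak2 f \<in> borel_measurable borel" "weakly_diff (weak_deriv f)"
  using weak_deriv_of_prim(1,3,4)[OF assms(4) weak_deriv_of_prim(4,3)[OF assms(3,1,2)]] by auto

text \<open>The representative \<open>F\<close> is continuously differentiable, so
  \<open>form_norm_test_fun_approx\<close> supplies the approximants that the closure in
  \<open>Vw0\<close> demands. Together with \<open>DS_D\<close> this allows \<open>DS\<close> to be
  handled through primitives and weighted norms alone.\<close>

lemma DS_I:
  assumes f: "f \<in> borel_measurable borel" "AE x in lborel. f x = F x"
    and F: "prim F1 F" "prim F2 F1"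
    and L: "F \<in> L2 w" "F1 \<in> L2 w" "F2 \<in> L2 w" "(\<lambda>x. complex_of_real (q x) * F x) \<in> L2 w"
  shows "f \<in> DS lam"
proof -
  note d1 = weak_deriv_of_prim[OF F(1) f]
  note d2 = weak2_of_prim[OF f F]
  note [measurable] = f(1) d1(4) d2(2) borel_measurable_continuous_onI[OF continuous_form_multiplier]
    borel_measurable_continuous_onI[OF continuous_q] prim_measurable[OF F(1)] prim_measurable[OF F(2)]
  have mF: "(\<lambda>x. complex_of_real (form_multiplier lam x) * F x) \<in> L2 w"
    by (rule form_multiplier_L2[OF L(1,4)])
  have "f \<in> L2 w" by (rule L2_AE_cong[OF weight_w f(1) L(1) f(2)])
  moreover have "(\<lambda>x. complex_of_real (sqrt (cmod (V lam x)) * cmod (f x) + cmod (weak_deriv f x))) \<in> L2 w"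
    unfolding form_multiplier_def[symmetric]
  proof (rule L2_bound_sum[OF weight_w _ mF L(2), of _ 1 1])
    show "(\<lambda>x. complex_of_real (form_multiplier lam x * cmod (f x) + cmod (weak_deriv f x))) \<in> borel_measurable borel"
      by measurable
    show "AE x in lborel. cmod (complex_of_real (form_multiplier lam x * cmod (f x) + cmod (weak_deriv f x)))
        \<le> 1 * cmod (complex_of_real (form_multiplier lam x) * F x) + 1 * cmod (F1 x)"
      using f(2) d1(3)
    proof eventually_elim
      case (elim x)
      have "0 \<le> form_multiplier lam x" by (simp add: form_multiplier_def)
      then show ?case unfolding elim norm_of_real by (simp add: norm_mult)
    qed
  qed simp_all
  ultimately have Vw: "f \<in> Vw lam"
    using d1(1) by (simp add: Vw_def)
  have "\<exists>\<phi>\<in>test_funs. Vw_norm lam (f - \<phi>) < e" if "0 < e" for e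
  proof -
    obtain \<phi> where \<phi>: "\<phi> \<in> test_funs" "(L2_norm w (\<lambda>x. F1 x - vderiv \<phi> x))\<^sup>2
      + (L2_norm w (\<lambda>x. complex_of_real (form_multiplier lam x) * (F x - \<phi> x)))\<^sup>2 + (L2_norm w (\<lambda>x. F x - \<phi> x))\<^sup>2 < e\<^sup>2"
      using form_norm_test_fun_approx[OF F(1) prim_continuous[OF F(2)] L(1,2) continuous_form_multiplier mF
        zero_less_power[OF \<open>0 < e\<close>]] by blast
    note s = test_fun_smooth[OF \<phi>(1)]
    have [measurable]: "\<phi> \<in> borel_measurable borel" "vderiv \<phi> \<in> borel_measurable borel"
      by (intro borel_measurable_continuous_onI smooth_continuous smooth_vderiv s)+
    have eq: "f - \<phi> = (\<lambda>x. f x - \<phi> x)" by (simp add: fun_eq_iff)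
    have ae: "AE x in lborel. f x - \<phi> x = F x - \<phi> x" using f(2) by eventually_elim simp
    note d = weak_deriv_of_prim[OF prim_diff[OF F(1) smooth_prim[OF s]] _ ae]
    have "L2_norm w (weak_deriv (\<lambda>x. f x - \<phi> x)) = L2_norm w (\<lambda>x. F1 x - vderiv \<phi> x)"
      by (rule L2_norm_AE_cong[OF weight_w d(4) _ d(3)]) measurable
    moreover have "L2_norm w (\<lambda>x. complex_of_real (form_multiplier lam x) * (f x - \<phi> x))
      = L2_norm w (\<lambda>x. complex_of_real (form_multiplier lam x) * (F x - \<phi> x))"
    proof (rule L2_norm_AE_cong[OF weight_w])
      show "AE x in lborel. complex_of_real (form_multiplier lam x) * (f x - \<phi> x) = complex_of_real (form_multiplier lam x) * (F x - \<phi> x)"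
        using ae by eventually_elim simp
    qed measurable
    moreover have "L2_norm w (\<lambda>x. f x - \<phi> x) = L2_norm w (\<lambda>x. F x - \<phi> x)"
      by (rule L2_norm_AE_cong[OF weight_w _ _ ae]) measurable
    ultimately have "Vw_norm lam (f - \<phi>) < e"
      unfolding Vw_norm_def eq form_multiplier_def[symmetric]
      using \<phi>(2) that by (simp only:) (rule real_less_lsqrt; simp)
    then show ?thesis using \<phi>(1) by blast
  qed
  then have Vw0: "f \<in> Vw0 lam" using Vw by (simp add: Vw0_def)
  have "AE x in lborel. - weak2 f x = - F2 x" using d2(1) by eventually_elim simp
  then have "(\<lambda>x. - weak2 f x) \<in> L2 w"
    by (intro L2_AE_cong[OF weight_w _ L2_minus[OF L(3)]]) measurable
  moreover have "(\<lambda>x. complex_of_real (x\<^sup>2 * sinh x) * f x) \<in> L2 w"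
    unfolding q_def[symmetric]
  proof (rule L2_AE_cong[OF weight_w _ L(4)])
    show "AE x in lborel. complex_of_real (q x) * f x = complex_of_real (q x) * F x"
      using f(2) by eventually_elim simp
  qed measurable
  ultimately show ?thesis
    using Vw0 d2(3) by (simp add: DS_def)
qed

lemma DS_D:
  assumes "f \<in> DS lam"
  shows "f \<in> borel_measurable borel" "\<exists>F F1. (AE x in lborel. f x = F x) \<and> prim F1 F \<and> prim (weak2 f) F1 \<and>
    F \<in> L2 w \<and> F1 \<in> L2 w \<and> weak2 f \<in> L2 w \<and> (\<lambda>x. complex_of_real (q x) * F x) \<in> L2 w"
proof -
  have f: "f \<in> L2 w" "weakly_diff f" and v: "(\<lambda>x. complex_of_real (sqrt (cmod (V lam x)) * cmod (f x) + cmod (weak_deriv f x))) \<in> L2 w"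
    using assms by (auto simp: DS_def Vw0_def Vw_def)
  have g: "weakly_diff (weak_deriv f)" "(\<lambda>x. - weak2 f x) \<in> L2 w" "(\<lambda>x. complex_of_real (q x) * f x) \<in> L2 w"
    using assms by (auto simp: DS_def q_def)
  show fm: "f \<in> borel_measurable borel" by (rule L2_measurable[OF f(1)])
  have h1: "has_weak_deriv f (weak_deriv f)"
    using f(2) unfolding weakly_diff_def weak_deriv_def by (rule someI_ex)
  have h2: "has_weak_deriv (weak_deriv f) (weak2 f)"
    using g(1) unfolding weakly_diff_def weak_deriv_def[of "weak_deriv f"] by (rule someI_ex)
  obtain F where F: "prim (weak_deriv f) F" "AE x in lborel. f x = F x"
    using has_weak_deriv_imp_prim[OF h1] by blast
  obtain F1 where F1: "prim (weak2 f) F1" "AE x in lborel. weak_deriv f x = F1 x"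
    using has_weak_deriv_imp_prim[OF h2] by blast
  \<comment> \<open>The two representatives were found independently of each other. As the weak
    derivative agrees almost everywhere with the continuous \<open>F1\<close>, \<open>F\<close> is
    also a primitive of \<open>F1\<close>, which makes it continuously differentiable.\<close>
  have p: "prim F1 F" by (rule prim_AE_cong[OF F(1) prim_measurable[OF F1(1)] F1(2)])
  note [measurable] = prim_measurable[OF F(1)] prim_measurable[OF F1(1)] borel_measurable_continuous_onI[OF continuous_q]
  have "F \<in> L2 w"
    by (rule L2_AE_cong[OF weight_w _ f(1)]) (use F(2) in \<open>auto simp: prim_measurable[OF F(1)] elim!: eventually_mono\<close>)
  moreover have "F1 \<in> L2 w"
  proof (rule L2_bound[OF weight_w prim_measurable[OF F1(1)] v, of 1])
    show "AE x in lborel. cmod (F1 x) \<le> 1 * cmod (complex_of_real (sqrt (cmod (V lam x)) * cmod (f x) + cmod (weak_deriv f x)))"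
      using F1(2)
    proof eventually_elim
      case (elim x)
      have "0 \<le> sqrt (cmod (V lam x)) * cmod (f x)" by simp
      then show ?case unfolding norm_of_real elim by simp
    qed
  qed
  moreover have "weak2 f \<in> L2 w" using L2_minus[OF g(2)] by simp
  moreover have "(\<lambda>x. complex_of_real (q x) * F x) \<in> L2 w"
  proof (rule L2_AE_cong[OF weight_w _ g(3)])
    show "AE x in lborel. complex_of_real (q x) * F x = complex_of_real (q x) * f x"
      using F(2) by eventually_elim simp
  qed measurable
  ultimately show "\<exists>F F1. (AE x in lborel. f x = F x) \<and> prim F1 F \<and> prim (weak2 f) F1 \<and>
    F \<in> L2 w \<and> F1 \<in> L2 w \<and> weak2 f \<in> L2 w \<and> (\<lambda>x. complex_of_real (q x) * F x) \<in> L2 w"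
    using F(2) p F1(1) by blast
qed

lemma DS_AE_cong:
  assumes "f \<in> DS lam" "g \<in> borel_measurable borel" "AE x in lborel. g x = f x"
  shows "g \<in> DS lam" "AE x in lborel. weak2 g x = weak2 f x"
proof -
  obtain F F1 where F: "AE x in lborel. f x = F x" "prim F1 F" "prim (weak2 f) F1" "F \<in> L2 w" "F1 \<in> L2 w"
    "weak2 f \<in> L2 w" "(\<lambda>x. complex_of_real (q x) * F x) \<in> L2 w"
    using DS_D(2)[OF assms(1)] by blast
  have g: "AE x in lborel. g x = F x" using assms(3) F(1) by eventually_elim simp
  show "g \<in> DS lam" by (rule DS_I[OF assms(2) g F(2-7)])
  show "AE x in lborel. weak2 g x = weak2 f x" by (rule weak2_of_prim(1)[OF assms(2) g F(2,3)])
qed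

lemma DS_lincomb:
  assumes f: "f \<in> DS lam" and g: "g \<in> DS lam"
  shows "(\<lambda>x. a * f x + b * g x) \<in> DS lam"
    "AE x in lborel. weak2 (\<lambda>x. a * f x + b * g x) x = a * weak2 f x + b * weak2 g x"
proof -
  obtain F F1 where F: "AE x in lborel. f x = F x" "prim F1 F" "prim (weak2 f) F1" "F \<in> L2 w" "F1 \<in> L2 w"
    "weak2 f \<in> L2 w" "(\<lambda>x. complex_of_real (q x) * F x) \<in> L2 w"
    using DS_D(2)[OF f] by blast
  obtain G G1 where G: "AE x in lborel. g x = G x" "prim G1 G" "prim (weak2 g) G1" "G \<in> L2 w" "G1 \<in> L2 w"
    "weak2 g \<in> L2 w" "(\<lambda>x. complex_of_real (q x) * G x) \<in> L2 w"
    using DS_D(2)[OF g] by blast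
  have m: "(\<lambda>x. a * f x + b * g x) \<in> borel_measurable borel"
    using DS_D(1)[OF f] DS_D(1)[OF g] by measurable
  have ae: "AE x in lborel. a * f x + b * g x = a * F x + b * G x"
    using F(1) G(1) by eventually_elim simp
  have p: "prim (\<lambda>x. a * F1 x + b * G1 x) (\<lambda>x. a * F x + b * G x)"
    "prim (\<lambda>x. a * weak2 f x + b * weak2 g x) (\<lambda>x. a * F1 x + b * G1 x)"
    by (intro prim_add prim_cmult F G)+
  have "(\<lambda>x. a * (complex_of_real (q x) * F x) + b * (complex_of_real (q x) * G x)) \<in> L2 w"
    by (intro L2_add[OF weight_w] L2_cmult F G)
  then have "(\<lambda>x. complex_of_real (q x) * (a * F x + b * G x)) \<in> L2 w"
    by (simp only: distrib_left mult.left_commute[of "complex_of_real (q _)"])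
  then show "(\<lambda>x. a * f x + b * g x) \<in> DS lam"
    by (intro DS_I[OF m ae p]) (intro L2_add[OF weight_w] L2_cmult F G)+
  show "AE x in lborel. weak2 (\<lambda>x. a * f x + b * g x) x = a * weak2 f x + b * weak2 g x"
    by (rule weak2_of_prim(1)[OF m ae p])
qed

text \<open>The energy identity on the whole line. The boundary function d' cnj d w is integrable as
  a product of weighted square integrable functions, and so is its derivative, so
  \<open>prim_integral_zero\<close> removes the boundary terms.\<close>

lemma homogeneous_L2w_trivial:
  assumes d: "prim d1 d" "prim d2 d1" "AE x in lborel. d2 x = Q x * d x"
    and L: "d \<in> L2 w" "d1 \<in> L2 w" "d2 \<in> L2 w"
  shows "AE x in lborel. d x = 0"
proof -
  let ?g = "\<lambda>x. (d2 x * cnj (d x) + cnj (d1 x) * d1 x) * complex_of_real (w x)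
      + complex_of_real (wd x) * (d1 x * cnj (d x))"
  have p: "prim ?g (\<lambda>x. (d1 x * cnj (d x)) * complex_of_real (w x))"
    by (rule prim_energy[OF d(1,2) prim_w])
  have Lc: "(\<lambda>x. cnj (u x)) \<in> L2 w" if "u \<in> L2 w" for u
    by (rule L2_bound[OF weight_w _ that, of _ 1]) (use L2_measurable[OF that] in \<open>auto intro: borel_measurable_continuous_on[OF continuous_on_cnj[OF continuous_on_id]]\<close>)
  have i1: "integrable lborel (\<lambda>x. d2 x * cnj (d x) * complex_of_real (w x))"
    "integrable lborel (\<lambda>x. cnj (d1 x) * d1 x * complex_of_real (w x))"
    and i3: "integrable lborel (\<lambda>x. d1 x * cnj (d x) * complex_of_real (w x))"
    by (intro L2_mult_integrable[OF weight_w] L Lc)+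
  note [measurable] = L2_measurable[OF L(1)] L2_measurable[OF L(2)] L2_measurable[OF Lc[OF L(1)]]
    borel_measurable_continuous_onI[OF continuous_wd] weight_measurable[OF weight_w]
  have i2: "integrable lborel (\<lambda>x. complex_of_real (wd x) * (d1 x * cnj (d x)))"
  proof (rule Bochner_Integration.integrable_bound)
    show "integrable lborel (\<lambda>x. 2 * (d1 x * cnj (d x) * complex_of_real (w x)))" using i3 by simp
    show "AE x in lborel. norm (complex_of_real (wd x) * (d1 x * cnj (d x))) \<le> norm (2 * (d1 x * cnj (d x) * complex_of_real (w x)))"
    proof (rule AE_I2)
      fix x
      show "norm (complex_of_real (wd x) * (d1 x * cnj (d x))) \<le> norm (2 * (d1 x * cnj (d x) * complex_of_real (w x)))"
        using mult_right_mono[OF abs_wd_le[of x], of "cmod (d1 x) * cmod (d x)"] w_pos[of x]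
        by (simp add: norm_mult mult_ac)
    qed
  qed measurable
  have ig: "integrable lborel ?g"
    unfolding distrib_right by (intro Bochner_Integration.integrable_add i1 i2)
  have "(\<integral>x. ?g x \<partial>lborel) = 0"
    by (rule prim_integral_zero[OF p ig i3])
  then have z: "(\<integral>x. Re (?g x) \<partial>lborel) = 0"
    by (simp only: integral_Re[OF ig] zero_complex.sel)
  have "(\<integral>x. 1/2 * ((cmod (d x))\<^sup>2 * w x) \<partial>lborel) \<le> (\<integral>x. Re (?g x) \<partial>lborel)"
  proof (rule integral_mono_AE)
    show "integrable lborel (\<lambda>x. 1/2 * ((cmod (d x))\<^sup>2 * w x))"
      using L2_integrable[OF L(1)] by simp
    show "integrable lborel (\<lambda>x. Re (?g x))" by (rule integrable_Re[OF ig])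
    show "AE x in lborel. 1/2 * ((cmod (d x))\<^sup>2 * w x) \<le> Re (?g x)"
      using d(3)
    proof eventually_elim
      case (elim x)
      have "1/2 * ((cmod (d x))\<^sup>2 * w x) \<le> w x / 2 * ((cmod (d x))\<^sup>2 + (cmod (d1 x))\<^sup>2 - (cmod 0)\<^sup>2)"
        using w_pos[of x] by (simp add: distrib_left)
      also have "\<dots> \<le> Re (?g x)"
        using energy_pointwise[OF abs_wd_le[of x], of "d x" "d1 x" 0 "q x"]
        unfolding elim Q_def by (simp only: diff_0_right)
      finally show ?case .
    qed
  qed
  then have "(L2_norm w d)\<^sup>2 \<le> 0"
    unfolding z L2_norm_square[OF weight_w] by simp
  then have "L2_norm w d = 0" by simp
  then show ?thesis using L2_norm_eq_0_iff[OF weight_w L(1)] by simp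
qed

section \<open>Comparison with the unweighted norm\<close>

lemma one_plus_fourth_power_le: "1 + (x\<^sup>2)\<^sup>2 \<le> 8 * (w x + (q x)\<^sup>2 * w x)"
proof (cases "\<bar>x\<bar> \<le> 1")
  \<comment> \<open>Near 0 the weight alone suffices: cosh x \<le> 2 gives w \<ge> 1/4, while the
    left-hand side is at most 2.\<close>
  case True
  have "x\<^sup>2 \<le> 1" using True by (simp add: abs_square_le_1)
  then have 1: "(x\<^sup>2)\<^sup>2 \<le> 1" by (rule power_le_one[OF zero_le_power2])
  have "cosh 1 = (exp 1 + exp (-1)) / (2::real)" by (simp add: cosh_def)
  also have "\<dots> \<le> (3 + 1) / 2" by (intro divide_right_mono add_mono exp_le) simp_all
  finally have "cosh 1 \<le> (2::real)" by simp
  moreover have "cosh \<bar>x\<bar> \<le> cosh 1" using True by (subst cosh_real_nonneg_le_iff) auto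
  ultimately have "cosh x \<le> 2" by (simp only: cosh_real_abs)
  then have "(cosh x)\<^sup>2 \<le> 2\<^sup>2" by (intro power_mono) auto
  from mult_left_mono[OF this less_imp_le[OF w_pos[of x]]] have "1 \<le> 4 * w x"
    by (simp add: w_cosh)
  moreover have "0 \<le> (q x)\<^sup>2 * w x" using w_pos[of x] by simp
  ultimately show ?thesis using 1 unfolding distrib_left by linarith
next
  \<comment> \<open>Here q^2 w = x^4 tanh(x)^2, and sinh 1 \<ge> 3/4 makes tanh(x)^2 at least 1/4;
    the summand 1 is absorbed by x^4 \<ge> 1.\<close>
  case False
  have "1 \<le> x\<^sup>2" using False abs_square_le_1[of x] by linarith
  then have 1: "1 \<le> (x\<^sup>2)\<^sup>2" by (rule one_le_power)
  have "2 \<le> exp (1::real)" using exp_ge_add_one_self[of 1] by simp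
  then have "inverse (exp (1::real)) \<le> inverse 2" by (intro le_imp_inverse_le) auto
  with \<open>2 \<le> exp (1::real)\<close> have "3/4 \<le> sinh (1::real)" by (simp add: sinh_def exp_minus)
  also have "sinh 1 \<le> sinh \<bar>x\<bar>" using False by (subst sinh_real_le_iff) simp
  finally have "(3/4)\<^sup>2 \<le> (sinh \<bar>x\<bar>)\<^sup>2" by (rule power_mono) simp
  then have s: "9/16 \<le> (sinh x)\<^sup>2" by (simp add: power_divide)
  have "1 = w x + (sinh x)\<^sup>2 * w x"
    using w_cosh[of x] by (simp add: cosh_square_real algebra_simps)
  moreover have "9/16 * w x \<le> (sinh x)\<^sup>2 * w x"
    using s w_pos[of x] by (intro mult_right_mono) auto
  ultimately have "1 \<le> 4 * ((sinh x)\<^sup>2 * w x)" by linarith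
  from mult_left_mono[OF this, of "(x\<^sup>2)\<^sup>2"] have "(x\<^sup>2)\<^sup>2 \<le> 4 * ((q x)\<^sup>2 * w x)"
    by (simp add: q_def power_mult_distrib mult_ac)
  then show ?thesis using 1 w_pos[of x] unfolding distrib_left by linarith
qed

text \<open>Control of q f compensates for the decay of the weight, and even leaves the factor x^2.
  This is what sends the second row of \<open>A\<close> into L2(R) and makes the solution operator
  bounded without weight.\<close>

lemma L2R_of_L2w:
  assumes "f \<in> L2 w" "(\<lambda>x. complex_of_real (q x) * f x) \<in> L2 w"
  shows "f \<in> L2R" "(\<lambda>x. complex_of_real (x\<^sup>2) * f x) \<in> L2R"
    "(L2R_norm f)\<^sup>2 + (L2R_norm (\<lambda>x. complex_of_real (x\<^sup>2) * f x))\<^sup>2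
      \<le> 8 * ((L2_norm w f)\<^sup>2 + (L2_norm w (\<lambda>x. complex_of_real (q x) * f x))\<^sup>2)"
proof -
  let ?k = "\<lambda>x. 8 * ((cmod (f x))\<^sup>2 * w x + (cmod (complex_of_real (q x) * f x))\<^sup>2 * w x)"
  have k: "integrable lborel ?k" using assms[THEN L2_integrable] by simp
  have b: "(cmod (f x))\<^sup>2 + (cmod (complex_of_real (x\<^sup>2) * f x))\<^sup>2 \<le> ?k x" for x
    using mult_left_mono[OF one_plus_fourth_power_le[of x], of "(cmod (f x))\<^sup>2"]
    unfolding norm_mult norm_of_real power_mult_distrib power2_abs by (simp add: algebra_simps)
  have b12: "(cmod (f x))\<^sup>2 * 1 \<le> ?k x" "(cmod (complex_of_real (x\<^sup>2) * f x))\<^sup>2 * 1 \<le> ?k x" for x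
    using b[of x] zero_le_power2[of "cmod (f x)"] zero_le_power2[of "cmod (complex_of_real (x\<^sup>2) * f x)"] by linarith+
  have m: "(\<lambda>x. complex_of_real (x\<^sup>2) * f x) \<in> borel_measurable borel"
    using L2_measurable[OF assms(1)] by measurable
  show 1: "f \<in> L2R" by (rule L2_dominated[OF weight_one L2_measurable[OF assms(1)] k AE_I2[OF b12(1)]])
  show 2: "(\<lambda>x. complex_of_real (x\<^sup>2) * f x) \<in> L2R" by (rule L2_dominated[OF weight_one m k AE_I2[OF b12(2)]])
  have "(L2R_norm f)\<^sup>2 + (L2R_norm (\<lambda>x. complex_of_real (x\<^sup>2) * f x))\<^sup>2
    = (\<integral>x. (cmod (f x))\<^sup>2 * 1 + (cmod (complex_of_real (x\<^sup>2) * f x))\<^sup>2 * 1 \<partial>lborel)"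
    unfolding L2_norm_square[OF weight_one]
    by (rule Bochner_Integration.integral_add[symmetric, OF L2_integrable[OF 1] L2_integrable[OF 2]])
  also have "\<dots> \<le> (\<integral>x. ?k x \<partial>lborel)"
    by (rule integral_mono[OF Bochner_Integration.integrable_add[OF L2_integrable[OF 1] L2_integrable[OF 2]] k])
      (use b in \<open>simp only: mult_1_right\<close>)
  also have "\<dots> = 8 * ((L2_norm w f)\<^sup>2 + (L2_norm w (\<lambda>x. complex_of_real (q x) * f x))\<^sup>2)"
    unfolding L2_norm_square[OF weight_w] integral_mult_right_zero
    by (subst Bochner_Integration.integral_add[OF L2_integrable[OF assms(1)] L2_integrable[OF assms(2)]]) (rule refl)
  finally show "(L2R_norm f)\<^sup>2 + (L2R_norm (\<lambda>x. complex_of_real (x\<^sup>2) * f x))\<^sup>2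
      \<le> 8 * ((L2_norm w f)\<^sup>2 + (L2_norm w (\<lambda>x. complex_of_real (q x) * f x))\<^sup>2)" .
qed

lemma L2_compact_support:
  fixes u :: cfun
  assumes \<rho>: "weight \<rho>" "continuous_on UNIV \<rho>" and u: "continuous_on UNIV u" "\<And>x. R \<le> \<bar>x\<bar> \<Longrightarrow> u x = 0"
  shows "u \<in> L2 \<rho>"
proof (rule L2_dominated[OF \<rho>(1) borel_measurable_continuous_onI[OF u(1)]])
  show "integrable lborel (\<lambda>x. indicator {-R..R} x *\<^sub>R ((cmod (u x))\<^sup>2 * \<rho> x))"
    using set_integrable_continuous[of "\<lambda>x. (cmod (u x))\<^sup>2 * \<rho> x" "-R" R] u(1) \<rho>(2)
    unfolding set_integrable_def by (simp add: continuous_intros)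
  show "AE x in lborel. (cmod (u x))\<^sup>2 * \<rho> x \<le> indicator {-R..R} x *\<^sub>R ((cmod (u x))\<^sup>2 * \<rho> x)"
  proof (rule AE_I2)
    fix x
    show "(cmod (u x))\<^sup>2 * \<rho> x \<le> indicator {-R..R} x *\<^sub>R ((cmod (u x))\<^sup>2 * \<rho> x)"
      using u(2)[of x] by (cases "R \<le> \<bar>x\<bar>") (auto simp: indicator_def)
  qed
qed

lemma test_fun_L2:
  assumes "\<phi> \<in> test_funs" "weight \<rho>" "continuous_on UNIV \<rho>"
  shows "\<phi> \<in> L2 \<rho>"
proof -
  obtain R where "\<forall>x. R \<le> \<bar>x\<bar> \<longrightarrow> \<phi> x = 0 \<and> vderiv \<phi> x = 0"
    using test_fun_support[OF assms(1)] by blast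
  then show ?thesis
    by (intro L2_compact_support[where R = R] assms smooth_continuous[OF test_fun_smooth[OF assms(1)]]) auto
qed

lemma test_fun_DS:
  assumes "\<phi> \<in> test_funs"
  shows "\<phi> \<in> DS lam" "AE x in lborel. weak2 \<phi> x = vderiv (vderiv \<phi>) x" "weak2 \<phi> \<in> borel_measurable borel"
proof -
  note t1 = test_fun_vderiv[OF assms] and t2 = test_fun_vderiv[OF test_fun_vderiv[OF assms]]
  note s = assms[THEN test_fun_smooth] t1[THEN test_fun_smooth]
  have m: "\<phi> \<in> borel_measurable borel"
    by (rule borel_measurable_continuous_onI[OF smooth_continuous[OF s(1)]])
  obtain R where R: "\<forall>x. R \<le> \<bar>x\<bar> \<longrightarrow> \<phi> x = 0 \<and> vderiv \<phi> x = 0"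
    using test_fun_support[OF assms] by blast
  have q\<phi>: "(\<lambda>x. complex_of_real (q x) * \<phi> x) \<in> L2 w"
    by (rule L2_compact_support[OF weight_w continuous_w, where R = R])
      (use R in \<open>auto intro!: continuous_intros continuous_q smooth_continuous[OF s(1)]\<close>)
  note W = test_fun_L2[OF _ weight_w continuous_w]
  show "\<phi> \<in> DS lam"
    by (rule DS_I[OF m _ smooth_prim[OF s(1)] smooth_prim[OF s(2)] W[OF assms] W[OF t1] W[OF t2] q\<phi>]) simp
  show "AE x in lborel. weak2 \<phi> x = vderiv (vderiv \<phi>) x" "weak2 \<phi> \<in> borel_measurable borel"
    by (rule weak2_of_prim[OF m _ smooth_prim[OF s(1)] smooth_prim[OF s(2)]], simp)+
qed

section \<open>Density of test functions in L2(R)\<close>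

lemma borel_measurable_AE_limit_continuous:
  fixes f :: cfun
  assumes "f \<in> borel_measurable borel"
  shows "\<exists>g. (\<forall>n. continuous_on UNIV (g n)) \<and> (AE x in lborel. (\<lambda>n. g n x) \<longlonglongrightarrow> f x)"
proof -
  \<comment> \<open>The detour through the completed measure gives access to
    \<open>measurable_on\<close>, whose definition supplies continuous approximants off a negligible
    set.\<close>
  have "f \<in> borel_measurable lebesgue"
    using assms by (simp add: measurable_completion)
  then have "f measurable_on UNIV"
    by (intro lebesgue_measurable_imp_measurable_on) auto
  then obtain N g where N: "negligible N" and g: "\<forall>n. continuous_on UNIV (g n)"
    "\<forall>x. x \<notin> N \<longrightarrow> (\<lambda>n. g n x) \<longlonglongrightarrow> f x"
    unfolding measurable_on_def by auto
  have "AE x in lebesgue. x \<notin> N"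
    using N by (intro AE_not_in) (simp add: negligible_iff_null_sets)
  then have "AE x in lborel. x \<notin> N" by (simp add: AE_completion_iff)
  then have "AE x in lborel. (\<lambda>n. g n x) \<longlonglongrightarrow> f x"
    by eventually_elim (use g(2) in blast)
  with g(1) show ?thesis by blast
qed

lemma bounded_compact_test_fun_approx:
  assumes f: "f \<in> borel_measurable borel" "\<And>x. cmod (f x) \<le> real N + 1" "\<And>x. real N < \<bar>x\<bar> \<Longrightarrow> f x = 0" and "0 < e"
  shows "\<exists>\<phi>\<in>test_funs. L2R_norm (\<lambda>x. f x - \<phi> x) < e"
proof -
  \<comment> \<open>One number serves as radius and as bound: \<open>plateau N\<close> vanishes from
    N + 1 on, and the values of \<open>f\<close> have modulus at most N + 1.\<close>
  define L where "L = real N + 1"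
  have L: "0 < L" by (simp add: L_def)
  obtain g where g: "\<forall>n. continuous_on UNIV (g n)" "AE x in lborel. (\<lambda>n. g n x) \<longlonglongrightarrow> f x"
    using borel_measurable_AE_limit_continuous[OF f(1)] by blast
  \<comment> \<open>The radial retraction onto the disc of radius L. The continuous approximants
    need not be uniformly bounded; composing with \<open>c\<close> bounds them, without moving their
    almost everywhere limit \<open>f\<close>, whose values already lie in the disc.\<close>
  define c where "c y = complex_of_real (L / max L (cmod y)) * y" for y
  have c_cont: "continuous_on UNIV c"
    unfolding c_def[abs_def] using L by (intro continuous_intros) (auto simp: max_def)
  have c_bound: "cmod (c y) \<le> L" for y
  proof -
    have "L * cmod y \<le> L * max L (cmod y)" using L by (intro mult_left_mono) auto
    then show ?thesis using L by (simp add: c_def norm_mult norm_divide divide_simps max_def)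
  qed
  have c_id: "c y = y" if "cmod y \<le> L" for y
    using that L by (simp add: c_def max_def)
  have cg: "continuous_on S (\<lambda>x. c (g n x))" for n S
    using continuous_on_compose2[OF c_cont, of UNIV "g n"] g(1) continuous_on_subset by blast
  have "\<exists>p. smooth p \<and> (\<forall>x\<in>{-L..L}. cmod (c (g n x) - p x) < 1 / Suc n)" for n
    by (rule smooth_approx[OF cg]) simp
  then obtain p where p: "\<And>n. smooth (p n)" "\<And>n x. x \<in> {-L..L} \<Longrightarrow> cmod (c (g n x) - p n x) < 1 / Suc n"
    by metis
  define \<phi> where "\<phi> n x = plateau N x * p n x" for n x
  have \<phi>: "\<phi> n \<in> test_funs" for n
    unfolding \<phi>_def[abs_def] by (rule test_fun_mult[OF plateau_test_fun p(1)])
  have [measurable]: "\<phi> n \<in> borel_measurable borel" for n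
    by (intro borel_measurable_continuous_onI smooth_continuous test_fun_smooth \<phi>)
  let ?K = plateau_bound
  have K: "1 \<le> ?K" by (rule plateau_bound_ge_1)
  have out: "\<phi> n x = 0" "f x = 0" if "x \<notin> {-L..L}" for n x
  proof -
    have "L < \<bar>x\<bar>" using that by auto
    then show "\<phi> n x = 0" "f x = 0" using plateau_zero[of N x] f(3)[of x] by (auto simp: \<phi>_def L_def)
  qed
  have "(\<lambda>n. L2R_norm (\<lambda>x. f x - \<phi> n x)) \<longlonglongrightarrow> 0"
  proof (rule L2_norm_dominated_convergence[OF weight_one])
    show "(\<lambda>x. complex_of_real (indicator {-L..L} x)) \<in> L2R"
    proof (rule L2_dominated[OF weight_one])
      show "integrable lborel (indicator {-L..L} :: real \<Rightarrow> real)"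
        by (rule integrable_real_indicator) (auto simp: emeasure_lborel_Icc_eq)
    qed (auto simp: indicator_def)
    show "AE x in lborel. (\<lambda>n. f x - \<phi> n x) \<longlonglongrightarrow> 0"
      using g(2)
    proof eventually_elim
      case (elim x)
      show ?case
      proof (cases "x \<in> {-L..L}")
        case True
        have "(\<lambda>n. c (g n x)) \<longlonglongrightarrow> c (f x)"
          by (rule continuous_on_tendsto_compose[OF c_cont elim]) auto
        then have 1: "(\<lambda>n. c (g n x)) \<longlonglongrightarrow> f x" using c_id[of "f x"] f(2)[of x] by (simp add: L_def)
        have 2: "(\<lambda>n. c (g n x) - p n x) \<longlonglongrightarrow> 0"
          by (rule Lim_null_comparison[OF always_eventually LIMSEQ_Suc[OF lim_1_over_n]])
            (use p(2)[OF True] in \<open>auto intro: less_imp_le simp del: of_nat_Suc\<close>)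
        from tendsto_diff[OF 1 2] have "(\<lambda>n. p n x) \<longlonglongrightarrow> f x" by simp
        then have "(\<lambda>n. f x - plateau N x * p n x) \<longlonglongrightarrow> f x - plateau N x * f x"
          by (intro tendsto_intros)
        moreover have "plateau N x * f x = f x"
          using plateau_one[of x N] f(3)[of x] by (cases "\<bar>x\<bar> \<le> real N") auto
        ultimately show ?thesis by (simp add: \<phi>_def)
      next
        case False
        then show ?thesis by (simp add: out)
      qed
    qed
    show "AE x in lborel. cmod (f x - \<phi> n x) \<le> (L + ?K * (L + 1)) * cmod (complex_of_real (indicator {-L..L} x))" for n
    proof (rule AE_I2)
      fix x
      show "cmod (f x - \<phi> n x) \<le> (L + ?K * (L + 1)) * cmod (complex_of_real (indicator {-L..L} x))"
      proof (cases "x \<in> {-L..L}")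
        case True
        have "1 / real (Suc n) \<le> 1" by simp
        then have "cmod (c (g n x) - p n x) \<le> 1" using p(2)[OF True, of n] by linarith
        then have "cmod (p n x) \<le> L + 1"
          using c_bound[of "g n x"] norm_triangle_ineq4[of "c (g n x)" "c (g n x) - p n x"] by simp
        then have "cmod (\<phi> n x) \<le> ?K * (L + 1)"
          unfolding \<phi>_def norm_mult using K by (intro mult_mono plateau_bounds) auto
        then show ?thesis
          using True norm_triangle_ineq4[of "f x" "\<phi> n x"] f(2)[of x] by (simp add: L_def)
      next
        case False
        then show ?thesis by (simp add: out)
      qed
    qed
  qed (use f(1) in measurable)
  then have "\<forall>\<^sub>F n in sequentially. L2R_norm (\<lambda>x. f x - \<phi> n x) < e"
    by (rule order_tendstoD(2)) (rule \<open>0 < e\<close>)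
  then obtain n where "L2R_norm (\<lambda>x. f x - \<phi> n x) < e"
    by (auto simp: eventually_sequentially)
  with \<phi> show ?thesis by blast
qed

lemma test_funs_dense_L2R:
  assumes f: "f \<in> L2R" and "0 < e"
  shows "\<exists>\<phi>\<in>test_funs. (L2R_norm (\<lambda>x. f x - \<phi> x))\<^sup>2 < e"
proof -
  note [measurable] = L2_measurable[OF f]
  \<comment> \<open>Truncating both the domain and the values leaves a bounded function of bounded
    support. The two squared errors get e / 4 each, as the squared triangle inequality costs a
    factor 2.\<close>
  define h where "h n x = (if \<bar>x\<bar> \<le> real n \<and> cmod (f x) \<le> real n then f x else 0)" for n :: nat and x
  have [measurable]: "h n \<in> borel_measurable borel" for n
    unfolding h_def[abs_def] by measurable
  have hL: "h n \<in> L2R" for n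
    by (rule L2_bound[OF weight_one _ f, of _ 1]) (auto simp: h_def)
  have "(\<lambda>n. L2R_norm (\<lambda>x. f x - h n x)) \<longlonglongrightarrow> 0"
  proof (rule L2_norm_dominated_convergence[OF weight_one _ f])
    show "AE x in lborel. (\<lambda>n. f x - h n x) \<longlonglongrightarrow> 0"
    proof (rule AE_I2, rule tendsto_eventually)
      fix x
      obtain N :: nat where N: "max \<bar>x\<bar> (cmod (f x)) \<le> real N" using real_arch_simple by blast
      show "\<forall>\<^sub>F n in sequentially. f x - h n x = 0"
        by (rule eventually_sequentiallyI[of N]) (use N in \<open>auto simp: h_def\<close>)
    qed
    show "AE x in lborel. cmod (f x - h n x) \<le> 1 * cmod (f x)" for n
      by (auto simp: h_def)
  qed measurable
  then have "(\<lambda>n. (L2R_norm (\<lambda>x. f x - h n x))\<^sup>2) \<longlonglongrightarrow> 0\<^sup>2" by (intro tendsto_intros)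
  then have "\<forall>\<^sub>F n in sequentially. (L2R_norm (\<lambda>x. f x - h n x))\<^sup>2 < e / 4"
    by (rule order_tendstoD(2)) (use \<open>0 < e\<close> in simp)
  then obtain n where n: "(L2R_norm (\<lambda>x. f x - h n x))\<^sup>2 < e / 4"
    by (auto simp: eventually_sequentially)
  have "\<exists>\<phi>\<in>test_funs. L2R_norm (\<lambda>x. h n x - \<phi> x) < sqrt (e / 4)"
    by (rule bounded_compact_test_fun_approx[of _ n]) (use \<open>0 < e\<close> in \<open>auto simp: h_def\<close>)
  then obtain \<phi> where \<phi>: "\<phi> \<in> test_funs" "L2R_norm (\<lambda>x. h n x - \<phi> x) < sqrt (e / 4)" by blast
  have pL: "\<phi> \<in> L2R" by (rule test_fun_L2[OF \<phi>(1) weight_one continuous_on_const])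
  have "(L2R_norm (\<lambda>x. h n x - \<phi> x))\<^sup>2 < (sqrt (e / 4))\<^sup>2"
    by (rule power_strict_mono[OF \<phi>(2) L2_norm_nonneg[OF weight_one]]) simp
  then have "(L2R_norm (\<lambda>x. h n x - \<phi> x))\<^sup>2 < e / 4" using \<open>0 < e\<close> by simp
  moreover have "(L2R_norm (\<lambda>x. f x - \<phi> x))\<^sup>2 \<le> 2 * (L2R_norm (\<lambda>x. f x - h n x))\<^sup>2 + 2 * (L2R_norm (\<lambda>x. h n x - \<phi> x))\<^sup>2"
    using L2_norm_add_square[OF weight_one L2_diff[OF weight_one f hL[of n]] L2_diff[OF weight_one hL[of n] pL]] by simp
  ultimately have "(L2R_norm (\<lambda>x. f x - \<phi> x))\<^sup>2 < e" using n by linarith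
  with \<phi>(1) show ?thesis by blast
qed

text \<open>No regularity is asked of the second component, so a sharp cut-off is enough; on its
  support sinh is bounded, which brings i sinh x g back into L2(R).\<close>

lemma truncation_approx_L2R:
  assumes g: "g \<in> L2R"
  shows "(\<lambda>n. L2R_norm (\<lambda>x. g x - indicator {- real n..real n} x * g x)) \<longlonglongrightarrow> 0"
    "(\<lambda>x. indicator {- real n..real n} x * g x) \<in> L2R"
    "(\<lambda>x. \<i> * complex_of_real (sinh x) * (indicator {- real n..real n} x * g x)) \<in> L2R"
proof -
  note [measurable] = L2_measurable[OF g]
  have [measurable]: "(\<lambda>x::real. complex_of_real (sinh x)) \<in> borel_measurable borel"
    by (intro borel_measurable_continuous_onI continuous_intros)
  show "(\<lambda>n. L2R_norm (\<lambda>x. g x - indicator {- real n..real n} x * g x)) \<longlonglongrightarrow> 0"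
  proof (rule L2_norm_dominated_convergence[OF weight_one _ g])
    show "AE x in lborel. (\<lambda>n. g x - indicator {- real n..real n} x * g x) \<longlonglongrightarrow> 0"
    proof (rule AE_I2, rule tendsto_eventually)
      fix x :: real
      obtain N :: nat where N: "\<bar>x\<bar> \<le> real N" using real_arch_simple by blast
      show "\<forall>\<^sub>F n in sequentially. g x - indicator {- real n..real n} x * g x = 0"
        by (rule eventually_sequentiallyI[of N]) (use N in \<open>auto simp: indicator_def\<close>)
    qed
    show "AE x in lborel. cmod (g x - indicator {- real n..real n} x * g x) \<le> 1 * cmod (g x)" for n
      by (auto simp: indicator_def)
  qed measurable
  show "(\<lambda>x. indicator {- real n..real n} x * g x) \<in> L2R"
    by (rule L2_bound[OF weight_one _ g, of _ 1]) (auto simp: indicator_def)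
  show "(\<lambda>x. \<i> * complex_of_real (sinh x) * (indicator {- real n..real n} x * g x)) \<in> L2R"
  proof (rule L2_bound[OF weight_one _ g, of _ "sinh (real n)"])
    show "AE x in lborel. cmod (\<i> * complex_of_real (sinh x) * (indicator {- real n..real n} x * g x)) \<le> sinh (real n) * cmod (g x)"
    proof (rule AE_I2)
      fix x
      show "cmod (\<i> * complex_of_real (sinh x) * (indicator {- real n..real n} x * g x)) \<le> sinh (real n) * cmod (g x)"
      proof (cases "x \<in> {- real n..real n}")
        case True
        have "sinh \<bar>x\<bar> \<le> sinh (real n)" using True by (subst sinh_real_le_iff) (simp add: abs_le_iff)
        then have "\<bar>sinh x\<bar> \<le> sinh (real n)" by simp
        from mult_right_mono[OF this norm_ge_zero[of "g x"]] show ?thesis using True by (simp add: norm_mult)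
      qed simp
    qed
  qed measurable
qed

text \<open>Compact support removes the weight from the second derivative, which puts the cut-off
  into the first slot of the domain as soon as the second slot is truncated. Convergence in the
  \<open>DS\<close> norm rests on the plateau bounds being uniform in N.\<close>

lemma DS_cutoff:
  assumes "f \<in> DS lam"
  shows "(\<lambda>x. plateau N x * f x) \<in> DS lam" "weak2 (\<lambda>x. plateau N x * f x) \<in> L2R"
    "(\<lambda>N. DS_norm (\<lambda>x. f x - plateau N x * f x)) \<longlonglongrightarrow> 0"
proof -
  obtain F F1 where F: "AE x in lborel. f x = F x" "prim F1 F" "prim (weak2 f) F1" "F \<in> L2 w" "F1 \<in> L2 w"
    "weak2 f \<in> L2 w" "(\<lambda>x. complex_of_real (q x) * F x) \<in> L2 w"
    using DS_D(2)[OF assms] by blast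
  let ?F2 = "weak2 f" and ?K = plateau_bound
  let ?p = plateau and ?p1 = "\<lambda>N. vderiv (plateau N)" and ?p2 = "\<lambda>N. vderiv (vderiv (plateau N))"
  have K: "1 \<le> ?K" by (rule plateau_bound_ge_1)
  have mp: "?p N \<in> borel_measurable borel" "?p1 N \<in> borel_measurable borel" "?p2 N \<in> borel_measurable borel" for N
    by (intro borel_measurable_continuous_onI smooth_continuous smooth_vderiv plateau_smooth)+
  note [measurable] = mp DS_D(1)[OF assms] prim_measurable[OF F(2)] prim_measurable[OF F(3)] L2_measurable[OF F(6)]
    borel_measurable_continuous_onI[OF continuous_q]
  let ?G = "\<lambda>N x. F x * ?p N x" and ?G1 = "\<lambda>N x. F1 x * ?p N x + ?p1 N x * F x"
    and ?G2 = "\<lambda>N x. (?F2 x * ?p N x + ?p1 N x * F1 x) + (?p2 N x * F x + F1 x * ?p1 N x)"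
  have G1: "prim (?G1 N) (?G N)" for N
    by (rule prim_mult[OF F(2) smooth_prim[OF plateau_smooth]])
  have G2: "prim (?G2 N) (?G1 N)" for N
    by (intro prim_add prim_mult F smooth_prim plateau_smooth smooth_vderiv)
  have bd: "(\<lambda>x. b x * u x) \<in> L2 w" if "u \<in> L2 w" "\<And>x. cmod (b x) \<le> ?K" "b \<in> borel_measurable borel" for b u
  proof (rule L2_bound[OF weight_w _ that(1), of _ ?K])
    show "(\<lambda>x. b x * u x) \<in> borel_measurable borel" using that(3) L2_measurable[OF that(1)] by measurable
    show "AE x in lborel. cmod (b x * u x) \<le> ?K * cmod (u x)"
      unfolding norm_mult by (intro AE_I2 mult_right_mono that) simp
  qed
  have GL: "?G N \<in> L2 w" "?G1 N \<in> L2 w" "?G2 N \<in> L2 w" for N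
    unfolding mult.commute[of "F _" "?p _ _"] mult.commute[of "F1 _" "?p _ _"] mult.commute[of "?F2 _" "?p _ _"] mult.commute[of "F1 _" "?p1 _ _"]
    by (intro L2_add[OF weight_w] bd F plateau_bounds mp)+
  have "(\<lambda>x. ?p N x * (complex_of_real (q x) * F x)) \<in> L2 w" for N
    by (intro bd F plateau_bounds mp)
  then have qG: "(\<lambda>x. complex_of_real (q x) * ?G N x) \<in> L2 w" for N
    by (simp only: mult_ac)
  have fm: "(\<lambda>x. ?p N x * f x) \<in> borel_measurable borel" for N by measurable
  have fa: "AE x in lborel. ?p N x * f x = ?G N x" for N
    using F(1) by eventually_elim (simp add: mult.commute)
  show cut: "(\<lambda>x. ?p N x * f x) \<in> DS lam" for N
    by (rule DS_I[OF fm fa G1 G2 GL qG])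
  note w2 = weak2_of_prim[OF fm fa G1 G2]
  show "weak2 (\<lambda>x. ?p N x * f x) \<in> L2R"
  proof (rule L2_bound[OF weight_one w2(2)])
    let ?S = "{-(real N+1)..real N+1}"
    have ae: "AE x in lborel. weak2 (\<lambda>x. ?p N x * f x) x = indicator ?S x * ?G2 N x"
      using w2(1)[of N]
    proof eventually_elim
      case (elim x)
      have "?p N x = 0 \<and> ?p1 N x = 0 \<and> ?p2 N x = 0" if "x \<notin> ?S"
      proof -
        have z: "?p N y = 0" if "y \<in> - ?S" for y using that by (intro plateau_zero) auto
        have z1: "?p1 N y = 0" if "y \<in> - ?S" for y
          by (rule vderiv_locally_const[of "- ?S" y _ 0]) (use that z in auto)
        have "?p2 N x = 0"
          by (rule vderiv_locally_const[of "- ?S" x _ 0]) (use that z1 in auto)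
        then show ?thesis using z z1 that by auto
      qed
      then show ?case unfolding elim by (cases "x \<in> ?S") simp_all
    qed
    \<comment> \<open>On the support the square root of the weight, 1 / cosh x, is at least 1 / ?C,
      so there the weighted norm controls the unweighted one.\<close>
    let ?C = "cosh (real N + 1)"
    show "(\<lambda>x. complex_of_real (sqrt (w x)) * ?G2 N x) \<in> L2R"
      using L2_integrable[OF GL(3)[of N]] w_pos weight_measurable[OF weight_w]
      by (simp add: L2_def norm_mult power_mult_distrib less_imp_le mult.commute)
    show "AE x in lborel. cmod (weak2 (\<lambda>x. ?p N x * f x) x) \<le> ?C * cmod (complex_of_real (sqrt (w x)) * ?G2 N x)"
      using ae
    proof eventually_elim
      case (elim x)
      show ?case
      proof (cases "x \<in> ?S")
        case True
        have sw: "sqrt (w x) = 1 / cosh x" by (simp add: w_eq real_sqrt_divide)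
        have "cosh \<bar>x\<bar> \<le> ?C" using True by (subst cosh_real_nonneg_le_iff) (auto simp: abs_le_iff)
        then have "1 \<le> ?C * sqrt (w x)" unfolding sw by (simp add: divide_simps)
        from mult_right_mono[OF this norm_ge_zero[of "?G2 N x"]] show ?thesis
          using True w_pos[of x] unfolding elim by (simp add: norm_mult mult.assoc less_imp_le)
      next
        case False
        then show ?thesis unfolding elim by simp
      qed
    qed
  qed
  \<comment> \<open>At a fixed point the cut-off and its first two derivatives eventually equal 1,
    0, 0, so every expression in them is eventually constant, and no continuity of \<open>k\<close>
    is involved.\<close>
  have ev: "(\<lambda>N. k (?p N x) (?p1 N x) (?p2 N x)) \<longlonglongrightarrow> k 1 0 0" for k :: "complex \<Rightarrow> complex \<Rightarrow> complex \<Rightarrow> complex" and x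
    by (rule tendsto_eventually) (use eventually_plateau[of x] in eventually_elim, simp)
  have cutb: "cmod (u - ?p N x * u) \<le> (1 + ?K) * cmod u" for N x u
    using norm_triangle_ineq4[of u "?p N x * u"] mult_right_mono[OF plateau_bounds(1)[of N x] norm_ge_zero[of u]]
    by (simp add: norm_mult distrib_right)
  have t1: "(\<lambda>N. L2_norm w (\<lambda>x. f x - ?p N x * f x)) \<longlonglongrightarrow> 0"
  proof (rule L2_norm_dominated_convergence[OF weight_w _ F(4), of _ "1 + ?K"])
    show "AE x in lborel. (\<lambda>N. f x - ?p N x * f x) \<longlonglongrightarrow> 0"
    proof (rule AE_I2)
      fix x
      show "(\<lambda>N. f x - ?p N x * f x) \<longlonglongrightarrow> 0"
        using ev[of "\<lambda>a b c. f x - a * f x" x] by simp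
    qed
    show "AE x in lborel. cmod (f x - ?p N x * f x) \<le> (1 + ?K) * cmod (F x)" for N
      using F(1) by eventually_elim (simp add: cutb)
  qed measurable
  have t2: "(\<lambda>N. L2_norm w (\<lambda>x. complex_of_real (q x) * (f x - ?p N x * f x))) \<longlonglongrightarrow> 0"
  proof (rule L2_norm_dominated_convergence[OF weight_w _ F(7), of _ "1 + ?K"])
    show "AE x in lborel. (\<lambda>N. complex_of_real (q x) * (f x - ?p N x * f x)) \<longlonglongrightarrow> 0"
    proof (rule AE_I2)
      fix x
      show "(\<lambda>N. complex_of_real (q x) * (f x - ?p N x * f x)) \<longlonglongrightarrow> 0"
        using ev[of "\<lambda>a b c. complex_of_real (q x) * (f x - a * f x)" x] by simp
    qed
    show "AE x in lborel. cmod (complex_of_real (q x) * (f x - ?p N x * f x)) \<le> (1 + ?K) * cmod (complex_of_real (q x) * F x)" for N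
      using F(1)
    proof eventually_elim
      case (elim x)
      show ?case
        using mult_left_mono[OF cutb[of "F x" N x] abs_ge_zero[of "q x"]]
        unfolding elim norm_mult norm_of_real by (simp only: mult_ac)
    qed
  qed measurable
  have t3: "(\<lambda>N. L2_norm w (weak2 (\<lambda>x. f x - ?p N x * f x))) \<longlonglongrightarrow> 0"
  proof -
    have ae: "AE x in lborel. weak2 (\<lambda>x. f x - ?p N x * f x) x = ?F2 x - ?G2 N x" and
      ms: "weak2 (\<lambda>x. f x - ?p N x * f x) \<in> borel_measurable borel" for N
    proof -
      have "(\<lambda>x. f x - ?p N x * f x) \<in> borel_measurable borel" by measurable
      moreover have "AE x in lborel. f x - ?p N x * f x = F x - ?G N x"
        using F(1) by eventually_elim (simp add: mult.commute)
      ultimately show "AE x in lborel. weak2 (\<lambda>x. f x - ?p N x * f x) x = ?F2 x - ?G2 N x"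
        "weak2 (\<lambda>x. f x - ?p N x * f x) \<in> borel_measurable borel"
        using weak2_of_prim(1,2)[OF _ _ prim_diff[OF F(2) G1[of N]] prim_diff[OF F(3) G2[of N]]] by auto
    qed
    have "L2_norm w (weak2 (\<lambda>x. f x - ?p N x * f x)) = L2_norm w (\<lambda>x. ?F2 x - ?G2 N x)" for N
      by (rule L2_norm_AE_cong[OF weight_w ms _ ae]) measurable
    moreover have "(\<lambda>N. L2_norm w (\<lambda>x. ?F2 x - ?G2 N x)) \<longlonglongrightarrow> 0"
    proof (rule L2_norm_dominated_convergence[OF weight_w, where c = "1 + 2 * ?K"])
      show "(\<lambda>x. complex_of_real (cmod (?F2 x)) + (complex_of_real (cmod (F1 x)) + complex_of_real (cmod (F x)))) \<in> L2 w"
        by (intro L2_add[OF weight_w] L2_cmod F)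
      show "AE x in lborel. (\<lambda>N. ?F2 x - ?G2 N x) \<longlonglongrightarrow> 0"
      proof (rule AE_I2)
        fix x
        show "(\<lambda>N. ?F2 x - ?G2 N x) \<longlonglongrightarrow> 0"
          using ev[of "\<lambda>a b c. ?F2 x - ((?F2 x * a + b * F1 x) + (c * F x + F1 x * b))" x] by simp
      qed
      show "AE x in lborel. cmod (?F2 x - ?G2 N x) \<le> (1 + 2 * ?K)
          * cmod (complex_of_real (cmod (?F2 x)) + (complex_of_real (cmod (F1 x)) + complex_of_real (cmod (F x))))" for N
      proof (rule AE_I2)
        fix x
        have eq: "?F2 x - ?G2 N x = (?F2 x - ?p N x * ?F2 x) - (2 * (?p1 N x * F1 x) + ?p2 N x * F x)"
          by (simp add: algebra_simps)
        have "cmod (?F2 x - ?G2 N x) \<le> cmod (?F2 x - ?p N x * ?F2 x) + cmod (2 * (?p1 N x * F1 x) + ?p2 N x * F x)"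
          unfolding eq by (rule norm_triangle_ineq4)
        also have "\<dots> \<le> cmod (?F2 x - ?p N x * ?F2 x) + (2 * (cmod (?p1 N x) * cmod (F1 x)) + cmod (?p2 N x) * cmod (F x))"
          using norm_triangle_ineq[of "2 * (?p1 N x * F1 x)" "?p2 N x * F x"] by (simp add: norm_mult)
        also have "\<dots> \<le> (1 + ?K) * cmod (?F2 x) + (2 * (?K * cmod (F1 x)) + ?K * cmod (F x))"
          by (intro add_mono cutb mult_left_mono mult_right_mono plateau_bounds) auto
        also have "\<dots> \<le> (1 + 2 * ?K) * (cmod (?F2 x) + (cmod (F1 x) + cmod (F x)))"
        proof -
          have "(1 + ?K) * cmod (?F2 x) \<le> (1 + 2 * ?K) * cmod (?F2 x)"
            "(2 * ?K) * cmod (F1 x) \<le> (1 + 2 * ?K) * cmod (F1 x)" "?K * cmod (F x) \<le> (1 + 2 * ?K) * cmod (F x)"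
            using K by (intro mult_right_mono; simp)+
          then show ?thesis unfolding distrib_left[of "1 + 2 * ?K"] by linarith
        qed
        also have "cmod (?F2 x) + (cmod (F1 x) + cmod (F x))
            = cmod (complex_of_real (cmod (?F2 x)) + (complex_of_real (cmod (F1 x)) + complex_of_real (cmod (F x))))"
          unfolding of_real_add[symmetric] norm_of_real by simp
        finally show "cmod (?F2 x - ?G2 N x) \<le> (1 + 2 * ?K)
          * cmod (complex_of_real (cmod (?F2 x)) + (complex_of_real (cmod (F1 x)) + complex_of_real (cmod (F x))))" .
      qed
    qed measurable
    ultimately show ?thesis by simp
  qed
  have "(\<lambda>N. sqrt ((L2_norm w (weak2 (\<lambda>x. f x - ?p N x * f x)))\<^sup>2
     + (L2_norm w (\<lambda>x. complex_of_real (q x) * (f x - ?p N x * f x)))\<^sup>2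
     + (L2_norm w (\<lambda>x. f x - ?p N x * f x))\<^sup>2)) \<longlonglongrightarrow> sqrt (0\<^sup>2 + 0\<^sup>2 + 0\<^sup>2)"
    by (intro tendsto_intros t1 t2 t3)
  then show "(\<lambda>N. DS_norm (\<lambda>x. f x - plateau N x * f x)) \<longlonglongrightarrow> 0"
    by (simp add: DS_norm_def q_def)
qed

section \<open>The resolvent equation\<close>

text \<open>The energy bound 919 = 1 + 918 passes through the comparison factor 8 of
  \<open>L2R_of_L2w\<close>, which gives 7352.\<close>

lemma schur_complement_solution:
  assumes h: "h \<in> L2 w"
  shows "\<exists>f\<in>DS lam. (AE x in lborel. weak2 f x = Q x * f x - h x) \<and> f \<in> L2R \<and>
    (\<lambda>x. complex_of_real (x\<^sup>2) * f x) \<in> L2R \<and> weak2 f \<in> borel_measurable borel \<and>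
    (L2R_norm f)\<^sup>2 + (L2R_norm (\<lambda>x. complex_of_real (x\<^sup>2) * f x))\<^sup>2 \<le> 7352 * (L2_norm w h)\<^sup>2"
proof -
  obtain f f1 where f: "prim f1 f" "prim (\<lambda>x. Q x * f x - h x) f1" "integrable lborel (total_energy f f1)"
    "(\<integral>x. total_energy f f1 x \<partial>lborel) \<le> 919 * (L2_norm w h)\<^sup>2"
    using weighted_solution_exists[OF h] by blast
  note E = total_energy_L2[OF prim_continuous[OF f(1)] prim_continuous[OF f(2)] f(3)]
  have "(\<lambda>x. 3 * f x + (- \<i> / 3) * (complex_of_real (q x) * f x) - h x) \<in> L2 w"
    by (intro L2_add L2_diff L2_cmult E h weight_w)
  moreover have "3 * f x + (- \<i> / 3) * (complex_of_real (q x) * f x) - h x = Q x * f x - h x" for x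
    by (simp add: Q_def algebra_simps)
  ultimately have f2: "(\<lambda>x. Q x * f x - h x) \<in> L2 w" by simp
  have fm: "f \<in> borel_measurable borel" by (rule prim_measurable[OF f(1)])
  have fDS: "f \<in> DS lam"
    by (rule DS_I[OF fm _ f(1,2) E(1,2) f2 E(3)]) simp
  note w2 = weak2_of_prim[OF fm _ f(1,2)]
  have "(L2R_norm f)\<^sup>2 + (L2R_norm (\<lambda>x. complex_of_real (x\<^sup>2) * f x))\<^sup>2 \<le> 8 * (919 * (L2_norm w h)\<^sup>2)"
    by (rule order_trans[OF L2R_of_L2w(3)[OF E(1,3)]]) (intro mult_left_mono order_trans[OF E(4) f(4)], simp)
  then show ?thesis
    using fDS w2 L2R_of_L2w(1,2)[OF E(1,3)] by (intro bexI[of _ f]) auto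
qed

text \<open>From w + (sinh x)^2 w = 1 both summands are at most 1, so neither \<open>h1\<close> nor
  sinh x h2 loses anything but a constant in the weighted norm.\<close>

lemma weighted_rhs:
  assumes "h1 \<in> L2R" "h2 \<in> L2R"
  shows "(\<lambda>x. h1 x - \<i> / 3 * (complex_of_real (sinh x) * h2 x)) \<in> L2 w"
    "(L2_norm w (\<lambda>x. h1 x - \<i> / 3 * (complex_of_real (sinh x) * h2 x)))\<^sup>2 \<le> 2 * (L2R_norm h1)\<^sup>2 + 2 * (L2R_norm h2)\<^sup>2"
proof -
  let ?h = "\<lambda>x. h1 x - \<i> / 3 * (complex_of_real (sinh x) * h2 x)"
  note [measurable] = assms[THEN L2_measurable]
  have [measurable]: "(\<lambda>x::real. complex_of_real (sinh x)) \<in> borel_measurable borel"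
    by (intro borel_measurable_continuous_onI continuous_intros)
  let ?k = "\<lambda>x. 2 * ((cmod (h1 x))\<^sup>2 * 1) + 2 * ((cmod (h2 x))\<^sup>2 * 1)"
  have k: "integrable lborel ?k"
    by (intro Bochner_Integration.integrable_add integrable_mult_right assms[THEN L2_integrable])
  have b: "(cmod (?h x))\<^sup>2 * w x \<le> ?k x" for x
  proof -
    have ws: "w x + (sinh x)\<^sup>2 * w x = 1"
      using w_cosh[of x] by (simp add: cosh_square_real algebra_simps)
    have "0 \<le> (sinh x)\<^sup>2 * w x" using w_pos[of x] by simp
    with ws have w1: "w x \<le> 1" "(sinh x)\<^sup>2 * w x \<le> 1" using w_pos[of x] by linarith+
    have "(cmod (?h x))\<^sup>2 \<le> 2 * (cmod (h1 x))\<^sup>2 + 2 * (cmod (\<i> / 3 * (complex_of_real (sinh x) * h2 x)))\<^sup>2"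
      using cmod_add_square_le[of "h1 x" "- (\<i> / 3 * (complex_of_real (sinh x) * h2 x))"] by simp
    also have "\<dots> \<le> 2 * (cmod (h1 x))\<^sup>2 + 2 * ((sinh x)\<^sup>2 * (cmod (h2 x))\<^sup>2)"
      by (simp add: norm_mult norm_divide power_mult_distrib power_divide)
    finally have "(cmod (?h x))\<^sup>2 * w x \<le> (2 * (cmod (h1 x))\<^sup>2 + 2 * ((sinh x)\<^sup>2 * (cmod (h2 x))\<^sup>2)) * w x"
      by (rule mult_right_mono[OF _ less_imp_le[OF w_pos]])
    also have "\<dots> = 2 * ((cmod (h1 x))\<^sup>2 * w x) + 2 * ((cmod (h2 x))\<^sup>2 * ((sinh x)\<^sup>2 * w x))"
      by (simp add: algebra_simps)
    also have "\<dots> \<le> ?k x"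
      by (intro add_mono mult_left_mono w1) auto
    finally show ?thesis .
  qed
  show L: "?h \<in> L2 w"
    by (rule L2_dominated[OF weight_w _ k AE_I2[OF b]]) measurable
  have "(L2_norm w ?h)\<^sup>2 \<le> (\<integral>x. ?k x \<partial>lborel)"
    unfolding L2_norm_square[OF weight_w] by (rule integral_mono[OF L2_integrable[OF L] k b])
  also have "\<dots> = 2 * (L2R_norm h1)\<^sup>2 + 2 * (L2R_norm h2)\<^sup>2"
    unfolding L2_norm_square[OF weight_one]
    by (subst Bochner_Integration.integral_add[OF integrable_mult_right integrable_mult_right])
      (use assms[THEN L2_integrable] in auto)
  finally show "(L2_norm w ?h)\<^sup>2 \<le> 2 * (L2R_norm h1)\<^sup>2 + 2 * (L2R_norm h2)\<^sup>2" .
qed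

section \<open>The product space modulo null functions\<close>

abbreviation pair_space :: "(cfun \<times> cfun) set" where
  "pair_space \<equiv> L2R \<times> L2R"

abbreviation pair_norm :: "cfun \<times> cfun \<Rightarrow> real" where
  "pair_norm \<equiv> dsum_norm L2R_norm L2R_norm"

text \<open>On \<open>pair_space\<close> this is equality modulo the null space of
  \<open>pair_norm\<close>, see \<open>pair_norm_diff_eq_0_iff\<close>, in a form that admits
  pointwise algebra.\<close>

definition AE_eq :: "cfun \<times> cfun \<Rightarrow> cfun \<times> cfun \<Rightarrow> bool" where
  "AE_eq p r \<longleftrightarrow> (AE x in lborel. fst p x = fst r x \<and> snd p x = snd r x)"

lemma pair_scale_apply [simp]: "fst (pair_scale c p) x = c * fst p x" "snd (pair_scale c p) x = c * snd p x"
  by (simp_all add: pair_scale_def)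

lemma fst_snd_pair_scale: "fst (pair_scale c p) = (\<lambda>x. c * fst p x)" "snd (pair_scale c p) = (\<lambda>x. c * snd p x)"
  by (simp_all add: pair_scale_def)

lemma A_apply:
  "fst (A p) x = - weak2 (fst p) x + \<i> * complex_of_real (sinh x) * snd p x"
  "snd (A p) x = complex_of_real (x\<^sup>2) * fst p x"
  by (cases p; simp add: A_def)+

lemma pair_space_closed:
  assumes "p \<in> pair_space" "r \<in> pair_space"
  shows "p + r \<in> pair_space" "p - r \<in> pair_space" "pair_scale c p \<in> pair_space"
proof -
  have L: "fst p \<in> L2R" "snd p \<in> L2R" "fst r \<in> L2R" "snd r \<in> L2R" using assms by auto
  have "fst (p + r) = (\<lambda>x. fst p x + fst r x)" "snd (p + r) = (\<lambda>x. snd p x + snd r x)"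
    "fst (p - r) = (\<lambda>x. fst p x - fst r x)" "snd (p - r) = (\<lambda>x. snd p x - snd r x)"
    by (simp_all add: fun_eq_iff)
  then show "p + r \<in> pair_space" "p - r \<in> pair_space" "pair_scale c p \<in> pair_space"
    using L2_add[OF weight_one L(1,3)] L2_add[OF weight_one L(2,4)]
      L2_diff[OF weight_one L(1,3)] L2_diff[OF weight_one L(2,4)] L2_cmult[OF L(1), of c] L2_cmult[OF L(2), of c]
    by (simp_all add: mem_Times_iff fst_snd_pair_scale)
qed

lemma pair_norm_square: "(pair_norm p)\<^sup>2 = (L2R_norm (fst p))\<^sup>2 + (L2R_norm (snd p))\<^sup>2"
  by (simp add: dsum_norm_def)

lemma pair_norm_nonneg: "0 \<le> pair_norm p"
  by (simp add: dsum_norm_def)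

lemma pair_norm_add_square:
  assumes "p \<in> pair_space" "r \<in> pair_space"
  shows "(pair_norm (p + r))\<^sup>2 \<le> 2 * (pair_norm p)\<^sup>2 + 2 * (pair_norm r)\<^sup>2"
proof -
  have L: "fst p \<in> L2R" "snd p \<in> L2R" "fst r \<in> L2R" "snd r \<in> L2R" using assms by auto
  have "fst (p + r) = (\<lambda>x. fst p x + fst r x)" "snd (p + r) = (\<lambda>x. snd p x + snd r x)"
    by (simp_all add: fun_eq_iff)
  then show ?thesis
    using L2_norm_add_square[OF weight_one L(1,3)] L2_norm_add_square[OF weight_one L(2,4)]
    unfolding pair_norm_square distrib_left by simp
qed

lemma pair_norm_scale: "pair_norm (pair_scale c p) = cmod c * pair_norm p"
proof (rule power2_eq_imp_eq)
  show "(pair_norm (pair_scale c p))\<^sup>2 = (cmod c * pair_norm p)\<^sup>2"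
    unfolding pair_norm_square power_mult_distrib fst_snd_pair_scale L2_norm_cmult by (simp add: distrib_left)
qed (simp_all add: pair_norm_nonneg)

lemma pair_norm_diff_commute: "pair_norm (p - r) = pair_norm (r - p)"
proof -
  have "p - r = pair_scale (- 1) (r - p)"
    by (simp add: prod_eq_iff fun_eq_iff)
  then show ?thesis by (simp add: pair_norm_scale)
qed

lemma pair_norm_AE_eq:
  assumes "p \<in> pair_space" "r \<in> pair_space" "AE_eq p r"
  shows "pair_norm p = pair_norm r"
proof -
  have "L2R_norm (fst p) = L2R_norm (fst r)"
    by (rule L2_norm_AE_cong[OF weight_one]) (use assms in \<open>auto intro: L2_measurable simp: AE_eq_def\<close>)
  moreover have "L2R_norm (snd p) = L2R_norm (snd r)"
    by (rule L2_norm_AE_cong[OF weight_one]) (use assms in \<open>auto intro: L2_measurable simp: AE_eq_def\<close>)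
  ultimately show ?thesis by (simp add: dsum_norm_def)
qed

lemma pair_norm_diff_eq_0_iff:
  assumes "p \<in> pair_space" "r \<in> pair_space"
  shows "pair_norm (p - r) = 0 \<longleftrightarrow> AE_eq p r"
proof -
  have d: "p - r \<in> pair_space" by (rule pair_space_closed[OF assms])
  have "pair_norm (p - r) = 0 \<longleftrightarrow> L2R_norm (fst (p - r)) = 0 \<and> L2R_norm (snd (p - r)) = 0"
    by (simp add: dsum_norm_def real_sqrt_eq_0_iff sum_power2_eq_zero_iff)
  also have "\<dots> \<longleftrightarrow> (AE x in lborel. fst (p - r) x = 0) \<and> (AE x in lborel. snd (p - r) x = 0)"
    using d L2_norm_eq_0_iff[OF weight_one, of "fst (p - r)"] L2_norm_eq_0_iff[OF weight_one, of "snd (p - r)"]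
    by (simp only: mem_Times_iff)
  also have "\<dots> \<longleftrightarrow> AE_eq p r"
    by (simp add: AE_eq_def)
  finally show ?thesis .
qed

lemma DS_L2R:
  assumes "f \<in> DS lam"
  shows "f \<in> L2R" "(\<lambda>x. complex_of_real (x\<^sup>2) * f x) \<in> L2R" "weak2 f \<in> borel_measurable borel"
proof -
  have "f \<in> L2 w" "(\<lambda>x. complex_of_real (q x) * f x) \<in> L2 w"
    using assms by (auto simp: DS_def Vw0_def Vw_def q_def)
  from L2R_of_L2w(1,2)[OF this] show "f \<in> L2R" "(\<lambda>x. complex_of_real (x\<^sup>2) * f x) \<in> L2R" .
  show "weak2 f \<in> borel_measurable borel"
    using DS_D(2)[OF assms] L2_measurable by blast
qed

lemma DomA_iff: "p \<in> DomA lam \<longleftrightarrow> fst p \<in> DS lam \<and> snd p \<in> L2R \<and> fst (A p) \<in> L2R"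
  by (cases p) (simp add: DomA_def A_def)

lemma DomA_pair_space:
  assumes "p \<in> DomA lam"
  shows "p \<in> pair_space" "A p \<in> pair_space"
proof -
  have "fst p \<in> L2R" "snd p \<in> L2R" "fst (A p) \<in> L2R" "snd (A p) \<in> L2R"
    using assms DS_L2R[of "fst p" lam] A_apply(2)[of p] by (auto simp: DomA_iff A_def split: prod.splits)
  then show "p \<in> pair_space" "A p \<in> pair_space" by (simp_all add: mem_Times_iff)
qed

text \<open>The domain and the action respect null sets. Closedness relies on this: there the limit
  is identified with an element of the domain only almost everywhere.\<close>

lemma DomA_AE_eq:
  assumes "p \<in> DomA lam" "r \<in> pair_space" "AE_eq r p"
  shows "r \<in> DomA lam" "AE_eq (A r) (A p)"
proof -
  have m: "fst r \<in> borel_measurable borel" "snd r \<in> borel_measurable borel"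
    using assms(2) L2_measurable by auto
  have "AE x in lborel. fst r x = fst p x"
    using assms(3) unfolding AE_eq_def by eventually_elim simp
  note c = DS_AE_cong[OF _ m(1) this, of lam]
  have p: "fst p \<in> DS lam" using assms(1) by (simp add: DomA_iff)
  show e: "AE_eq (A r) (A p)"
    using assms(3) c(2)[OF p] unfolding AE_eq_def A_apply by eventually_elim simp
  have [measurable]: "(\<lambda>x::real. complex_of_real (sinh x)) \<in> borel_measurable borel"
    by (intro borel_measurable_continuous_onI continuous_intros)
  note [measurable] = m DS_L2R(3)[OF c(1)[OF p]]
  have "(\<lambda>x. - weak2 (fst r) x + \<i> * complex_of_real (sinh x) * snd r x) \<in> borel_measurable borel" by measurable
  moreover have "fst (A r) = (\<lambda>x. - weak2 (fst r) x + \<i> * complex_of_real (sinh x) * snd r x)"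
    by (simp add: fun_eq_iff A_apply)
  ultimately have mA: "fst (A r) \<in> borel_measurable borel" by (simp only:)
  have "AE x in lborel. fst (A r) x = fst (A p) x"
    using e unfolding AE_eq_def by eventually_elim simp
  moreover have "fst (A p) \<in> L2R" using assms(1) by (simp add: DomA_iff)
  ultimately have "fst (A r) \<in> L2R"
    by (intro L2_AE_cong[OF weight_one mA])
  then show "r \<in> DomA lam" using c(1)[OF p] assms(2) by (auto simp: DomA_iff)
qed

lemma DomA_lincomb:
  assumes "p \<in> DomA lam" "r \<in> DomA lam"
  shows "pair_scale a p + pair_scale b r \<in> DomA lam"
    "AE_eq (A (pair_scale a p + pair_scale b r)) (pair_scale a (A p) + pair_scale b (A r))"
proof -
  let ?s = "pair_scale a p + pair_scale b r" and ?T = "pair_scale a (A p) + pair_scale b (A r)"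
  have "fst ?s = (\<lambda>x. a * fst p x + b * fst r x)" by (simp add: fun_eq_iff)
  then have DS: "fst ?s \<in> DS lam" "AE x in lborel. weak2 (fst ?s) x = a * weak2 (fst p) x + b * weak2 (fst r) x"
    using DS_lincomb[of "fst p" lam "fst r" a b] assms by (simp_all add: DomA_iff)
  show e: "AE_eq (A ?s) ?T"
    using DS(2) unfolding AE_eq_def by eventually_elim (simp add: A_apply algebra_simps)
  note pH = DomA_pair_space[OF assms(1)] and rH = DomA_pair_space[OF assms(2)]
  have sH: "?s \<in> pair_space"
    by (intro pair_space_closed(1) pair_space_closed(3)[OF pH(1) pH(1)] pair_space_closed(3)[OF rH(1) rH(1)])
  have TH: "?T \<in> pair_space"
    by (intro pair_space_closed(1) pair_space_closed(3)[OF pH(2) pH(2)] pair_space_closed(3)[OF rH(2) rH(2)])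
  have [measurable]: "(\<lambda>x::real. complex_of_real (sinh x)) \<in> borel_measurable borel"
    by (intro borel_measurable_continuous_onI continuous_intros)
  have [measurable]: "snd ?s \<in> borel_measurable borel"
    by (rule L2_measurable[where \<rho> = "\<lambda>_. 1"]) (use sH in \<open>simp only: mem_Times_iff\<close>)
  note [measurable] = DS_L2R(3)[OF DS(1)]
  have "(\<lambda>x. - weak2 (fst ?s) x + \<i> * complex_of_real (sinh x) * snd ?s x) \<in> borel_measurable borel" by measurable
  moreover have "fst (A ?s) = (\<lambda>x. - weak2 (fst ?s) x + \<i> * complex_of_real (sinh x) * snd ?s x)"
    by (rule ext) (rule A_apply(1))
  ultimately have "fst (A ?s) \<in> borel_measurable borel" by (simp only:)
  moreover have "AE x in lborel. fst (A ?s) x = fst ?T x"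
    using e unfolding AE_eq_def by eventually_elim simp
  ultimately have "fst (A ?s) \<in> L2R"
    using L2_AE_cong[OF weight_one, of "fst (A ?s)" "fst ?T"] TH by (simp only: mem_Times_iff)
  then show "?s \<in> DomA lam" using DS(1) sH by (simp only: DomA_iff mem_Times_iff)
qed

text \<open>The second row forces g = (h2 - x^2 f) / 3, and inserting this into the first leaves the
  Schur complement equation. The two terms of -f'' + i sinh x g need not be in L2(R) separately;
  their sum is, because it equals h1 - 3 f.\<close>

lemma resolvent_equation_solvable:
  assumes p: "p \<in> pair_space"
  shows "\<exists>r\<in>DomA lam. AE_eq (A r - pair_scale (- 3) r) p \<and> pair_norm r \<le> 122 * pair_norm p"
proof -
  let ?h1 = "fst p" and ?h2 = "snd p"
  have L: "?h1 \<in> L2R" "?h2 \<in> L2R" using p by auto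
  let ?h = "\<lambda>x. ?h1 x - \<i> / 3 * (complex_of_real (sinh x) * ?h2 x)"
  note h = weighted_rhs[OF L]
  obtain f where f: "f \<in> DS lam" "AE x in lborel. weak2 f x = Q x * f x - ?h x" "f \<in> L2R"
    "(\<lambda>x. complex_of_real (x\<^sup>2) * f x) \<in> L2R" "weak2 f \<in> borel_measurable borel"
    "(L2R_norm f)\<^sup>2 + (L2R_norm (\<lambda>x. complex_of_real (x\<^sup>2) * f x))\<^sup>2 \<le> 7352 * (L2_norm w ?h)\<^sup>2"
    using schur_complement_solution[OF h(1)] by blast
  define g where "g x = (1/3) * (?h2 x - complex_of_real (x\<^sup>2) * f x)" for x
  let ?r = "(f, g)"
  have gL: "g \<in> L2R" unfolding g_def[abs_def] by (intro L2_cmult L2_diff weight_one L f)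
  have ae: "AE x in lborel. fst (A ?r) x = ?h1 x + (- 3) * f x"
    using f(2)
  proof eventually_elim
    case (elim x)
    show ?case unfolding A_apply fst_conv snd_conv elim g_def Q_def q_def by (simp add: field_simps)
  qed
  have [measurable]: "(\<lambda>x::real. complex_of_real (sinh x)) \<in> borel_measurable borel"
    by (intro borel_measurable_continuous_onI continuous_intros)
  note [measurable] = f(5) L2_measurable[OF gL]
  have "(\<lambda>x. - weak2 f x + \<i> * complex_of_real (sinh x) * g x) \<in> borel_measurable borel" by measurable
  then have "fst (A ?r) \<in> borel_measurable borel" by (simp add: A_def)
  then have "fst (A ?r) \<in> L2R"
    by (rule L2_AE_cong[OF weight_one _ L2_add[OF weight_one L(1) L2_cmult[OF f(3)]] ae])
  then have rD: "?r \<in> DomA lam" using f(1) gL by (simp add: DomA_iff)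
  have "AE_eq (A ?r - pair_scale (- 3) ?r) p"
    using ae unfolding AE_eq_def
  proof eventually_elim
    case (elim x)
    then show ?case by (simp add: A_apply(2) g_def field_simps)
  qed
  moreover have "pair_norm ?r \<le> 122 * pair_norm p"
  proof (rule power2_le_imp_le)
    have "L2R_norm g = 1/3 * L2R_norm (\<lambda>x. ?h2 x - complex_of_real (x\<^sup>2) * f x)"
      unfolding g_def[abs_def] L2_norm_cmult by simp
    then have "(L2R_norm g)\<^sup>2 = 1/9 * (L2R_norm (\<lambda>x. ?h2 x - complex_of_real (x\<^sup>2) * f x))\<^sup>2"
      by (simp only: power_mult_distrib) (simp add: power_divide)
    then have "(L2R_norm g)\<^sup>2 \<le> 1/9 * (2 * (L2R_norm ?h2)\<^sup>2 + 2 * (L2R_norm (\<lambda>x. complex_of_real (x\<^sup>2) * f x))\<^sup>2)"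
      using L2_norm_diff_square[OF weight_one L(2) f(4)] unfolding distrib_left by linarith
    then have "(pair_norm ?r)\<^sup>2 \<le> (L2R_norm f)\<^sup>2 + (L2R_norm ?h2)\<^sup>2 + (L2R_norm (\<lambda>x. complex_of_real (x\<^sup>2) * f x))\<^sup>2"
      unfolding pair_norm_square fst_conv snd_conv distrib_left
      using zero_le_power2[of "L2R_norm ?h2"] zero_le_power2[of "L2R_norm (\<lambda>x. complex_of_real (x\<^sup>2) * f x)"] by linarith
    \<comment> \<open>Twice 7352 comes from the bound on f and x^2 f through
      \<open>weighted_rhs\<close>, and 1 from the share of \<open>h2\<close> in g; moreover 14705 is
      below the square of 122.\<close>
    also have "\<dots> \<le> 14705 * (pair_norm p)\<^sup>2"
      using f(6) h(2) zero_le_power2[of "L2R_norm ?h1"] unfolding pair_norm_square distrib_left by linarith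
    also have "\<dots> \<le> (122 * pair_norm p)\<^sup>2"
      by (simp add: power_mult_distrib)
    finally show "(pair_norm ?r)\<^sup>2 \<le> (122 * pair_norm p)\<^sup>2" .
  qed (simp add: pair_norm_nonneg)
  ultimately show ?thesis using rD by blast
qed

text \<open>Eliminating the second component as in the solvability proof leaves f'' = Q f with
  weighted square integrable data, which \<open>homogeneous_L2w_trivial\<close> excludes unless f
  vanishes; then g vanishes with it.\<close>

lemma resolvent_equation_injective:
  assumes p: "p \<in> DomA lam" and z: "AE_eq (A p - pair_scale (- 3) p) 0"
  shows "AE_eq p 0"
proof -
  let ?f = "fst p"
  obtain F F1 where F: "AE x in lborel. ?f x = F x" "prim F1 F" "prim (weak2 ?f) F1" "F \<in> L2 w" "F1 \<in> L2 w"
    "weak2 ?f \<in> L2 w" "(\<lambda>x. complex_of_real (q x) * F x) \<in> L2 w"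
    using DS_D(2)[of ?f lam] p by (auto simp: DomA_iff)
  have g: "AE x in lborel. snd p x = - (1/3) * (complex_of_real (x\<^sup>2) * ?f x)"
    using z unfolding AE_eq_def
  proof eventually_elim
    case (elim x)
    then have "complex_of_real (x\<^sup>2) * ?f x + 3 * snd p x = 0" by (simp add: A_apply)
    then show ?case by (simp add: field_simps add_eq_0_iff)
  qed
  have "AE x in lborel. weak2 ?f x = Q x * F x"
    using z g F(1) unfolding AE_eq_def
  proof eventually_elim
    case (elim x)
    then have "- weak2 ?f x + \<i> * complex_of_real (sinh x) * snd p x + 3 * F x = 0"
      by (simp add: A_apply(1))
    then have "weak2 ?f x = \<i> * complex_of_real (sinh x) * snd p x + 3 * F x"
      by (simp add: algebra_simps add_eq_0_iff)
    also have "\<dots> = Q x * F x"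
    proof -
      have s: "snd p x = - (1/3) * (complex_of_real (x\<^sup>2) * F x)" using elim by simp
      show ?thesis unfolding s Q_def q_def by (simp add: algebra_simps)
    qed
    finally show ?case .
  qed
  then have "AE x in lborel. F x = 0"
    by (rule homogeneous_L2w_trivial[OF F(2,3) _ F(4,5,6)])
  then show ?thesis
    using F(1) g unfolding AE_eq_def by eventually_elim simp
qed

section \<open>Closedness and density\<close>

lemma linear_A: "linear_operator pair_scale pair_space pair_norm (DomA lam) A"
  unfolding linear_operator_def
proof (intro conjI ballI allI)
  show "DomA lam \<subseteq> pair_space" using DomA_pair_space(1) by blast
  show "A ` DomA lam \<subseteq> pair_space" using DomA_pair_space(2) by blast
  have "0 \<in> pair_space"
    using L2_zero[of "\<lambda>_. 1"] by (simp add: mem_Times_iff zero_fun_def)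
  \<comment> \<open>The zero pair enters as 0 times some element of the domain; one exists because
    the resolvent equation is solvable.\<close>
  then obtain r where r: "r \<in> DomA lam" using resolvent_equation_solvable by blast
  have "pair_scale 0 r + pair_scale 0 r = 0"
    by (simp add: prod_eq_iff fun_eq_iff)
  with DomA_lincomb(1)[OF r r, of 0 0] show "0 \<in> DomA lam" by simp
next
  fix p r assume p: "p \<in> DomA lam" and r: "r \<in> DomA lam"
  have eq: "pair_scale 1 s + pair_scale 1 t = s + t" for s t
    by (simp add: prod_eq_iff fun_eq_iff)
  note c = DomA_lincomb[OF p r, of 1 1, unfolded eq]
  show "p + r \<in> DomA lam" by (rule c(1))
  show "pair_norm (A (p + r) - (A p + A r)) = 0"
    using c(2) pair_norm_diff_eq_0_iff[OF DomA_pair_space(2)[OF c(1)]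
      pair_space_closed(1)[OF DomA_pair_space(2)[OF p] DomA_pair_space(2)[OF r]]] by blast
next
  fix c p assume p: "p \<in> DomA lam"
  have eq: "pair_scale c s + pair_scale 0 s = pair_scale c s" for s
    by (simp add: prod_eq_iff fun_eq_iff)
  note l = DomA_lincomb[OF p p, of c 0, unfolded eq]
  show "pair_scale c p \<in> DomA lam" by (rule l(1))
  note pA = DomA_pair_space(2)[OF p]
  show "pair_norm (A (pair_scale c p) - pair_scale c (A p)) = 0"
    using l(2) pair_norm_diff_eq_0_iff[OF DomA_pair_space(2)[OF l(1)] pair_space_closed(3)[OF pA pA]] by blast
qed

lemma DomA_diff:
  assumes "p \<in> DomA lam" "r \<in> DomA lam"
  shows "p - r \<in> DomA lam" "AE_eq (A (p - r)) (A p - A r)"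
proof -
  have eq: "pair_scale 1 s + pair_scale (- 1) t = s - t" for s t
    by (simp add: prod_eq_iff fun_eq_iff)
  show "p - r \<in> DomA lam" "AE_eq (A (p - r)) (A p - A r)"
    using DomA_lincomb[OF assms, of 1 "- 1"] unfolding eq by auto
qed

lemma shifted_A_injective:
  assumes "p \<in> DomA lam" "r \<in> DomA lam"
    and "AE_eq (A r - pair_scale (- 3) r) (A p - pair_scale (- 3) p)"
  shows "AE_eq p r"
proof -
  note d = DomA_diff[OF assms(1,2)]
  have aux: "a - b = 3 * t - 3 * s" if "b + 3 * t = a + 3 * s" for a b s t :: complex
  proof -
    have "a - b = (a + 3 * s) - (b + 3 * t) + (3 * t - 3 * s)" by simp
    then show ?thesis unfolding that by simp
  qed
  have "AE_eq (A (p - r) - pair_scale (- 3) (p - r)) 0"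
    using d(2) assms(3) unfolding AE_eq_def
  proof eventually_elim
    case (elim x)
    then show ?case
      using aux[of "fst (A r) x" "fst r x" "fst (A p) x" "fst p x"]
        aux[of "snd (A r) x" "snd r x" "snd (A p) x" "snd p x"] by simp
  qed
  from resolvent_equation_injective[OF d(1) this] show ?thesis
    unfolding AE_eq_def by eventually_elim simp
qed

text \<open>The estimate is known for the constructed solution of the resolvent equation, and
  injectivity identifies that solution with \<open>p\<close> up to null sets.\<close>

lemma shifted_A_bounded_below:
  assumes p: "p \<in> DomA lam"
  shows "pair_norm p \<le> 122 * pair_norm (A p - pair_scale (- 3) p)"
proof -
  note pH = DomA_pair_space[OF p]
  let ?y = "A p - pair_scale (- 3) p"
  have y: "?y \<in> pair_space" by (rule pair_space_closed(2)[OF pH(2) pair_space_closed(3)[OF pH(1) pH(1)]])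
  obtain r where r: "r \<in> DomA lam" "AE_eq (A r - pair_scale (- 3) r) ?y" "pair_norm r \<le> 122 * pair_norm ?y"
    using resolvent_equation_solvable[OF y] by blast
  from shifted_A_injective[OF p r(1,2)] have "pair_norm p = pair_norm r"
    by (rule pair_norm_AE_eq[OF pH(1) DomA_pair_space(1)[OF r(1)]])
  with r(3) show ?thesis by simp
qed

lemma resolvent_A: "- 3 \<in> resolvent_set pair_scale pair_space pair_norm (DomA lam) A"
proof -
  define R where "R y = (SOME r. r \<in> DomA lam \<and> AE_eq (A r - pair_scale (- 3) r) y \<and> pair_norm r \<le> 122 * pair_norm y)" for y
  have R: "R y \<in> DomA lam" "AE_eq (A (R y) - pair_scale (- 3) (R y)) y" "pair_norm (R y) \<le> 122 * pair_norm y"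
    if "y \<in> pair_space" for y
  proof -
    have "\<exists>r. r \<in> DomA lam \<and> AE_eq (A r - pair_scale (- 3) r) y \<and> pair_norm r \<le> 122 * pair_norm y"
      using resolvent_equation_solvable[OF that, of lam] by blast
    then have "R y \<in> DomA lam \<and> AE_eq (A (R y) - pair_scale (- 3) (R y)) y \<and> pair_norm (R y) \<le> 122 * pair_norm y"
      unfolding R_def by (rule someI_ex)
    then show "R y \<in> DomA lam" "AE_eq (A (R y) - pair_scale (- 3) (R y)) y" "pair_norm (R y) \<le> 122 * pair_norm y"
      by auto
  qed
  have S: "A p - pair_scale (- 3) p \<in> pair_space" if "p \<in> DomA lam" for p
    by (intro pair_space_closed(2) pair_space_closed(3)[OF DomA_pair_space(1)[OF that] DomA_pair_space(1)[OF that]]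
      DomA_pair_space(2)[OF that])
  have right: "pair_norm (A (R y) - pair_scale (- 3) (R y) - y) = 0" if "y \<in> pair_space" for y
    using pair_norm_diff_eq_0_iff[OF S[OF R(1)[OF that]] that] R(2)[OF that] by blast
  have left: "pair_norm (R (A p - pair_scale (- 3) p) - p) = 0" if p: "p \<in> DomA lam" for p
  proof -
    let ?r = "R (A p - pair_scale (- 3) p)"
    note r = R[OF S[OF p]]
    from shifted_A_injective[OF p r(1,2)] have "AE_eq ?r p"
      unfolding AE_eq_def by eventually_elim simp
    then show ?thesis
      using pair_norm_diff_eq_0_iff[OF DomA_pair_space(1)[OF r(1)] DomA_pair_space(1)[OF p]] by blast
  qed
  show ?thesis
    unfolding resolvent_set_def
  proof (intro CollectI exI[of _ R] conjI ballI)
    show "\<exists>C. \<forall>y\<in>pair_space. pair_norm (R y) \<le> C * pair_norm y"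
      by (rule exI[of _ 122]) (intro ballI R(3))
  qed (fact R(1) right left)+
qed

text \<open>A bounded inverse of A + 3 makes \<open>A\<close> closed: let r in the domain solve (A +
  3) r = v + 3 u. The lower bound applied to p n - r shows that \<open>p n\<close> tends to r, so u
  = r up to null sets, and the equation for r then reads A u = v.\<close>

lemma closed_A: "closed_operator pair_scale pair_space pair_norm (DomA lam) A"
  unfolding closed_operator_def
proof (intro conjI linear_A allI impI)
  fix p u v
  assume p: "\<forall>n::nat. p n \<in> DomA lam" and u: "u \<in> pair_space" and v: "v \<in> pair_space"
    and pu: "(\<lambda>n. pair_norm (p n - u)) \<longlonglongrightarrow> 0" and Av: "(\<lambda>n. pair_norm (A (p n) - v)) \<longlonglongrightarrow> 0"
  let ?y = "v - pair_scale (- 3) u"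
  have y: "?y \<in> pair_space" by (rule pair_space_closed(2)[OF v pair_space_closed(3)[OF u u]])
  obtain r where r: "r \<in> DomA lam" "AE_eq (A r - pair_scale (- 3) r) ?y"
    using resolvent_equation_solvable[OF y] by blast
  \<comment> \<open>Squares are kept throughout because the triangle inequality is used in the form
    of \<open>pair_norm_add_square\<close>.\<close>
  have b1: "(pair_norm (p n - r))\<^sup>2 \<le> 122\<^sup>2 * (2 * (pair_norm (A (p n) - v))\<^sup>2 + 2 * (3 * pair_norm (p n - u))\<^sup>2)" for n
  proof -
    have pn: "p n \<in> DomA lam" using p by blast
    note pH = DomA_pair_space[OF pn]
    note d = DomA_diff[OF pn r(1)]
    let ?s = "A (p n - r) - pair_scale (- 3) (p n - r)"
    let ?a = "A (p n) - v" and ?b = "pair_scale 3 (p n - u)"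
    have aH: "?a \<in> pair_space" by (rule pair_space_closed(2)[OF pH(2) v])
    have cH: "p n - u \<in> pair_space" by (rule pair_space_closed(2)[OF pH(1) u])
    have bH: "?b \<in> pair_space" by (rule pair_space_closed(3)[OF cH cH])
    note dH = DomA_pair_space[OF d(1)]
    have sH: "?s \<in> pair_space" by (rule pair_space_closed(2)[OF dH(2) pair_space_closed(3)[OF dH(1) dH(1)]])
    have "AE_eq ?s (?a + ?b)"
      using d(2) r(2) unfolding AE_eq_def
    proof eventually_elim
      case (elim x)
      have "fst (A r) x = fst v x + 3 * fst u x - 3 * fst r x" "snd (A r) x = snd v x + 3 * snd u x - 3 * snd r x"
        using elim(2) by (simp_all add: algebra_simps)
      with elim(1) have "fst (A (p n - r)) x = fst (A (p n)) x - (fst v x + 3 * fst u x - 3 * fst r x)"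
        "snd (A (p n - r)) x = snd (A (p n)) x - (snd v x + 3 * snd u x - 3 * snd r x)"
        by simp_all
      then show ?case by (simp add: algebra_simps)
    qed
    then have "pair_norm ?s = pair_norm (?a + ?b)"
      by (rule pair_norm_AE_eq[OF sH pair_space_closed(1)[OF aH bH]])
    then have s: "(pair_norm ?s)\<^sup>2 \<le> 2 * (pair_norm ?a)\<^sup>2 + 2 * (3 * pair_norm (p n - u))\<^sup>2"
      using pair_norm_add_square[OF aH bH] by (simp add: pair_norm_scale)
    have "(pair_norm (p n - r))\<^sup>2 \<le> (122 * pair_norm ?s)\<^sup>2"
      by (rule power_mono[OF shifted_A_bounded_below[OF d(1)] pair_norm_nonneg])
    also have "\<dots> = 122\<^sup>2 * (pair_norm ?s)\<^sup>2" by (rule power_mult_distrib)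
    also have "\<dots> \<le> 122\<^sup>2 * (2 * (pair_norm ?a)\<^sup>2 + 2 * (3 * pair_norm (p n - u))\<^sup>2)"
      by (rule mult_left_mono[OF s]) simp
    finally show ?thesis .
  qed
  have b2: "(pair_norm (u - r))\<^sup>2 \<le> 2 * (pair_norm (p n - u))\<^sup>2
      + 2 * (122\<^sup>2 * (2 * (pair_norm (A (p n) - v))\<^sup>2 + 2 * (3 * pair_norm (p n - u))\<^sup>2))" for n
  proof -
    have pn: "p n \<in> DomA lam" using p by blast
    have eq: "u - r = (u - p n) + (p n - r)" by simp
    have "(pair_norm (u - r))\<^sup>2 \<le> 2 * (pair_norm (u - p n))\<^sup>2 + 2 * (pair_norm (p n - r))\<^sup>2"
      unfolding eq by (rule pair_norm_add_square[OF pair_space_closed(2)[OF u DomA_pair_space(1)[OF pn]]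
        pair_space_closed(2)[OF DomA_pair_space(1)[OF pn] DomA_pair_space(1)[OF r(1)]]])
    also have "pair_norm (u - p n) = pair_norm (p n - u)" by (rule pair_norm_diff_commute)
    finally show ?thesis using b1[of n] by linarith
  qed
  have "(\<lambda>n. 2 * (pair_norm (p n - u))\<^sup>2
      + 2 * (122\<^sup>2 * (2 * (pair_norm (A (p n) - v))\<^sup>2 + 2 * (3 * pair_norm (p n - u))\<^sup>2)))
    \<longlonglongrightarrow> 2 * 0\<^sup>2 + 2 * (122\<^sup>2 * (2 * 0\<^sup>2 + 2 * (3 * 0)\<^sup>2))"
    by (intro tendsto_intros pu Av)
  then have "(pair_norm (u - r))\<^sup>2 \<le> 2 * 0\<^sup>2 + 2 * (122\<^sup>2 * (2 * 0\<^sup>2 + 2 * (3 * 0)\<^sup>2))"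
    by (rule LIMSEQ_le_const) (use b2 in blast)
  then have "pair_norm (u - r) = 0" by simp
  then have ur: "AE_eq u r" using pair_norm_diff_eq_0_iff[OF u DomA_pair_space(1)[OF r(1)]] by blast
  note uD = DomA_AE_eq[OF r(1) u ur]
  have "AE_eq (A u) v"
    using uD(2) r(2) ur unfolding AE_eq_def by eventually_elim simp
  then show "u \<in> DomA lam" "pair_norm (A u - v) = 0"
    using uD(1) pair_norm_diff_eq_0_iff[OF DomA_pair_space(2)[OF uD(1)] v] by auto
qed

text \<open>For such pairs both terms of -f'' + i sinh x g are square integrable on their own. These
  pairs already suffice for both density statements.\<close>

lemma cutoff_pair_DomA:
  assumes "f \<in> DS lam" "weak2 f \<in> L2R" "g \<in> L2R"
  shows "(f, \<lambda>x. indicator {- real n..real n} x * g x) \<in> DomA lam"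
  using assms L2_add[OF weight_one L2_minus[OF assms(2)] truncation_approx_L2R(3)[OF assms(3), of n]]
    truncation_approx_L2R(2)[OF assms(3), of n]
  by (simp add: DomA_def)

lemma DomA_dense_DS: "dense_in (dsum_norm DS_norm L2R_norm) (DomA lam) (DS lam \<times> L2R)"
  unfolding dense_in_def
proof (intro conjI ballI allI impI)
  show "DomA lam \<subseteq> DS lam \<times> L2R" by (auto simp: DomA_def)
  fix x :: "cfun \<times> cfun" and e :: real assume x: "x \<in> DS lam \<times> L2R" and e: "0 < e"
  obtain f g where fg: "x = (f, g)" "f \<in> DS lam" "g \<in> L2R" using x by blast
  let ?f = "\<lambda>n x. plateau n x * f x" and ?g = "\<lambda>n x. indicator {- real n..real n} x * g x"
  have eq: "dsum_norm DS_norm L2R_norm (x - (?f n, ?g n))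
      = sqrt ((DS_norm (\<lambda>x. f x - ?f n x))\<^sup>2 + (L2R_norm (\<lambda>x. g x - ?g n x))\<^sup>2)" for n
    unfolding fg dsum_norm_def by (simp add: fun_diff_def)
  have "(\<lambda>n. sqrt ((DS_norm (\<lambda>x. f x - ?f n x))\<^sup>2 + (L2R_norm (\<lambda>x. g x - ?g n x))\<^sup>2)) \<longlonglongrightarrow> sqrt (0\<^sup>2 + 0\<^sup>2)"
    by (intro tendsto_intros DS_cutoff(3)[OF fg(2)] truncation_approx_L2R(1)[OF fg(3)])
  then have "\<forall>\<^sub>F n in sequentially. sqrt ((DS_norm (\<lambda>x. f x - ?f n x))\<^sup>2 + (L2R_norm (\<lambda>x. g x - ?g n x))\<^sup>2) < e"
    by (rule order_tendstoD(2)) (use e in simp)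
  then obtain n where n: "sqrt ((DS_norm (\<lambda>x. f x - ?f n x))\<^sup>2 + (L2R_norm (\<lambda>x. g x - ?g n x))\<^sup>2) < e"
    by (auto simp: eventually_sequentially)
  have "(?f n, ?g n) \<in> DomA lam"
    by (rule cutoff_pair_DomA[OF DS_cutoff(1,2)[OF fg(2)] fg(3)])
  then show "\<exists>y\<in>DomA lam. dsum_norm DS_norm L2R_norm (x - y) < e"
    using n unfolding eq[symmetric] by blast
qed

lemma DomA_dense_L2: "dense_in pair_norm (DomA lam) pair_space"
  unfolding dense_in_def
proof (intro conjI ballI allI impI)
  show "DomA lam \<subseteq> pair_space" using DomA_pair_space(1) by blast
  fix x :: "cfun \<times> cfun" and e :: real assume x: "x \<in> pair_space" and e: "0 < e"
  obtain f g where fg: "x = (f, g)" "f \<in> L2R" "g \<in> L2R" using x by blast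
  have e2: "0 < e\<^sup>2 / 2" using e by simp
  obtain \<phi> where \<phi>: "\<phi> \<in> test_funs" "(L2R_norm (\<lambda>x. f x - \<phi> x))\<^sup>2 < e\<^sup>2 / 2"
    using test_funs_dense_L2R[OF fg(2) e2] by blast
  let ?g = "\<lambda>n x. indicator {- real n..real n} x * g x"
  have "(\<lambda>n. (L2R_norm (\<lambda>x. g x - ?g n x))\<^sup>2) \<longlonglongrightarrow> 0\<^sup>2"
    by (intro tendsto_intros truncation_approx_L2R(1)[OF fg(3)])
  then have "\<forall>\<^sub>F n in sequentially. (L2R_norm (\<lambda>x. g x - ?g n x))\<^sup>2 < e\<^sup>2 / 2"
    by (rule order_tendstoD(2)) (use e2 in simp)
  then obtain n where n: "(L2R_norm (\<lambda>x. g x - ?g n x))\<^sup>2 < e\<^sup>2 / 2"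
    by (auto simp: eventually_sequentially)
  note t = test_fun_DS[OF \<phi>(1)]
  have "weak2 \<phi> \<in> L2R"
    by (rule L2_AE_cong[OF weight_one t(3) test_fun_L2[OF test_fun_vderiv[OF test_fun_vderiv[OF \<phi>(1)]]
      weight_one continuous_on_const] t(2)])
  then have D: "(\<phi>, ?g n) \<in> DomA lam"
    by (rule cutoff_pair_DomA[OF t(1) _ fg(3)])
  have "pair_norm (x - (\<phi>, ?g n)) = sqrt ((L2R_norm (\<lambda>x. f x - \<phi> x))\<^sup>2 + (L2R_norm (\<lambda>x. g x - ?g n x))\<^sup>2)"
    unfolding fg dsum_norm_def by (simp add: fun_diff_def)
  also have "\<dots> < e"
    by (rule real_less_lsqrt) (use \<phi>(2) n e in auto)
  finally show "\<exists>y\<in>DomA lam. pair_norm (x - y) < e" using D by blast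
qed

theorem proposition4p2:
  fixes lam :: real
  assumes "lam < -1"
  shows "closed_operator pair_scale (L2R \<times> L2R) (dsum_norm L2R_norm L2R_norm) (DomA lam) A
    \<and> resolvent_set pair_scale (L2R \<times> L2R) (dsum_norm L2R_norm L2R_norm) (DomA lam) A \<noteq> {}
    \<and> dense_in (dsum_norm DS_norm L2R_norm) (DomA lam) (DS lam \<times> L2R)
    \<and> dense_in (dsum_norm L2R_norm L2R_norm) (DomA lam) (L2R \<times> L2R)"
  using closed_A resolvent_A DomA_dense_DS DomA_dense_L2 by blast

end
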